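(* Let $\varphi:\mathbb{R}^n\to\mathbb{R}$ be smooth, and set $V_1=\frac14|\nabla\varphi|^2-\frac12\triangle\varphi$ and $V_2=\frac14|\nabla\varphi|^2+\frac12\triangle\varphi$. Let $r>0$ and let $\mathbb{B}(x,r)$ denote the ball with center $x$ and radius $r$. (1) Suppose that $V_1$ is semi-bounded from below, and suppose that there is $\gamma>0$ such that for any discrete sequence $(x_l)_l\subset\mathbb{R}^n$ (i.e. $|x_l|\to\infty$) and any compact sets $F_l\subset\mathbb{B}(x_l,r)$ with $\lambda(F_l)\le\gamma r^n$ it holds that $$\int_{\mathbb{B}(x_l,r)\setminus F_l}\left(\frac14|\nabla\varphi|^2-\frac12\triangle\varphi\right)d\lambda\to\infty\quad\text{as}\quad l\to\infty.$$ Then the injection $H^1(\mathbb{R}^n,\varphi)\hookrightarrow L^2(\mathbb{R}^n,\varphi)$ is compact. (2) Suppose that $V_2$ is semi-bounded from below, and suppose that there is $\gamma>0$ such that for any discrete sequence $(x_l)_l\subset\mathbb{R}^n$ (i.e. $|x_l|\to\infty$) and any compact sets $F_l\subset\mathbb{B}(x_l,r)$ with $\lambda(F_l)\le\gamma r^n$ it holds that $$\int_{\mathbb{B}(x_l,r)\setminus F_l}\left(\frac14|\nabla\varphi|^2+\frac12\triangle\varphi\right)d\lambda\to\infty\quad\text{as}\quad l\to\infty.$$ Then the injection $H^1(\mathbb{R}^n,\varphi,\nabla\varphi)\hookrightarrow L^2(\mathbb{R}^n,\varphi)$ is compact.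
   Context: $\lambda$ is Lebesgue measure. A function $V$ is semi-bounded from below if $V\ge-C$ for some $C>0$. $L^2(\mathbb{R}^n,\varphi)$ is the space of measurable $f:\mathbb{R}^n\to\mathbb{C}$ with $\|f\|_\varphi^2=\int_{\mathbb{R}^n}|f|^2e^{-\varphi}\,d\lambda<\infty$. $H^1(\mathbb{R}^n,\varphi)$ is the space of $f\in L^2(\mathbb{R}^n,\varphi)$ with distributional derivatives $\frac{\partial f}{\partial x_j}\in L^2(\mathbb{R}^n,\varphi)$ for $1\le j\le n$, with norm $\|f\|_{1,\varphi}^2=\|f\|_\varphi^2+\sum_{j=1}^n\|\frac{\partial f}{\partial x_j}\|_\varphi^2$. With $X_j=\frac{\partial}{\partial x_j}-\frac{\partial\varphi}{\partial x_j}$ (the second term acting by multiplication), $H^1(\mathbb{R}^n,\varphi,\nabla\varphi)$ is the space of $f\in L^2(\mathbb{R}^n,\varphi)$ with $X_jf\in L^2(\mathbb{R}^n,\varphi)$ (in the sense of distributions) for $1\le j\le n$, with norm $\|f\|_{\varphi,\nabla\varphi}^2=\|f\|_\varphi^2+\sum_{j=1}^n\|X_jf\|_\varphi^2$.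
   Formalization: The divergence condition is required for every r>0 with one γ independent of r; with a single fixed r the claim is false (n=1, r=10: V_1 huge on part of each [4k,4k+1] and zero in the gaps, where bumps give a bounded non-compact sequence). *)

theory Defs
  imports "HOL-Analysis.Analysis"
begin

definition partial :: "'n::finite \<Rightarrow> (real^'n \<Rightarrow> 'b::real_normed_vector) \<Rightarrow> real^'n \<Rightarrow> 'b" where
  "partial j f x = frechet_derivative f (at x) (axis j 1)"

definition gradient :: "(real^'n::finite \<Rightarrow> real) \<Rightarrow> real^'n \<Rightarrow> real^'n" where
  "gradient f x = (\<chi> j. partial j f x)"

definition laplacian :: "(real^'n::finite \<Rightarrow> real) \<Rightarrow> real^'n \<Rightarrow> real" where
  "laplacian f x = (\<Sum>j\<in>UNIV. partial j (partial j f) x)"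

primrec C_k :: "nat \<Rightarrow> (real^'n::finite \<Rightarrow> 'b::real_normed_vector) \<Rightarrow> bool" where
  "C_k 0 f \<longleftrightarrow> continuous_on UNIV f"
| "C_k (Suc k) f \<longleftrightarrow> (\<forall>x. f differentiable (at x)) \<and> (\<forall>j. C_k k (partial j f))"

definition smooth :: "(real^'n::finite \<Rightarrow> 'b::real_normed_vector) \<Rightarrow> bool" where
  "smooth f \<longleftrightarrow> (\<forall>k. C_k k f)"

definition semibounded_below :: "('a \<Rightarrow> real) \<Rightarrow> bool" where
  "semibounded_below V \<longleftrightarrow> (\<exists>C>0. \<forall>x. V x \<ge> - C)"

(* The radius r is arbitrary and \<gamma> does not depend on it (hence the normalisation by r ^ n).
   With one fixed r the condition would not give compactness: a potential tending to infinity
   only on the intervals [4k, 4k+1] of the line and vanishing between them satisfies it for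
   r = 10, while normalised bumps in the gaps have bounded energy and pairwise
   disjoint supports. *)
definition diverges_off_small_sets :: "(real^'n::finite \<Rightarrow> real) \<Rightarrow> real \<Rightarrow> bool" where
  "diverges_off_small_sets V \<gamma> \<longleftrightarrow>
     (\<forall>r>0. \<forall>(x :: nat \<Rightarrow> real^'n) (F :: nat \<Rightarrow> (real^'n) set).
        filterlim (\<lambda>l. norm (x l)) at_top sequentially \<longrightarrow>
        (\<forall>l. compact (F l) \<and> F l \<subseteq> ball (x l) r \<and>
             measure lebesgue (F l) \<le> \<gamma> * r ^ CARD('n)) \<longrightarrow>
        filterlim (\<lambda>l. LINT y:(ball (x l) r - F l)|lebesgue. V y) at_top sequentially)"

(* Elements of the function spaces are functions rather than classes modulo equality
   almost everywhere; the norms below are accordingly seminorms. *)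

definition L2 :: "(real^'n::finite \<Rightarrow> real) \<Rightarrow> (real^'n \<Rightarrow> complex) set" where
  "L2 \<phi> = {f \<in> borel_measurable lebesgue.
             integrable lebesgue (\<lambda>x. (cmod (f x))\<^sup>2 * exp (- \<phi> x))}"

definition L2_norm :: "(real^'n::finite \<Rightarrow> real) \<Rightarrow> (real^'n \<Rightarrow> complex) \<Rightarrow> real" where
  "L2_norm \<phi> f = sqrt (LINT x|lebesgue. (cmod (f x))\<^sup>2 * exp (- \<phi> x))"

definition test_functions :: "(real^'n::finite \<Rightarrow> complex) set" where
  "test_functions = {\<psi>. smooth \<psi> \<and> compact (closure {x. \<psi> x \<noteq> 0})}"

(* Distributions are represented by their action on test functions. They are only formed
   from f in L2 \<phi> with \<phi> continuous; such f are locally integrable, so the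
   integrals defining regular_dist f converge. *)

type_synonym 'n distr = "(real^'n \<Rightarrow> complex) \<Rightarrow> complex"

definition regular_dist :: "(real^'n::finite \<Rightarrow> complex) \<Rightarrow> 'n distr" where
  "regular_dist f \<psi> = (LINT x|lebesgue. f x * \<psi> x)"

definition dist_deriv :: "'n::finite \<Rightarrow> 'n distr \<Rightarrow> 'n distr" where
  "dist_deriv j T \<psi> = - T (partial j \<psi>)"

definition dist_mult :: "(real^'n::finite \<Rightarrow> real) \<Rightarrow> 'n distr \<Rightarrow> 'n distr" where
  "dist_mult a T \<psi> = T (\<lambda>x. complex_of_real (a x) * \<psi> x)"

definition X_op :: "(real^'n::finite \<Rightarrow> real) \<Rightarrow> 'n \<Rightarrow> 'n distr \<Rightarrow> 'n distr" where
  "X_op \<phi> j T \<psi> = dist_deriv j T \<psi> - dist_mult (partial j \<phi>) T \<psi>"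

definition represents_in_L2 ::
    "(real^'n::finite \<Rightarrow> real) \<Rightarrow> (real^'n \<Rightarrow> complex) \<Rightarrow> 'n distr \<Rightarrow> bool" where
  "represents_in_L2 \<phi> g T \<longleftrightarrow> g \<in> L2 \<phi> \<and> (\<forall>\<psi>\<in>test_functions. T \<psi> = regular_dist g \<psi>)"

definition dist_in_L2 :: "(real^'n::finite \<Rightarrow> real) \<Rightarrow> 'n distr \<Rightarrow> bool" where
  "dist_in_L2 \<phi> T \<longleftrightarrow> (\<exists>g. represents_in_L2 \<phi> g T)"

(* The representative g is unique almost everywhere, so this does not depend on the choice. *)
definition dist_L2_norm :: "(real^'n::finite \<Rightarrow> real) \<Rightarrow> 'n distr \<Rightarrow> real" where
  "dist_L2_norm \<phi> T = L2_norm \<phi> (SOME g. represents_in_L2 \<phi> g T)"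

definition H1 :: "(real^'n::finite \<Rightarrow> real) \<Rightarrow> (real^'n \<Rightarrow> complex) set" where
  "H1 \<phi> = {f \<in> L2 \<phi>. \<forall>j. dist_in_L2 \<phi> (dist_deriv j (regular_dist f))}"

definition H1_norm :: "(real^'n::finite \<Rightarrow> real) \<Rightarrow> (real^'n \<Rightarrow> complex) \<Rightarrow> real" where
  "H1_norm \<phi> f = sqrt ((L2_norm \<phi> f)\<^sup>2 +
     (\<Sum>j\<in>UNIV. (dist_L2_norm \<phi> (dist_deriv j (regular_dist f)))\<^sup>2))"

definition H1_grad :: "(real^'n::finite \<Rightarrow> real) \<Rightarrow> (real^'n \<Rightarrow> complex) set" where
  "H1_grad \<phi> = {f \<in> L2 \<phi>. \<forall>j. dist_in_L2 \<phi> (X_op \<phi> j (regular_dist f))}"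

definition H1_grad_norm :: "(real^'n::finite \<Rightarrow> real) \<Rightarrow> (real^'n \<Rightarrow> complex) \<Rightarrow> real" where
  "H1_grad_norm \<phi> f = sqrt ((L2_norm \<phi> f)\<^sup>2 +
     (\<Sum>j\<in>UNIV. (dist_L2_norm \<phi> (X_op \<phi> j (regular_dist f)))\<^sup>2))"

(* Compactness of the inclusion of (A, N) into (B, M): bounded sequences of (A, N) have
   subsequences converging in (B, M). The sequential form is insensitive to N and M being
   seminorms on functions instead of norms on classes of functions. *)
definition compact_injection ::
    "('a \<Rightarrow> complex) set \<Rightarrow> (('a \<Rightarrow> complex) \<Rightarrow> real) \<Rightarrow>
     ('a \<Rightarrow> complex) set \<Rightarrow> (('a \<Rightarrow> complex) \<Rightarrow> real) \<Rightarrow> bool" where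
  "compact_injection A N B M \<longleftrightarrow> A \<subseteq> B \<and>
     (\<forall>u :: nat \<Rightarrow> 'a \<Rightarrow> complex.
        (\<forall>k. u k \<in> A) \<and> (\<exists>K. \<forall>k. N (u k) \<le> K) \<longrightarrow>
        (\<exists>g\<in>B. \<exists>s. strict_mono s \<and> (\<lambda>k. M (\<lambda>x. u (s k) x - g x)) \<longlonglongrightarrow> 0))"

end

theory Submission
  imports Defs "HOL-Complex_Analysis.Great_Picard"
begin

text \<open>
  Put \<open>u = exp(-\<phi>/2) f\<close>. Then \<open>exp(-\<phi>/2) \<partial>\<^sub>jf = D\<^sub>ju\<close> with \<open>D\<^sub>j = \<partial>\<^sub>j + \<partial>\<^sub>j\<phi>/2\<close>, while \<open>X\<^sub>j\<close> turns into the same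
  operator for \<open>-\<phi>\<close>, so both parts are one statement about unweighted \<open>L\<^sup>2\<close>. For compactly supported \<open>w\<close> of class
  \<open>C\<^sup>1\<close>, integration by parts gives \<open>\<Sum>\<^sub>j\<parallel>D\<^sub>jw\<parallel>\<^sup>2 = \<integral>|\<nabla>w|\<^sup>2 + V|w|\<^sup>2\<close>, where \<open>V\<close> is \<open>V\<^sub>1\<close>, respectively \<open>V\<^sub>2\<close>.
  Tile the space by cubes of side \<open>s\<close>. On a cube near the origin the Poincare inequality bounds \<open>\<integral>|w|\<^sup>2\<close>
  by a multiple of \<open>s\<^sup>2\<integral>|\<nabla>w|\<^sup>2\<close> plus the square of the mean of \<open>w\<close>. On a far cube \<open>|w(y)|\<close> is, for every \<open>y\<close>,
  controlled either by the variation of \<open>w\<close>, if \<open>|w| \<le> |w(y)|/2\<close> on a set of large measure, or else by the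
  large mass of \<open>V\<close> off that set. Hence for every \<open>\<epsilon>\<close> the norm \<open>\<parallel>w\<parallel>\<^sup>2\<close> is at most \<open>\<epsilon>\<close> times the energy plus a
  multiple of finitely many squared means. Applied to differences, with a diagonal subsequence along which all
  means over all cubes converge, this yields a Cauchy subsequence; cutting off and mollifying
  reduces arbitrary \<open>u\<close> to \<open>C\<^sup>1\<close> functions of compact support.
\<close>

section \<open>Calculus of smooth functions\<close>

text \<open>The Poincare inequality gains only a factor \<open>s\<^sup>2\<close>, so the cubes must
  shrink with \<epsilon>, and the divergence hypothesis is applied at the radius
  \<open>s / 2\<close> of their inscribed balls. The normalisation by \<open>r ^ n\<close> makes
  this harmless: the threshold volume \<gamma> * (s / 2) ^ n is a fixed fraction of the cube volume,
  so the constant on far cubes is again a multiple of \<open>s\<^sup>2\<close>. The constants are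
  fixed in the order \<epsilon>, s, the mass M, the radius beyond which cubes are far, the finite
  set of near cubes. The potential is only semi-bounded; adding C makes it nonnegative at the price
  of C times the squared norm, which is absorbed by working with \<epsilon> / (1 + C). Sides are
  restricted to 1 / (m + 1), so that all means that can ever occur form one countable family and a
  single subsequence serves every \<epsilon>. In the approximation the twisted derivatives of the
  approximants need only stay bounded, not converge; crude constants therefore suffice.\<close>

lemma partial_eq: "(f has_derivative f') (at x) \<Longrightarrow> partial j f x = f' (axis j 1)"
  unfolding partial_def by (metis frechet_derivative_at)

lemma C_k_mono: "C_k (Suc k) f \<Longrightarrow> C_k k f"
proof (induction k arbitrary: f)
  case 0
  then show ?case
    by (auto simp: continuous_on_eq_continuous_at intro: differentiable_imp_continuous_within)
qed auto

lemma partial_add: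
  assumes "f differentiable (at x)" "g differentiable (at x)"
  shows "partial j (\<lambda>x. f x + g x) x = partial j f x + partial j g x"
  using partial_eq[OF has_derivative_add[OF assms[unfolded frechet_derivative_works]], of j]
  by (simp add: partial_def)

lemma partial_mult:
  fixes f g :: "real^'n \<Rightarrow> 'b::real_normed_algebra"
  assumes "f differentiable (at x)" "g differentiable (at x)"
  shows "partial j (\<lambda>x. f x * g x) x = f x * partial j g x + partial j f x * g x"
  using partial_eq[OF has_derivative_mult[OF assms[unfolded frechet_derivative_works]], of j]
  by (simp add: partial_def)

lemma partial_bounded_linear:
  assumes "bounded_linear h" "f differentiable (at x)"
  shows "partial j (\<lambda>x. h (f x)) x = h (partial j f x)"
  using partial_eq[OF bounded_linear.has_derivative[OF assms(1) assms(2)[unfolded frechet_derivative_works]], of j]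
  by (simp add: partial_def)

lemma partial_const [simp]: "partial j (\<lambda>x. c) = (\<lambda>x. 0)"
  by (rule ext, subst partial_eq[OF has_derivative_const]) simp

lemma C_k_const: "C_k k (\<lambda>x. c)"
  by (induction k arbitrary: c) auto

lemma C_k_add:
  assumes "C_k k f" "C_k k g"
  shows "C_k k (\<lambda>x. f x + g x)"
  using assms
proof (induction k arbitrary: f g)
  case (Suc k)
  then have "partial j (\<lambda>x. f x + g x) = (\<lambda>x. partial j f x + partial j g x)" for j
    by (auto simp: partial_add)
  with Suc show ?case by (auto intro: differentiable_add)
qed (auto intro: continuous_on_add)

lemma C_k_mult:
  fixes f g :: "real^'n::finite \<Rightarrow> 'b::real_normed_algebra"
  assumes "C_k k f" "C_k k g"
  shows "C_k k (\<lambda>x. f x * g x)"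
  using assms
proof (induction k arbitrary: f g)
  case (Suc k)
  then have eq: "partial j (\<lambda>x. f x * g x) = (\<lambda>x. f x * partial j g x + partial j f x * g x)" for j
    by (auto simp: partial_mult)
  have "C_k k f" "C_k k g"
    using Suc.prems by (auto intro!: C_k_mono simp del: C_k.simps)
  with Suc show ?case
    by (auto simp: eq intro!: C_k_add differentiable_mult)
qed (auto intro: continuous_on_mult)

lemma C_k_bounded_linear:
  assumes "bounded_linear h" "C_k k f"
  shows "C_k k (\<lambda>x. h (f x))"
  using assms(2)
proof (induction k arbitrary: f)
  case 0
  then show ?case using assms(1) by (auto intro: bounded_linear.continuous_on)
next
  case (Suc k)
  then have eq: "partial j (\<lambda>x. h (f x)) = (\<lambda>x. h (partial j f x))" for j
    by (auto simp: partial_bounded_linear[OF assms(1)])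
  have "(\<lambda>x. h (f x)) differentiable at x" for x
    using Suc.prems assms(1) bounded_linear.has_derivative unfolding differentiable_def C_k.simps by blast
  with Suc show ?case by (auto simp: eq)
qed

lemma partial_exp:
  fixes f :: "real^'n::finite \<Rightarrow> real"
  assumes "f differentiable (at x)"
  shows "partial j (\<lambda>x. exp (f x)) x = exp (f x) * partial j f x"
proof -
  have "((\<lambda>x. exp (f x)) has_derivative (\<lambda>v. exp (f x) * frechet_derivative f (at x) v)) (at x)"
    using assms[unfolded frechet_derivative_works] by (auto intro!: derivative_eq_intros)
  from partial_eq[OF this] show ?thesis by (simp add: partial_def)
qed

lemma C_k_exp:
  fixes f :: "real^'n::finite \<Rightarrow> real"
  assumes "C_k k f"
  shows "C_k k (\<lambda>x. exp (f x))"
  using assms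
proof (induction k)
  case (Suc k)
  then have eq: "partial j (\<lambda>x. exp (f x)) = (\<lambda>x. exp (f x) * partial j f x)" for j
    by (auto simp: partial_exp)
  have "(\<lambda>x. exp (f x)) differentiable at x" for x
    using Suc.prems by (auto simp: differentiable_def intro!: derivative_eq_intros)
  moreover have "C_k k (\<lambda>x. exp (f x))"
    using Suc.IH C_k_mono[OF Suc.prems] by simp
  ultimately show ?case using Suc.prems by (auto simp: eq intro!: C_k_mult)
qed (auto intro!: continuous_intros)

lemma C_k_prod:
  fixes f :: "'i \<Rightarrow> real^'n::finite \<Rightarrow> real"
  assumes "\<And>i. i \<in> I \<Longrightarrow> C_k k (f i)"
  shows "C_k k (\<lambda>x. \<Prod>i\<in>I. f i x)"
  using assms by (induction I rule: infinite_finite_induct) (auto intro: C_k_const C_k_mult)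

text \<open>The sequence H lists a function together with all its derivatives; since m is arbitrary
  in the induction, each partial derivative is a constant multiple of a function of the same kind.
  The signs \<open>b = 1\<close> and \<open>b = - 1\<close> give the two factors of
  \<open>bump\<close>.\<close>

lemma C_k_coordinate:
  fixes H :: "nat \<Rightarrow> real \<Rightarrow> real"
  assumes "\<And>m t. (H m has_real_derivative H (Suc m) t) (at t)"
  shows "C_k k (\<lambda>x::real^'n::finite. H m (a + b * x $ i))"
proof (induction k arbitrary: m)
  case 0
  have "continuous_on UNIV (H m)"
    using assms DERIV_continuous by (metis continuous_at_imp_continuous_on)
  then show ?case
    by (auto intro!: continuous_on_compose2[of UNIV "H m"] continuous_intros)
next
  case (Suc k)
  have D: "((\<lambda>x::real^'n. H m (a + b * x $ i)) has_derivative (\<lambda>v. H (Suc m) (a + b * x $ i) * (b * v $ i))) (at x)" for x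
  proof -
    have "((\<lambda>x::real^'n. a + b * x $ i) has_derivative (\<lambda>v. b * v $ i)) (at x)"
      by (auto intro!: derivative_eq_intros bounded_linear_imp_has_derivative bounded_linear_vec_nth)
    from DERIV_compose_FDERIV[OF assms this] show ?thesis
      by (simp add: mult_ac)
  qed
  have "partial j (\<lambda>x::real^'n. H m (a + b * x $ i)) = (\<lambda>x. (b * axis j 1 $ i) * H (Suc m) (a + b * x $ i))" for j
    by (rule ext, subst partial_eq[OF D]) (simp add: mult_ac)
  moreover have "C_k k (\<lambda>x::real^'n. (b * axis j (1::real) $ i) * H (Suc m) (a + b * x $ i))" for j
    by (intro C_k_mult C_k_const Suc)
  ultimately show ?case using D by (auto simp: differentiable_def)
qed

lemma smooth_partial: "smooth f \<Longrightarrow> smooth (partial j f)"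
  unfolding smooth_def using C_k.simps(2) by blast

lemma smooth_differentiable: "smooth f \<Longrightarrow> f differentiable (at x)"
  unfolding smooth_def using C_k.simps(2) by blast

lemma smooth_continuous_on: "smooth f \<Longrightarrow> continuous_on A f"
  unfolding smooth_def using C_k.simps(1) continuous_on_subset by blast

lemma smooth_mult:
  fixes f g :: "real^'n::finite \<Rightarrow> 'b::real_normed_algebra"
  shows "smooth f \<Longrightarrow> smooth g \<Longrightarrow> smooth (\<lambda>x. f x * g x)"
  by (auto simp: smooth_def intro: C_k_mult)

lemma smooth_const: "smooth (\<lambda>x. c)"
  by (auto simp: smooth_def intro: C_k_const)

lemma smooth_bounded_linear: "bounded_linear h \<Longrightarrow> smooth f \<Longrightarrow> smooth (\<lambda>x. h (f x))"
  by (auto simp: smooth_def intro: C_k_bounded_linear)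

lemma smooth_exp: "smooth f \<Longrightarrow> smooth (\<lambda>x. exp (f x :: real))"
  by (auto simp: smooth_def intro: C_k_exp)

lemma partial_affine:
  assumes "f differentiable (at (a + c *\<^sub>R x))"
  shows "(\<lambda>y. f (a + c *\<^sub>R y)) differentiable (at x)"
    and "partial j (\<lambda>y. f (a + c *\<^sub>R y)) x = c *\<^sub>R partial j f (a + c *\<^sub>R x)"
proof -
  have "((\<lambda>y. a + c *\<^sub>R y) has_derivative (\<lambda>v. c *\<^sub>R v)) (at x)"
    by (auto intro!: derivative_eq_intros)
  from has_derivative_compose[OF this assms[unfolded frechet_derivative_works]]
  have D: "((\<lambda>y. f (a + c *\<^sub>R y)) has_derivative (\<lambda>v. frechet_derivative f (at (a + c *\<^sub>R x)) (c *\<^sub>R v))) (at x)" .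
  then show "(\<lambda>y. f (a + c *\<^sub>R y)) differentiable (at x)" by (auto simp: differentiable_def)
  have "linear (frechet_derivative f (at (a + c *\<^sub>R x)))"
    using assms by (simp add: linear_frechet_derivative)
  then show "partial j (\<lambda>y. f (a + c *\<^sub>R y)) x = c *\<^sub>R partial j f (a + c *\<^sub>R x)"
    by (subst partial_eq[OF D]) (simp add: partial_def linear_scale)
qed

text \<open>Scalings produce the cutoffs and the mollifiers; the reflection \<open>c = - 1\<close>
  produces the test functions that evaluate a convolution at a point.\<close>

lemma C_k_affine: "C_k k f \<Longrightarrow> C_k k (\<lambda>y. f (a + c *\<^sub>R y))"
proof (induction k arbitrary: f)
  case 0
  then show ?case by (auto intro!: continuous_on_compose2[of UNIV f] continuous_intros)
next
  case (Suc k)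
  have "partial j (\<lambda>y. f (a + c *\<^sub>R y)) = (\<lambda>y. c *\<^sub>R partial j f (a + c *\<^sub>R y))" for j
    using Suc.prems by (auto simp: partial_affine)
  moreover have "C_k k (\<lambda>y. c *\<^sub>R partial j f (a + c *\<^sub>R y))" for j
    using Suc by (intro C_k_bounded_linear[OF bounded_linear_scaleR_right]) auto
  ultimately show ?case using Suc.prems by (auto intro: partial_affine)
qed

lemma smooth_affine: "smooth f \<Longrightarrow> smooth (\<lambda>y. f (a + c *\<^sub>R y))"
  by (auto simp: smooth_def intro: C_k_affine)

lemma has_derivative_partial:
  fixes f :: "real^'n::finite \<Rightarrow> 'b::real_normed_vector"
  assumes "f differentiable (at x)"
  shows "(f has_derivative (\<lambda>v. \<Sum>j\<in>UNIV. v $ j *\<^sub>R partial j f x)) (at x)"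
proof -
  have D: "(f has_derivative frechet_derivative f (at x)) (at x)"
    using assms frechet_derivative_works by blast
  interpret bounded_linear "frechet_derivative f (at x)"
    using D by (rule has_derivative_bounded_linear)
  have "frechet_derivative f (at x) v = (\<Sum>j\<in>UNIV. v $ j *\<^sub>R partial j f x)" for v
  proof -
    have "v = (\<Sum>j\<in>UNIV. v $ j *\<^sub>R axis j 1)"
      by (simp add: basis_expansion scalar_mult_eq_scaleR[symmetric])
    then have "frechet_derivative f (at x) v = frechet_derivative f (at x) (\<Sum>j\<in>UNIV. v $ j *\<^sub>R axis j 1)"
      by simp
    then show ?thesis by (simp add: sum scaleR partial_def)
  qed
  then have "frechet_derivative f (at x) = (\<lambda>v. \<Sum>j\<in>UNIV. v $ j *\<^sub>R partial j f x)" by auto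
  with D show ?thesis by simp
qed

section \<open>Bump functions\<close>

text \<open>The functions \<open>p(1/t) exp(-1/t)\<close>, extended by \<open>0\<close>, form a class closed under
  differentiation; this gives smoothness without computing higher derivatives.\<close>

definition flat_exp :: "real poly \<Rightarrow> real \<Rightarrow> real" where
  "flat_exp p t = (if t > 0 then poly p (1 / t) * exp (- 1 / t) else 0)"

text \<open>In the variable s = 1/t one has ds/dt = - \<open>s\<^sup>2\<close>, so p(s) exp(-s) has
  the t-derivative \<open>s\<^sup>2\<close> (p - p')(s) exp(-s); the polynomial
  \<open>[:0, 0, 1:]\<close> is this factor.\<close>

definition flat_exp_deriv :: "real poly \<Rightarrow> real poly" where
  "flat_exp_deriv p = [:0, 0, 1:] * (p - pderiv p)"

lemma poly_exp_neg_tendsto_0: "((\<lambda>s::real. poly p s * exp (- s)) \<longlongrightarrow> 0) at_top"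
proof -
  have "((\<lambda>s::real. (\<Sum>i\<le>degree p. coeff p i * (s ^ i / exp s))) \<longlongrightarrow> (\<Sum>i\<le>degree p. coeff p i * 0)) at_top"
    by (intro tendsto_intros tendsto_power_div_exp_0)
  then show ?thesis
    by (simp add: poly_altdef exp_minus sum_distrib_left divide_inverse mult_ac)
qed

lemma flat_exp_has_derivative:
  "(flat_exp p has_real_derivative flat_exp (flat_exp_deriv p) t) (at t)"
proof (cases t "0::real" rule: linorder_cases)
  case less
  have "((\<lambda>_. 0) has_real_derivative 0) (at t)" by simp
  then have "(flat_exp p has_real_derivative 0) (at t)"
    by (rule has_field_derivative_transform_within_open[where S="{..<0}"]) (use less in \<open>auto simp: flat_exp_def\<close>)
  then show ?thesis using less by (simp add: flat_exp_def)
next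
  case greater
  have "((\<lambda>t. poly p (1 / t) * exp (- 1 / t)) has_real_derivative flat_exp (flat_exp_deriv p) t) (at t)"
    using greater
    by (auto intro!: derivative_eq_intros DERIV_chain2[OF poly_DERIV]
      simp: flat_exp_def flat_exp_deriv_def field_simps power2_eq_square)
  then show ?thesis
    by (rule has_field_derivative_transform_within_open[where S="{0<..}"]) (use greater in \<open>auto simp: flat_exp_def\<close>)
next
  case equal
  \<comment> \<open>With s = 1/h the difference quotient at 0 is s p(s) exp(-s);
    \<open>pCons 0\<close> supplies the additional factor s.\<close>
  have "((\<lambda>s. poly (pCons 0 p) s * exp (- s)) \<longlongrightarrow> 0) at_top"
    by (rule poly_exp_neg_tendsto_0)
  then have "((\<lambda>h. poly (pCons 0 p) (inverse h) * exp (- inverse h)) \<longlongrightarrow> 0) (at_right (0::real))"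
    by (rule filterlim_compose[OF _ filterlim_inverse_at_top_right])
  then have "((\<lambda>h. (flat_exp p (0 + h) - flat_exp p 0) / h) \<longlongrightarrow> 0) (at_right 0)"
    by (rule Lim_transform_eventually)
       (auto simp: flat_exp_def eventually_at_filter field_simps)
  moreover have "((\<lambda>h. (flat_exp p (0 + h) - flat_exp p 0) / h) \<longlongrightarrow> 0) (at_left 0)"
    by (rule Lim_transform_eventually[of "\<lambda>_. 0"])
       (auto simp: flat_exp_def eventually_at_filter)
  ultimately have "((\<lambda>h. (flat_exp p (0 + h) - flat_exp p 0) / h) \<longlongrightarrow> 0) (at 0)"
    by (simp add: filterlim_at_split)
  then show ?thesis
    using equal by (simp add: DERIV_def flat_exp_def)
qed

text \<open>A product of one-variable bumps, supported in the cube of all points with coordinates in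
  [-1, 1]. The factor \<open>exp 2\<close> normalises each of them to the value 1 at the origin,
  which is also its maximum.\<close>

definition bump :: "real^'n::finite \<Rightarrow> real" where
  "bump x = (\<Prod>i\<in>UNIV. exp 2 * (flat_exp 1 (1 + x $ i) * flat_exp 1 (1 - x $ i)))"

lemma smooth_bump: "smooth (bump :: real^'n::finite \<Rightarrow> real)"
proof -
  have *: "C_k k (\<lambda>x::real^'n. flat_exp p (a + b * x $ i))" for k p a b i
    using C_k_coordinate[of "\<lambda>m. flat_exp ((flat_exp_deriv ^^ m) p)" k 0 a b i] flat_exp_has_derivative by simp
  have "C_k k (\<lambda>x::real^'n. \<Prod>i\<in>UNIV. exp 2 * (flat_exp 1 (1 + 1 * x $ i) * flat_exp 1 (1 + (- 1) * x $ i)))" for k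
    by (intro C_k_prod C_k_mult C_k_const *)
  then show ?thesis by (simp add: smooth_def bump_def[abs_def])
qed

lemma bump_nonneg: "bump x \<ge> 0"
  unfolding bump_def flat_exp_def by (auto intro!: prod_nonneg)

lemma bump_0: "bump 0 = 1"
  unfolding bump_def flat_exp_def by (simp add: exp_add[symmetric])

text \<open>If all coordinates were below 1 in modulus, the sum norm, hence the Euclidean norm,
  would be below n. The crude radius n is all that is needed later.\<close>

lemma bump_eq_0:
  fixes x :: "real^'n::finite"
  assumes "norm x \<ge> real CARD('n)"
  shows "bump x = 0"
proof -
  have "\<exists>i. \<bar>x $ i\<bar> \<ge> 1"
  proof (rule ccontr)
    assume "\<not> ?thesis"
    then have *: "\<bar>x $ i\<bar> < 1" for i by (meson not_le)
    have "norm x \<le> (\<Sum>i\<in>UNIV. \<bar>x $ i\<bar>)" by (rule norm_le_l1_cart)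
    also have "\<dots> < (\<Sum>i\<in>(UNIV::'n set). 1)" by (rule sum_strict_mono) (use * in auto)
    finally show False using assms by simp
  qed
  then obtain i where "\<bar>x $ i\<bar> \<ge> 1" ..
  then have "exp 2 * (flat_exp 1 (1 + x $ i) * flat_exp 1 (1 - x $ i)) = 0"
    by (auto simp: flat_exp_def)
  then show ?thesis unfolding bump_def by (intro prod_zero) auto
qed

section \<open>Poincare inequality on convex sets\<close>

definition grad_sq :: "(real^'n::finite \<Rightarrow> 'b::real_normed_vector) \<Rightarrow> real^'n \<Rightarrow> real" where
  "grad_sq w x = (\<Sum>j\<in>UNIV. (norm (partial j w x))\<^sup>2)"

lemma grad_sq_nonneg [simp]: "grad_sq w x \<ge> 0"
  by (auto simp: grad_sq_def intro: sum_nonneg)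

lemma C_k_1_iff: "C_k 1 w \<longleftrightarrow> (\<forall>x. w differentiable (at x)) \<and> (\<forall>j. continuous_on UNIV (partial j w))"
  by simp

lemma C_k_1_continuous: "C_k 1 w \<Longrightarrow> continuous_on A w"
  using C_k_mono[of 0 w] continuous_on_subset by auto

lemma continuous_on_grad_sq: "C_k 1 w \<Longrightarrow> continuous_on A (grad_sq w)"
  unfolding grad_sq_def
  by (intro continuous_intros) (auto intro: continuous_on_subset)

lemma norm_directional_le:
  fixes v :: "real^'n::finite"
  shows "(norm (\<Sum>j\<in>UNIV. v $ j *\<^sub>R partial j w x))\<^sup>2 \<le> (norm v)\<^sup>2 * grad_sq w x"
proof -
  have "norm (\<Sum>j\<in>UNIV. v $ j *\<^sub>R partial j w x) \<le> (\<Sum>j\<in>UNIV. \<bar>v $ j\<bar> * \<bar>norm (partial j w x)\<bar>)"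
    by (rule order_trans[OF norm_sum]) simp
  also have "\<dots> \<le> L2_set (\<lambda>j. v $ j) UNIV * L2_set (\<lambda>j. norm (partial j w x)) UNIV"
    by (rule L2_set_mult_ineq)
  finally have "(norm (\<Sum>j\<in>UNIV. v $ j *\<^sub>R partial j w x))\<^sup>2 \<le> (L2_set (\<lambda>j. v $ j) UNIV * L2_set (\<lambda>j. norm (partial j w x)) UNIV)\<^sup>2"
    by (rule power_mono) simp
  also have "\<dots> = (norm v)\<^sup>2 * grad_sq w x"
    by (simp add: power_mult_distrib grad_sq_def L2_set_def norm_vec_def sum_nonneg)
  finally show ?thesis .
qed

text \<open>Jensen's inequality along the segment: a is the mean of the derivative f', so
  integrating the nonnegative function \<open>(norm (f' t - a))\<^sup>2\<close> gives the integral
  of \<open>(norm (f' t))\<^sup>2\<close> minus \<open>(norm a)\<^sup>2\<close>. The extended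
  nonnegative form prepares for Tonelli.\<close>

lemma norm_increment_le:
  fixes w :: "real^'n::finite \<Rightarrow> complex"
  assumes w: "C_k 1 w"
  shows "ennreal ((norm (w y - w x))\<^sup>2) \<le>
    (\<integral>\<^sup>+t. ennreal ((norm (y - x))\<^sup>2 * grad_sq w ((1 - t) *\<^sub>R x + t *\<^sub>R y)) * indicator {0..1} t \<partial>lborel)"
proof -
  define p where "p = (\<lambda>t::real. (1 - t) *\<^sub>R x + t *\<^sub>R y)"
  define f' where "f' = (\<lambda>t. \<Sum>j\<in>UNIV. (y - x) $ j *\<^sub>R partial j w (p t))"
  define a where "a = w y - w x"
  have p: "continuous_on A p" for A unfolding p_def by (intro continuous_intros)
  have "continuous_on UNIV (partial j w)" for j using w by simp
  then have "continuous_on A (\<lambda>t. partial j w (p t))" for j A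
    by (rule continuous_on_compose2[OF _ p]) simp
  then have f'_cont: "continuous_on A f'" for A
    unfolding f'_def by (intro continuous_intros)
  have "((\<lambda>t. w (p t)) has_vector_derivative f' t) (at t within {0..1})" for t
  proof -
    have 1: "(p has_derivative (\<lambda>h. h *\<^sub>R (y - x))) (at t within {0..1})"
    proof -
      have "p = (\<lambda>t. x + t *\<^sub>R (y - x))" by (simp add: p_def fun_eq_iff scaleR_left_diff_distrib scaleR_right_diff_distrib)
      then show ?thesis by (auto intro!: derivative_eq_intros)
    qed
    have 2: "(w has_derivative (\<lambda>v. \<Sum>j\<in>UNIV. v $ j *\<^sub>R partial j w (p t))) (at (p t))"
      using w by (intro has_derivative_partial) simp
    show ?thesis
      using diff_chain_within[OF 1 has_derivative_at_withinI[OF 2]]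
      by (simp add: has_vector_derivative_def f'_def o_def scaleR_sum_right)
  qed
  then have "(f' has_integral (w (p 1) - w (p 0))) {0..1}"
    by (intro fundamental_theorem_of_calculus) auto
  then have I: "(f' has_integral a) {0..1}" by (simp add: p_def a_def)
  have "((\<lambda>t. f' t \<bullet> a) has_integral a \<bullet> a) {0..1}"
    using has_integral_linear[OF I bounded_linear_inner_left[of a]] by (simp add: o_def)
  moreover have ii: "(\<lambda>t. (norm (f' t))\<^sup>2) integrable_on {0..1}"
    by (intro integrable_continuous_real continuous_intros f'_cont)
  ultimately have "((\<lambda>t. (norm (f' t))\<^sup>2 - 2 * (f' t \<bullet> a) + a \<bullet> a) has_integral
      (integral {0..1} (\<lambda>t. (norm (f' t))\<^sup>2) - 2 * (a \<bullet> a) + a \<bullet> a)) {0..1}"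
    using has_integral_const_real[of "a \<bullet> a" 0 1]
    by (intro has_integral_add has_integral_diff has_integral_mult_right) (auto simp: integrable_integral)
  moreover have "(norm (f' t))\<^sup>2 - 2 * (f' t \<bullet> a) + a \<bullet> a = (norm (f' t - a))\<^sup>2" for t
    unfolding power2_norm_eq_inner by (simp add: inner_diff_left inner_diff_right inner_commute)
  ultimately have "((\<lambda>t. (norm (f' t - a))\<^sup>2) has_integral
      (integral {0..1} (\<lambda>t. (norm (f' t))\<^sup>2) - 2 * (a \<bullet> a) + a \<bullet> a)) {0..1}"
    by (simp only:)
  then have "0 \<le> integral {0..1} (\<lambda>t. (norm (f' t))\<^sup>2) - 2 * (a \<bullet> a) + a \<bullet> a"
    by (rule has_integral_nonneg) simp
  then have "(norm a)\<^sup>2 \<le> integral {0..1} (\<lambda>t. (norm (f' t))\<^sup>2)"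
    by (simp add: power2_norm_eq_inner)
  also have "\<dots> = (LINT t:{0..1}|lborel. (norm (f' t))\<^sup>2)"
    by (intro set_borel_integral_eq_integral(2)[symmetric] borel_integrable_atLeastAtMost' continuous_intros f'_cont)
  finally have "ennreal ((norm a)\<^sup>2) \<le> ennreal (LINT t:{0..1}|lborel. (norm (f' t))\<^sup>2)"
    by (rule ennreal_leI)
  also have "\<dots> = (\<integral>\<^sup>+t. ennreal ((norm (f' t))\<^sup>2 * indicator {0..1} t) \<partial>lborel)"
    unfolding set_lebesgue_integral_def
  proof (subst nn_integral_eq_integral)
    show "integrable lborel (\<lambda>t. (norm (f' t))\<^sup>2 * indicator {0..1::real} t)"
    proof -
      have "continuous_on {0..1} (\<lambda>t. (norm (f' t))\<^sup>2)" by (intro continuous_intros f'_cont)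
      from borel_integrable_atLeastAtMost'[OF this] show ?thesis
        by (simp add: set_integrable_def mult.commute)
    qed
  qed (auto simp: mult.commute)
  also have "\<dots> \<le> (\<integral>\<^sup>+t. ennreal ((norm (y - x))\<^sup>2 * grad_sq w (p t)) * indicator {0..1} t \<partial>lborel)"
    using norm_directional_le[of "y - x" w]
    unfolding f'_def by (intro nn_integral_mono) (auto simp: indicator_def intro!: ennreal_leI)
  finally show ?thesis unfolding a_def p_def .
qed

lemma nn_integral_lborel_affine:
  fixes g :: "real^'n::finite \<Rightarrow> ennreal"
  assumes [measurable]: "g \<in> borel_measurable borel" and c: "c \<noteq> 0"
  shows "(\<integral>\<^sup>+x. g (t + c *\<^sub>R x) \<partial>lborel) = ennreal (inverse (\<bar>c\<bar> ^ CARD('n))) * (\<integral>\<^sup>+x. g x \<partial>lborel)"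
proof -
  have "(\<integral>\<^sup>+x. g x \<partial>lborel) = ennreal (\<bar>c\<bar> ^ CARD('n)) * (\<integral>\<^sup>+x. g (t + c *\<^sub>R x) \<partial>lborel)"
    by (subst lborel_affine[OF c, of t])
       (simp add: nn_integral_density nn_integral_distr nn_integral_cmult)
  then show ?thesis
    using c by (simp add: mult.assoc[symmetric] ennreal_mult[symmetric])
qed

text \<open>The inner integral is invariant under the translation by \<open>x' x\<close> and scales
  by the inverse of t ^ n, which is at most 2 ^ n; it is therefore bounded independently of x, and
  the outer integral contributes the measure of Q.\<close>

lemma double_integral_convex_combination_le:
  fixes g :: "real^'n::finite \<Rightarrow> ennreal"
  assumes g: "g \<in> borel_measurable borel" and Q: "Q \<in> sets borel" and t: "1/2 \<le> t"
  shows "(\<integral>\<^sup>+x. \<integral>\<^sup>+y. indicator Q x * g (x' x + t *\<^sub>R y) \<partial>lborel \<partial>lborel)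
    \<le> 2 ^ CARD('n) * emeasure lborel Q * (\<integral>\<^sup>+x. g x \<partial>lborel)"
proof -
  note [measurable] = g Q
  have "inverse (\<bar>t\<bar> ^ CARD('n)) \<le> 2 ^ CARD('n)"
  proof -
    have "(1/2) ^ CARD('n) \<le> \<bar>t\<bar> ^ CARD('n)" using t by (intro power_mono) auto
    then have "inverse (\<bar>t\<bar> ^ CARD('n)) \<le> inverse ((1/2) ^ CARD('n))"
      by (intro le_imp_inverse_le) auto
    then show ?thesis by (simp add: power_one_over)
  qed
  then have "ennreal (inverse (\<bar>t\<bar> ^ CARD('n))) \<le> ennreal (2 ^ CARD('n))" by (rule ennreal_leI)
  then have le: "ennreal (inverse (\<bar>t\<bar> ^ CARD('n))) \<le> 2 ^ CARD('n)"
    by (simp add: ennreal_power[symmetric])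
  have "(\<integral>\<^sup>+x. \<integral>\<^sup>+y. indicator Q x * g (x' x + t *\<^sub>R y) \<partial>lborel \<partial>lborel)
    = (\<integral>\<^sup>+x. indicator Q x * (ennreal (inverse (\<bar>t\<bar> ^ CARD('n))) * (\<integral>\<^sup>+x. g x \<partial>lborel)) \<partial>lborel)"
    using t by (simp add: nn_integral_cmult nn_integral_lborel_affine)
  also have "\<dots> = ennreal (inverse (\<bar>t\<bar> ^ CARD('n))) * emeasure lborel Q * (\<integral>\<^sup>+x. g x \<partial>lborel)"
    by (simp add: nn_integral_multc mult_ac)
  finally show ?thesis using le by (simp add: mult_right_mono)
qed

text \<open>Integrate along segments; for each \<open>t\<close> one of \<open>t\<close>, \<open>1 - t\<close> is at least \<open>1/2\<close>, and
  substituting in the corresponding end point costs at most a factor \<open>2^n\<close>.\<close>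

lemma poincare_convex:
  fixes w :: "real^'n::finite \<Rightarrow> complex"
  assumes w: "C_k 1 w" and Q: "convex Q" "Q \<in> sets borel"
    and d: "\<And>x y. x \<in> Q \<Longrightarrow> y \<in> Q \<Longrightarrow> (norm (y - x))\<^sup>2 \<le> d"
  shows "(\<integral>\<^sup>+x\<in>Q. (\<integral>\<^sup>+y\<in>Q. ennreal ((norm (w y - w x))\<^sup>2) \<partial>lborel) \<partial>lborel)
    \<le> ennreal d * 2 ^ CARD('n) * emeasure lborel Q * (\<integral>\<^sup>+x\<in>Q. ennreal (grad_sq w x) \<partial>lborel)"
proof (cases "Q = {}")
  case False
  then have d0: "d \<ge> 0" using d by (meson ex_in_conv order_trans zero_le_power2)
  note [measurable] = Q(2)
  have [measurable]: "grad_sq w \<in> borel_measurable borel"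
    by (intro borel_measurable_continuous_onI continuous_on_grad_sq w)
  have [measurable]: "w \<in> borel_measurable borel"
    by (intro borel_measurable_continuous_onI C_k_1_continuous w)
  define g where "g = (\<lambda>x. ennreal (grad_sq w x) * indicator Q x)"
  have g [measurable]: "g \<in> borel_measurable borel" unfolding g_def by measurable
  \<comment> \<open>The constraints on x, y and t are carried as indicators, so that the three
    integrals run over full spaces and can be interchanged.\<close>
  define G where "G = (\<lambda>x y t. indicator Q x * (indicator Q y * (indicator {0..1} t * g ((1 - t) *\<^sub>R x + t *\<^sub>R y))) :: ennreal)"
  let ?K = "2 ^ CARD('n) * emeasure lborel Q * (\<integral>\<^sup>+x. g x \<partial>lborel)"
  have "(\<integral>\<^sup>+x\<in>Q. (\<integral>\<^sup>+y\<in>Q. ennreal ((norm (w y - w x))\<^sup>2) \<partial>lborel) \<partial>lborel)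
    \<le> (\<integral>\<^sup>+x. \<integral>\<^sup>+y. \<integral>\<^sup>+t. ennreal d * G x y t \<partial>lborel \<partial>lborel \<partial>lborel)"
  proof -
    have "ennreal ((norm (w y - w x))\<^sup>2) * indicator Q y * indicator Q x \<le> (\<integral>\<^sup>+t. ennreal d * G x y t \<partial>lborel)" for x y
    proof (cases "x \<in> Q \<and> y \<in> Q")
      case True
      have "ennreal ((norm (w y - w x))\<^sup>2) \<le>
        (\<integral>\<^sup>+t. ennreal ((norm (y - x))\<^sup>2 * grad_sq w ((1 - t) *\<^sub>R x + t *\<^sub>R y)) * indicator {0..1} t \<partial>lborel)"
        by (rule norm_increment_le[OF w])
      also have "\<dots> \<le> (\<integral>\<^sup>+t. ennreal d * G x y t \<partial>lborel)"
      proof (rule nn_integral_mono)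
        fix t :: real
        show "ennreal ((norm (y - x))\<^sup>2 * grad_sq w ((1 - t) *\<^sub>R x + t *\<^sub>R y)) * indicator {0..1} t \<le> ennreal d * G x y t"
        proof (cases "t \<in> {0..1}")
          case t: True
          \<comment> \<open>Convexity keeps the intermediate point in Q, so cutting g off outside Q
            loses nothing here, and only the gradient on Q enters the bound.\<close>
          then have "(1 - t) *\<^sub>R x + t *\<^sub>R y \<in> Q" using Q(1) True by (intro convexD) auto
          with True t d0 d[of x y] show ?thesis
            by (auto simp: G_def g_def ennreal_mult[symmetric] intro!: ennreal_leI mult_right_mono)
        qed auto
      qed
      finally show ?thesis using True by simp
    qed auto
    then have "(\<integral>\<^sup>+x. \<integral>\<^sup>+y. ennreal ((norm (w y - w x))\<^sup>2) * indicator Q y * indicator Q x \<partial>lborel \<partial>lborel)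
       \<le> (\<integral>\<^sup>+x. \<integral>\<^sup>+y. \<integral>\<^sup>+t. ennreal d * G x y t \<partial>lborel \<partial>lborel \<partial>lborel)"
      by (intro nn_integral_mono)
    then show ?thesis by (simp add: nn_integral_multc)
  qed
  also have "\<dots> = ennreal d * (\<integral>\<^sup>+x. \<integral>\<^sup>+y. \<integral>\<^sup>+t. G x y t \<partial>lborel \<partial>lborel \<partial>lborel)"
  proof -
    have "(\<lambda>t. G x y t) \<in> borel_measurable lborel"
      "(\<lambda>y. \<integral>\<^sup>+t. G x y t \<partial>lborel) \<in> borel_measurable lborel"
      "(\<lambda>x. \<integral>\<^sup>+y. \<integral>\<^sup>+t. G x y t \<partial>lborel \<partial>lborel) \<in> borel_measurable lborel" for x y
      unfolding G_def by measurable
    then show ?thesis by (simp add: nn_integral_cmult)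
  qed
  also have "(\<integral>\<^sup>+x. \<integral>\<^sup>+y. \<integral>\<^sup>+t. G x y t \<partial>lborel \<partial>lborel \<partial>lborel) = (\<integral>\<^sup>+x. \<integral>\<^sup>+t. \<integral>\<^sup>+y. G x y t \<partial>lborel \<partial>lborel \<partial>lborel)"
    unfolding G_def by (intro nn_integral_cong lborel_pair.Fubini') measurable
  also have "\<dots> = (\<integral>\<^sup>+t. \<integral>\<^sup>+x. \<integral>\<^sup>+y. G x y t \<partial>lborel \<partial>lborel \<partial>lborel)"
    unfolding G_def by (intro lborel_pair.Fubini') measurable
  also have "\<dots> \<le> (\<integral>\<^sup>+t. ?K * indicator {0..1::real} t \<partial>lborel)"
  proof (rule nn_integral_mono)
    fix t :: real
    show "(\<integral>\<^sup>+x. \<integral>\<^sup>+y. G x y t \<partial>lborel \<partial>lborel) \<le> ?K * indicator {0..1::real} t"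
    proof (cases "t \<in> {0..1}")
      case True
      consider "1/2 \<le> t" | "1/2 \<le> 1 - t" by linarith
      then have "(\<integral>\<^sup>+x. \<integral>\<^sup>+y. G x y t \<partial>lborel \<partial>lborel) \<le> ?K"
      proof cases
        case 1
        have "(\<integral>\<^sup>+x. \<integral>\<^sup>+y. G x y t \<partial>lborel \<partial>lborel) \<le> (\<integral>\<^sup>+x. \<integral>\<^sup>+y. indicator Q x * g ((1 - t) *\<^sub>R x + t *\<^sub>R y) \<partial>lborel \<partial>lborel)"
          by (intro nn_integral_mono) (auto simp: G_def indicator_def)
        also have "\<dots> \<le> ?K" by (rule double_integral_convex_combination_le[OF g Q(2) 1])
        finally show ?thesis .
      next
        case 2
        have "(\<integral>\<^sup>+x. \<integral>\<^sup>+y. G x y t \<partial>lborel \<partial>lborel) = (\<integral>\<^sup>+y. \<integral>\<^sup>+x. G x y t \<partial>lborel \<partial>lborel)"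
          unfolding G_def by (intro lborel_pair.Fubini') measurable
        also have "\<dots> \<le> (\<integral>\<^sup>+y. \<integral>\<^sup>+x. indicator Q y * g (t *\<^sub>R y + (1 - t) *\<^sub>R x) \<partial>lborel \<partial>lborel)"
          by (intro nn_integral_mono) (auto simp: G_def indicator_def add.commute)
        also have "\<dots> \<le> ?K" by (rule double_integral_convex_combination_le[OF g Q(2) 2])
        finally show ?thesis .
      qed
      then show ?thesis using True by simp
    qed (simp add: G_def)
  qed
  also have "\<dots> = ?K" by (simp add: nn_integral_cmult_indicator)
  finally show ?thesis
    using d0 by (simp add: g_def mult_left_mono mult.assoc)
qed simp

section \<open>Estimates on a single cell, near the origin and far from it\<close>

text \<open>Cauchy-Schwarz against the indicator of Q. If h is not integrable over Q, the left side
  is 0 by the default value of the integral.\<close>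

lemma norm_set_integral_power2_le:
  fixes h :: "'a::euclidean_space \<Rightarrow> complex"
  assumes [measurable]: "h \<in> borel_measurable borel" "Q \<in> sets borel"
  shows "ennreal ((norm (LINT x:Q|lborel. h x))\<^sup>2) \<le> emeasure lborel Q * (\<integral>\<^sup>+x\<in>Q. ennreal ((norm (h x))\<^sup>2) \<partial>lborel)"
proof (cases "set_integrable lborel Q h")
  case True
  then have "ennreal (norm (LINT x:Q|lborel. h x)) \<le> (\<integral>\<^sup>+x. ennreal (norm (indicator Q x *\<^sub>R h x)) \<partial>lborel)"
    unfolding set_lebesgue_integral_def set_integrable_def by (rule integral_norm_bound_ennreal)
  also have "\<dots> = (\<integral>\<^sup>+x. indicator Q x * (ennreal (norm (h x)) * indicator Q x) \<partial>lborel)"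
    by (intro nn_integral_cong) (auto simp: indicator_def)
  finally have "(ennreal (norm (LINT x:Q|lborel. h x)))\<^sup>2 \<le> (\<integral>\<^sup>+x. indicator Q x * (ennreal (norm (h x)) * indicator Q x) \<partial>lborel)\<^sup>2"
    by (rule power_mono) simp
  also have "\<dots> \<le> (\<integral>\<^sup>+x. (indicator Q x)\<^sup>2 \<partial>lborel) * (\<integral>\<^sup>+x. (ennreal (norm (h x)) * indicator Q x)\<^sup>2 \<partial>lborel)"
    by (rule Cauchy_Schwarz_nn_integral) measurable
  also have "(\<integral>\<^sup>+x. (indicator Q x)\<^sup>2 \<partial>lborel) = (\<integral>\<^sup>+x. indicator Q x \<partial>lborel)"
    by (intro nn_integral_cong) (auto simp: indicator_def)
  also have "\<dots> = emeasure lborel Q" by simp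
  also have "(\<integral>\<^sup>+x. (ennreal (norm (h x)) * indicator Q x)\<^sup>2 \<partial>lborel) = (\<integral>\<^sup>+x\<in>Q. ennreal ((norm (h x))\<^sup>2) \<partial>lborel)"
    by (intro nn_integral_cong) (auto simp: indicator_def ennreal_power)
  finally show ?thesis by (simp add: ennreal_power)
next
  case False
  then have "(LINT x:Q|lborel. h x) = 0"
    by (simp add: set_lebesgue_integral_def set_integrable_def not_integrable_integral_eq)
  then show ?thesis by simp
qed

lemma C_k_1_borel_measurable: "C_k 1 w \<Longrightarrow> w \<in> borel_measurable borel"
  by (intro borel_measurable_continuous_onI C_k_1_continuous)

text \<open>For each x the vector \<open>\<mu> *\<^sub>R w x\<close> is the integral of w over Q
  minus the integral J of \<open>w y - w x\<close> in y. Cauchy-Schwarz bounds the square of J by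
  \<mu> times the integral of the squared increments; integrating over x in Q leaves the two
  terms.\<close>

lemma near_estimate:
  fixes w :: "real^'n::finite \<Rightarrow> complex"
  assumes w: "C_k 1 w" and Q: "Q \<in> sets borel" "bounded Q" "emeasure lborel Q = ennreal \<mu>" "\<mu> > 0"
  shows "(\<integral>\<^sup>+x\<in>Q. ennreal ((norm (w x))\<^sup>2) \<partial>lborel) \<le>
     ennreal (2 / \<mu>) * (\<integral>\<^sup>+x\<in>Q. (\<integral>\<^sup>+y\<in>Q. ennreal ((norm (w y - w x))\<^sup>2) \<partial>lborel) \<partial>lborel)
     + ennreal (2 / \<mu> * (norm (LINT x:Q|lborel. w x))\<^sup>2)"
proof -
  note [measurable] = Q(1) C_k_1_borel_measurable[OF w]
  define I where "I = (LINT x:Q|lborel. w x)"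
  have \<mu>: "measure lborel Q = \<mu>" using Q by (simp add: measure_def)
  obtain R where R: "Q \<subseteq> cball 0 R" using Q(2) by (auto simp: bounded_iff mem_cball_0 subset_eq)
  have "set_integrable lborel (cball 0 R) w"
    unfolding set_integrable_def by (intro borel_integrable_compact C_k_1_continuous w) simp
  then have wi: "set_integrable lborel Q w" by (rule set_integrable_subset) (use R in auto)
  have ci: "set_integrable lborel Q (\<lambda>y. c)" for c :: complex
    using Q by (auto simp: set_integrable_def less_top)
  have pt: "ennreal ((norm (w x))\<^sup>2) \<le> ennreal (2 / \<mu>) * (\<integral>\<^sup>+y\<in>Q. ennreal ((norm (w y - w x))\<^sup>2) \<partial>lborel) + ennreal (2 / \<mu>\<^sup>2 * (norm I)\<^sup>2)" for x
  proof -
    define J where "J = (LINT y:Q|lborel. w y - w x)"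
    have "J = I - (LINT y:Q|lborel. w x)"
      unfolding J_def I_def by (rule set_integral_diff(2)[OF wi ci])
    also have "(LINT y:Q|lborel. w x) = \<mu> *\<^sub>R w x"
      using Q \<mu> by (simp add: set_lebesgue_integral_def)
    finally have "\<mu> *\<^sub>R w x = I - J" by simp
    then have "(\<mu> * norm (w x))\<^sup>2 = (norm (I - J))\<^sup>2" using Q(4) by (metis abs_of_pos norm_scaleR)
    also have "\<dots> \<le> (norm I + norm J)\<^sup>2" by (intro power_mono norm_triangle_ineq4) simp
    also have "\<dots> \<le> 2 * (norm I)\<^sup>2 + 2 * (norm J)\<^sup>2"
      using sum_squares_bound[of "norm I" "norm J"] by (simp add: power2_sum)
    finally have "(norm (w x))\<^sup>2 \<le> 2 / \<mu>\<^sup>2 * (norm J)\<^sup>2 + 2 / \<mu>\<^sup>2 * (norm I)\<^sup>2"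
      using Q(4) by (simp add: field_simps power_mult_distrib)
    then have "ennreal ((norm (w x))\<^sup>2) \<le> ennreal (2 / \<mu>\<^sup>2) * ennreal ((norm J)\<^sup>2) + ennreal (2 / \<mu>\<^sup>2 * (norm I)\<^sup>2)"
      by (simp add: ennreal_mult[symmetric] ennreal_plus[symmetric] ennreal_leI del: ennreal_plus)
    also have "ennreal ((norm J)\<^sup>2) \<le> emeasure lborel Q * (\<integral>\<^sup>+y\<in>Q. ennreal ((norm (w y - w x))\<^sup>2) \<partial>lborel)"
      unfolding J_def by (rule norm_set_integral_power2_le) measurable
    also have "ennreal (2 / \<mu>\<^sup>2) * (emeasure lborel Q * (\<integral>\<^sup>+y\<in>Q. ennreal ((norm (w y - w x))\<^sup>2) \<partial>lborel))
       = ennreal (2 / \<mu>) * (\<integral>\<^sup>+y\<in>Q. ennreal ((norm (w y - w x))\<^sup>2) \<partial>lborel)"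
      using Q(4) unfolding Q(3) mult.assoc[symmetric]
      by (subst ennreal_mult[symmetric]) (auto simp: power2_eq_square)
    finally show ?thesis by (simp add: mult_left_mono add_right_mono)
  qed
  have "(\<integral>\<^sup>+x\<in>Q. ennreal ((norm (w x))\<^sup>2) \<partial>lborel) \<le>
    (\<integral>\<^sup>+x. ennreal (2 / \<mu>) * ((\<integral>\<^sup>+y\<in>Q. ennreal ((norm (w y - w x))\<^sup>2) \<partial>lborel) * indicator Q x)
       + ennreal (2 / \<mu>\<^sup>2 * (norm I)\<^sup>2) * indicator Q x \<partial>lborel)"
    by (intro nn_integral_mono) (use pt in \<open>auto simp: indicator_def\<close>)
  also have "\<dots> = ennreal (2 / \<mu>) * (\<integral>\<^sup>+x\<in>Q. (\<integral>\<^sup>+y\<in>Q. ennreal ((norm (w y - w x))\<^sup>2) \<partial>lborel) \<partial>lborel)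
     + ennreal (2 / \<mu>\<^sup>2 * (norm I)\<^sup>2) * ennreal \<mu>"
    using Q(3) by (simp add: nn_integral_add nn_integral_cmult nn_integral_cmult_indicator)
  also have "ennreal (2 / \<mu>\<^sup>2 * (norm I)\<^sup>2) * ennreal \<mu> = ennreal (2 / \<mu> * (norm I)\<^sup>2)"
    using Q(4) by (subst ennreal_mult[symmetric]) (auto simp: power2_eq_square)
  finally show ?thesis unfolding I_def .
qed

text \<open>Around a point \<open>y\<close> of the ball, either \<open>w\<close> is large off a small set, where the mass of
  \<open>W\<close> controls \<open>w y\<close>, or \<open>w\<close> differs from \<open>w y\<close> on a large set.\<close>

lemma far_estimate_pointwise:
  fixes w :: "real^'n::finite \<Rightarrow> complex" and W :: "real^'n \<Rightarrow> real"
  assumes w: "C_k 1 w" and W: "continuous_on UNIV W" "\<And>x. W x \<ge> 0" and M: "M > 0" and m: "m > 0"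
    and r: "r > 0"
    and H: "\<And>F. compact F \<Longrightarrow> F \<subseteq> ball a r \<Longrightarrow> measure lborel F \<le> m \<Longrightarrow> M \<le> (LINT x:ball a r - F|lborel. W x)"
  shows "ennreal ((norm (w y))\<^sup>2) \<le> ennreal (4 / M) * (\<integral>\<^sup>+x\<in>ball a r. ennreal (W x * (norm (w x))\<^sup>2) \<partial>lborel)
     + ennreal (4 / m) * (\<integral>\<^sup>+x\<in>ball a r. ennreal ((norm (w x - w y))\<^sup>2) \<partial>lborel)"
proof -
  let ?B = "ball a r"
  let ?q = "(norm (w y) / 2)\<^sup>2"
  note [measurable] = C_k_1_borel_measurable[OF w]
  have [measurable]: "W \<in> borel_measurable borel" by (intro borel_measurable_continuous_onI W)
  \<comment> \<open>The threshold half of \<open>norm (w y)\<close> serves both cases: off F the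
    function itself is at least that large, and on F its distance from \<open>w y\<close> is.
    Squaring the half produces the factor 4 in both terms.\<close>
  define F where "F = {x. norm (w x) \<le> norm (w y) / 2}"
  have F: "closed F" unfolding F_def
    by (intro closed_Collect_le continuous_intros C_k_1_continuous w)
  then have [measurable]: "F \<in> sets borel" by simp
  have "set_integrable lborel (cball a r) W"
    unfolding set_integrable_def by (intro borel_integrable_compact continuous_on_subset[OF W(1)]) auto
  then have Wi: "set_integrable lborel A W" if "A \<in> sets lborel" "A \<subseteq> ?B" for A
    by (rule set_integrable_subset) (use that in auto)
  have fin: "?B \<inter> F \<in> fmeasurable lborel"
    by (rule fmeasurableI2[of "?B"]) (auto simp: fmeasurable_def intro!: emeasure_bounded_finite[unfolded infinity_ennreal_def])
  show ?thesis
  proof (cases "measure lborel (?B \<inter> F) \<le> m")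
    case True
    \<comment> \<open>The hypothesis speaks only of compact subsets of the open ball, while F
      intersected with the ball need not be closed. It is exhausted by compact sets, and the lower
      bound M survives the limit of the decreasing complements.\<close>
    define Fm where "Fm = (\<lambda>k. F \<inter> cball a (r - r / real (Suc k)))"
    have Fm: "compact (Fm k)" "Fm k \<subseteq> ?B" for k
    proof -
      show "compact (Fm k)" unfolding Fm_def by (intro closed_Int_compact F compact_cball)
      have "r / real (Suc k) > 0" using r by simp
      then have "r - r / real (Suc k) < r" by linarith
      then show "Fm k \<subseteq> ?B"
        unfolding Fm_def subset_eq mem_ball by (meson IntD2 mem_cball order.strict_trans1)
    qed
    have [measurable]: "Fm k \<in> sets borel" for k
      by (rule borel_closed[OF compact_imp_closed[OF Fm(1)]])
    have "measure lborel (Fm k) \<le> m" for k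
    proof -
      have "measure lborel (Fm k) \<le> measure lborel (?B \<inter> F)"
        by (rule measure_mono_fmeasurable[OF _ _ fin]) (use Fm(2) in \<open>auto simp: Fm_def\<close>)
      with True show ?thesis by simp
    qed
    then have "M \<le> (LINT x:?B - Fm k|lborel. W x)" for k by (intro H Fm)
    moreover have "(\<lambda>k. LINT x:?B - Fm k|lborel. W x) \<longlonglongrightarrow> (LINT x:(\<Inter>k. ?B - Fm k)|lborel. W x)"
    proof (rule set_integral_cont_down)
      have "Fm i \<subseteq> Fm j" if "i \<le> j" for i j
      proof -
        have "r / real (Suc j) \<le> r / real (Suc i)" using that r by (intro divide_left_mono) auto
        then show ?thesis unfolding Fm_def by (intro Int_mono subset_cball) auto
      qed
      then show "decseq (\<lambda>k. ?B - Fm k)" by (fastforce simp: decseq_def)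
      show "set_integrable lborel (?B - Fm 0) W" by (rule Wi) auto
    qed auto
    moreover have "(\<Inter>k. ?B - Fm k) = ?B - F"
    proof -
      have "\<exists>k. x \<in> Fm k" if "x \<in> F" "x \<in> ?B" for x
      proof -
        have "(\<lambda>k. r - r / real (Suc k)) \<longlonglongrightarrow> r - 0"
          by (intro tendsto_intros LIMSEQ_Suc[OF lim_const_over_n])
        then have "\<forall>\<^sub>F k in sequentially. dist a x < r - r / real (Suc k)"
          using that by (intro order_tendstoD(1)) auto
        then obtain k where "dist a x < r - r / real (Suc k)" by (meson eventually_happens sequentially_bot)
        then show ?thesis using that by (auto simp: Fm_def intro: less_imp_le)
      qed
      then show ?thesis by (auto simp: Fm_def)
    qed
    ultimately have "M \<le> (LINT x:?B - F|lborel. W x)"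
      by (metis LIMSEQ_le_const)
    note M_le = this
    have wi: "integrable lborel (\<lambda>x. indicator (?B - F) x * W x)"
      using Wi[of "?B - F"] by (simp add: set_integrable_def)
    from M_le have "ennreal (M * ?q) \<le> ennreal (LINT x:?B - F|lborel. W x) * ennreal ?q"
      using M by (simp add: ennreal_mult[symmetric] ennreal_leI mult_right_mono set_lebesgue_integral_def W(2))
    also have "ennreal (LINT x:?B - F|lborel. W x) = (\<integral>\<^sup>+x. ennreal (indicator (?B - F) x * W x) \<partial>lborel)"
      unfolding set_lebesgue_integral_def
      by (subst nn_integral_eq_integral) (use Wi[of "?B - F"] W(2) in \<open>auto simp: set_integrable_def\<close>)
    also have "\<dots> * ennreal ?q = (\<integral>\<^sup>+x. ennreal (indicator (?B - F) x * W x) * ennreal ?q \<partial>lborel)"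
      by (rule nn_integral_multc[symmetric])
         (intro measurable_compose[OF borel_measurable_integrable[OF wi] measurable_ennreal])
    also have "\<dots> \<le> (\<integral>\<^sup>+x\<in>?B. ennreal (W x * (norm (w x))\<^sup>2) \<partial>lborel)"
    proof (rule nn_integral_mono)
      fix x
      show "ennreal (indicator (?B - F) x * W x) * ennreal ?q \<le> ennreal (W x * (norm (w x))\<^sup>2) * indicator ?B x"
      proof (cases "x \<in> ?B - F")
        case True
        then have "?q \<le> (norm (w x))\<^sup>2" by (intro power_mono) (auto simp: F_def)
        then have "W x * ?q \<le> W x * (norm (w x))\<^sup>2" by (intro mult_left_mono W)
        with True show ?thesis by (simp add: ennreal_mult[symmetric] W(2) ennreal_leI)
      qed auto
    qed
    finally have "ennreal (4 / M) * ennreal (M * ?q) \<le> ennreal (4 / M) * (\<integral>\<^sup>+x\<in>?B. ennreal (W x * (norm (w x))\<^sup>2) \<partial>lborel)"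
      by (rule mult_left_mono) simp
    moreover have "ennreal (4 / M) * ennreal (M * ?q) = ennreal ((norm (w y))\<^sup>2)"
      using M by (subst ennreal_mult[symmetric]) (auto simp: power_divide)
    ultimately show ?thesis by (simp add: add_increasing2)
  next
    case False
    then have "ennreal (m * ?q) \<le> ennreal (measure lborel (?B \<inter> F)) * ennreal ?q"
      using m by (simp add: ennreal_mult[symmetric] ennreal_leI mult_right_mono)
    also have "\<dots> = ennreal ?q * emeasure lborel (?B \<inter> F)"
      using fin by (simp add: emeasure_eq_measure2 mult.commute)
    also have "\<dots> = (\<integral>\<^sup>+x. ennreal ?q * indicator (?B \<inter> F) x \<partial>lborel)"
      by (rule nn_integral_cmult_indicator[symmetric]) (use F in \<open>auto intro!: sets.Int\<close>)
    also have "\<dots> \<le> (\<integral>\<^sup>+x\<in>?B. ennreal ((norm (w x - w y))\<^sup>2) \<partial>lborel)"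
    proof (rule nn_integral_mono)
      fix x
      \<comment> \<open>The reverse triangle inequality, integrated over a set of measure more than
        m.\<close>
      have "?q \<le> (norm (w x - w y))\<^sup>2" if "x \<in> F"
        using that norm_triangle_ineq2[of "w y" "w x"]
        by (intro power_mono) (auto simp: F_def norm_minus_commute)
      then show "ennreal ?q * indicator (?B \<inter> F) x \<le> ennreal ((norm (w x - w y))\<^sup>2) * indicator ?B x"
        by (auto simp: indicator_def ennreal_leI)
    qed
    finally have "ennreal (4 / m) * ennreal (m * ?q) \<le> ennreal (4 / m) * (\<integral>\<^sup>+x\<in>?B. ennreal ((norm (w x - w y))\<^sup>2) \<partial>lborel)"
      by (rule mult_left_mono) simp
    moreover have "ennreal (4 / m) * ennreal (m * ?q) = ennreal ((norm (w y))\<^sup>2)"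
      using m by (subst ennreal_mult[symmetric]) (auto simp: power_divide)
    ultimately show ?thesis by (simp add: add_increasing)
  qed
qed

text \<open>The inscribed ball matters only for the hypothesis on W. The integrals over it are
  enlarged to Q so that the increments can later be bounded by Poincare on the whole cube.\<close>

lemma far_estimate:
  fixes w :: "real^'n::finite \<Rightarrow> complex" and W :: "real^'n \<Rightarrow> real"
  assumes w: "C_k 1 w" and W: "continuous_on UNIV W" "\<And>x. W x \<ge> 0" and M: "M > 0" and m: "m > 0"
    and r: "r > 0" and Q: "Q \<in> sets borel" "ball a r \<subseteq> Q"
    and H: "\<And>F. compact F \<Longrightarrow> F \<subseteq> ball a r \<Longrightarrow> measure lborel F \<le> m \<Longrightarrow> M \<le> (LINT x:ball a r - F|lborel. W x)"
  shows "(\<integral>\<^sup>+y\<in>Q. ennreal ((norm (w y))\<^sup>2) \<partial>lborel) \<le>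
     ennreal (4 / M) * emeasure lborel Q * (\<integral>\<^sup>+x\<in>Q. ennreal (W x * (norm (w x))\<^sup>2) \<partial>lborel)
     + ennreal (4 / m) * (\<integral>\<^sup>+y\<in>Q. (\<integral>\<^sup>+x\<in>Q. ennreal ((norm (w x - w y))\<^sup>2) \<partial>lborel) \<partial>lborel)"
proof -
  note [measurable] = Q(1) C_k_1_borel_measurable[OF w]
  let ?K = "\<integral>\<^sup>+x\<in>Q. ennreal (W x * (norm (w x))\<^sup>2) \<partial>lborel"
  have mono: "(\<integral>\<^sup>+x\<in>ball a r. f x \<partial>lborel) \<le> (\<integral>\<^sup>+x\<in>Q. f x \<partial>lborel)" for f :: "_ \<Rightarrow> ennreal"
    using Q(2) by (intro nn_integral_mono) (auto simp: indicator_def)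
  have "ennreal ((norm (w y))\<^sup>2) \<le> ennreal (4 / M) * ?K
     + ennreal (4 / m) * (\<integral>\<^sup>+x\<in>Q. ennreal ((norm (w x - w y))\<^sup>2) \<partial>lborel)" for y
    by (rule order_trans[OF far_estimate_pointwise[OF w W M m r H]])
       (auto intro!: add_mono mult_left_mono mono)
  then have "(\<integral>\<^sup>+y\<in>Q. ennreal ((norm (w y))\<^sup>2) \<partial>lborel) \<le>
    (\<integral>\<^sup>+y. ennreal (4 / M) * ?K * indicator Q y
     + ennreal (4 / m) * ((\<integral>\<^sup>+x\<in>Q. ennreal ((norm (w x - w y))\<^sup>2) \<partial>lborel) * indicator Q y) \<partial>lborel)"
    by (intro nn_integral_mono) (auto simp: indicator_def)
  also have "\<dots> = ennreal (4 / M) * ?K * emeasure lborel Q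
     + ennreal (4 / m) * (\<integral>\<^sup>+y\<in>Q. (\<integral>\<^sup>+x\<in>Q. ennreal ((norm (w x - w y))\<^sup>2) \<partial>lborel) \<partial>lborel)"
    by (simp add: nn_integral_add nn_integral_cmult nn_integral_cmult_indicator)
  finally show ?thesis by (simp add: mult_ac)
qed

section \<open>Tiling by cubes\<close>

text \<open>Half-open cubes partition the space exactly: each point lies in the one cube whose index
  is given by the integer parts of its scaled coordinates.\<close>

definition cube :: "real \<Rightarrow> ('n::finite \<Rightarrow> int) \<Rightarrow> (real^'n) set" where
  "cube s k = {x. \<forall>i. s * of_int (k i) \<le> x $ i \<and> x $ i < s * (of_int (k i) + 1)}"

definition cube_center :: "real \<Rightarrow> ('n::finite \<Rightarrow> int) \<Rightarrow> real^'n" where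
  "cube_center s k = (\<chi> i. s * (of_int (k i) + 1/2))"

lemma mem_cube_iff:
  assumes "s > 0"
  shows "x \<in> cube s k \<longleftrightarrow> k = (\<lambda>i. \<lfloor>x $ i / s\<rfloor>)"
proof -
  have "s * of_int (k i) \<le> x $ i \<and> x $ i < s * (of_int (k i) + 1) \<longleftrightarrow> k i = \<lfloor>x $ i / s\<rfloor>" for i
    using assms by (subst eq_commute) (auto simp: floor_eq_iff field_simps)
  then show ?thesis by (auto simp: cube_def fun_eq_iff)
qed

lemma sets_cube [measurable, simp]: "cube s k \<in> sets borel"
proof -
  have "cube s k = (\<Inter>i. {x. s * of_int (k i) \<le> x $ i} \<inter> {x. x $ i < s * (of_int (k i) + 1)})"
    by (auto simp: cube_def)
  moreover have "{x::real^'a. s * of_int (k i) \<le> x $ i} \<inter> {x. x $ i < s * (of_int (k i) + 1)} \<in> sets borel" for i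
    by (intro sets.Int borel_closed borel_open closed_Collect_le open_Collect_less continuous_intros)
  ultimately show ?thesis by (simp add: sets.finite_INT)
qed

lemma convex_cube: "convex (cube s k)"
proof -
  have "cube s k = (\<Inter>i. (\<lambda>x. x $ i) -` {s * of_int (k i)..<s * (of_int (k i) + 1)})"
    by (auto simp: cube_def)
  moreover have "convex ((\<lambda>x::real^'a. x $ i) -` {a..<b})" for i and a b :: real
    by (intro convex_linear_vimage) (auto intro: bounded_linear.linear bounded_linear_vec_nth)
  ultimately show ?thesis by (simp add: convex_INT)
qed

lemma ball_subset_cube:
  assumes "s > 0"
  shows "ball (cube_center s k) (s / 2) \<subseteq> cube s k"
proof
  fix x assume x: "x \<in> ball (cube_center s k) (s / 2)"
  have "s * of_int (k i) \<le> x $ i \<and> x $ i < s * (of_int (k i) + 1)" for i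
  proof -
    have "\<bar>x $ i - cube_center s k $ i\<bar> < s / 2"
      using x component_le_norm_cart[of "x - cube_center s k" i]
      by (simp add: dist_norm norm_minus_commute)
    moreover have "cube_center s k $ i = s * of_int (k i) + s / 2"
      by (simp add: cube_center_def algebra_simps)
    ultimately show ?thesis unfolding distrib_left mult_1_right by linarith
  qed
  then show "x \<in> cube s k" by (simp add: cube_def)
qed

lemma cube_diameter:
  fixes x y :: "real^'n::finite"
  assumes "x \<in> cube s k" "y \<in> cube s k"
  shows "(norm (y - x))\<^sup>2 \<le> real CARD('n) * s\<^sup>2"
proof -
  have "((y - x) $ i)\<^sup>2 \<le> s\<^sup>2" for i
  proof -
    have "s * of_int (k i) \<le> x $ i" "x $ i < s * of_int (k i) + s"
      "s * of_int (k i) \<le> y $ i" "y $ i < s * of_int (k i) + s"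
      using assms by (auto simp: cube_def algebra_simps)
    then have "\<bar>(y - x) $ i\<bar> \<le> s" by (simp add: abs_le_iff)
    then have "\<bar>(y - x) $ i\<bar>\<^sup>2 \<le> s\<^sup>2" by (intro power_mono) auto
    then show ?thesis by simp
  qed
  then have "(\<Sum>i\<in>UNIV. ((y - x) $ i)\<^sup>2) \<le> (\<Sum>i\<in>(UNIV::'n set). s\<^sup>2)" by (intro sum_mono)
  then show ?thesis by (simp add: norm_vec_def L2_set_def sum_nonneg)
qed

lemma bounded_cube: "bounded (cube s k)"
proof (cases "cube s k = {}")
  case False
  then obtain x where x: "x \<in> cube s k" by auto
  show ?thesis
  proof (rule boundedI)
    fix y assume "y \<in> cube s k"
    then have "norm (y - x) \<le> sqrt (real CARD('a) * s\<^sup>2)"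
      using cube_diameter[OF x] real_le_rsqrt by blast
    then show "norm y \<le> norm x + sqrt (real CARD('a) * s\<^sup>2)"
      using norm_triangle_ineq2[of y x] by linarith
  qed
qed simp

text \<open>The half-open cube lies between an open and a closed box of equal volume.\<close>

lemma emeasure_cube:
  fixes k :: "'n::finite \<Rightarrow> int"
  assumes "s > 0"
  shows "emeasure lborel (cube s k) = ennreal (s ^ CARD('n))"
proof -
  define a :: "real^'n" where "a = (\<chi> i. s * of_int (k i))"
  define b :: "real^'n" where "b = (\<chi> i. s * (of_int (k i) + 1))"
  have ab: "(b - a) \<bullet> i = s" if "i \<in> Basis" for i
    using that by (auto simp: a_def b_def Basis_vec_def inner_axis algebra_simps)
  have "emeasure lborel (box a b) = ennreal (s ^ CARD('n))"
    "emeasure lborel (cbox a b) = ennreal (s ^ CARD('n))"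
    using ab assms by (auto simp: emeasure_lborel_box_eq emeasure_lborel_cbox_eq algebra_simps)
  moreover have "box a b \<subseteq> cube s k" "cube s k \<subseteq> cbox a b"
    by (auto simp: a_def b_def cube_def mem_box_cart less_imp_le)
  ultimately show ?thesis
    by (metis antisym emeasure_mono sets_cube sets_lborel borel_closed closed_cbox)
qed

text \<open>The indicators of the cubes sum to 1 at every point. Writing the sum as an integral for
  counting measure on a countable type allows the interchange.\<close>

lemma nn_integral_cubes:
  fixes f :: "real^'n::finite \<Rightarrow> ennreal"
  assumes s: "s > 0" and [measurable]: "f \<in> borel_measurable borel"
  shows "(\<integral>\<^sup>+x. f x \<partial>lborel) = (\<integral>\<^sup>+k. (\<integral>\<^sup>+x\<in>cube s k. f x \<partial>lborel) \<partial>count_space UNIV)"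
proof -
  have "f x = (\<integral>\<^sup>+k. f x * indicator (cube s k) x \<partial>count_space UNIV)" for x
  proof -
    have "(\<lambda>k. f x * indicator (cube s k) x) = (\<lambda>k. f x * indicator {\<lambda>i. \<lfloor>x $ i / s\<rfloor>} k)"
      using mem_cube_iff[OF s, of x] by (auto simp: indicator_def fun_eq_iff)
    then show ?thesis by (simp add: nn_integral_cmult_indicator)
  qed
  then have "(\<integral>\<^sup>+x. f x \<partial>lborel) = (\<integral>\<^sup>+x. (\<integral>\<^sup>+k. f x * indicator (cube s k) x \<partial>count_space UNIV) \<partial>lborel)"
    by simp
  also have "\<dots> = (\<integral>\<^sup>+k. (\<integral>\<^sup>+x\<in>cube s k. f x \<partial>lborel) \<partial>count_space UNIV)"
    by (rule nn_integral_count_space_nn_integral) (auto intro: countableI_type)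
  finally show ?thesis .
qed

lemma finite_near_cubes:
  assumes "s > 0"
  shows "finite {k :: 'n::finite \<Rightarrow> int. norm (cube_center s k :: real^'n) < R}"
proof (rule finite_subset)
  define N where "N = \<lceil>\<bar>R\<bar> / s\<rceil> + 1"
  show "{k. norm (cube_center s k :: real^'n) < R} \<subseteq> PiE UNIV (\<lambda>_. {-N..N})"
  proof (clarsimp simp: PiE_def)
    fix k :: "'n \<Rightarrow> int" and i assume "norm (cube_center s k :: real^'n) < R"
    then have "\<bar>s * (of_int (k i) + 1/2)\<bar> < \<bar>R\<bar>"
      using component_le_norm_cart[of "cube_center s k" i] by (simp add: cube_center_def)
    then have "s * \<bar>of_int (k i) + 1/2\<bar> < \<bar>R\<bar>"
      using assms unfolding abs_mult by simp
    then have "\<bar>of_int (k i) + 1/2\<bar> < \<bar>R\<bar> / s"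
      using assms by (subst pos_less_divide_eq) (auto simp: mult.commute)
    then show "- N \<le> k i \<and> k i \<le> N" unfolding N_def by linarith
  qed
qed (auto intro: finite_PiE)

section \<open>The energy identity\<close>

lemma integrable_continuous_bounded_support:
  fixes f :: "real^'n::finite \<Rightarrow> 'b::{banach, second_countable_topology}"
  assumes "continuous_on UNIV f" "bounded S" "\<And>x. x \<notin> S \<Longrightarrow> f x = 0"
  shows "integrable lborel f"
proof -
  obtain R where R: "S \<subseteq> cball 0 R"
    using assms(2) by (auto simp: bounded_iff mem_cball_0 subset_eq)
  have "integrable lborel (\<lambda>x. indicator (cball 0 R) x *\<^sub>R f x)"
    by (intro borel_integrable_compact continuous_on_subset[OF assms(1)]) auto
  moreover have "(\<lambda>x. indicator (cball 0 R) x *\<^sub>R f x) = f"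
    using R assms(3) by (fastforce simp: fun_eq_iff indicator_def)
  ultimately show ?thesis by simp
qed

lemma partial_eq_0:
  assumes "open S" "x \<in> S" "\<And>y. y \<in> S \<Longrightarrow> f y = 0"
  shows "partial j f x = 0"
proof -
  have "(f has_derivative (\<lambda>v. 0)) (at x)"
    by (rule has_derivative_transform_within_open[OF has_derivative_const assms(1,2)]) (simp add: assms(3))
  then show ?thesis by (simp add: partial_eq)
qed

lemma partial_eq_0_cball:
  assumes "\<And>y. norm y > R \<Longrightarrow> f y = 0" "norm x > R"
  shows "partial j f x = 0"
proof (rule partial_eq_0)
  show "open {y. norm y > R}" by (intro open_Collect_less continuous_intros)
qed (use assms in auto)

lemma lborel_integral_translation:
  fixes f :: "real^'n::finite \<Rightarrow> real"
  assumes [measurable]: "f \<in> borel_measurable borel"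
  shows "(LINT x|lborel. f (t + x)) = (LINT x|lborel. f x)"
  by (subst (2) lborel_distr_plus[symmetric, of t]) (simp add: integral_distr)

lemma axis_eq_scaleR: "axis j t = t *\<^sub>R (axis j 1 :: real^'n::finite)"
  by (auto simp: axis_def vec_eq_iff)

lemma bounded_linear_axis: "bounded_linear (axis j :: real \<Rightarrow> real^'n::finite)"
  using bounded_linear_scaleR_left[of "axis j 1 :: real^'n"] by (simp add: axis_eq_scaleR[symmetric])

lemma norm_axis: "norm (axis j t :: real^'n::finite) = \<bar>t\<bar>"
  by (subst axis_eq_scaleR) (simp add: norm_axis_1)

text \<open>By translation invariance all difference quotients of \<open>F\<close> have integral zero.\<close>

lemma integral_partial_eq_0:
  fixes F :: "real^'n::finite \<Rightarrow> real"
  assumes F: "C_k 1 F" and supp: "\<And>x. norm x > R \<Longrightarrow> F x = 0"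
  shows "(LINT x|lborel. partial j F x) = 0"
proof -
  have cont: "continuous_on UNIV (partial j F)" using F by simp
  have F_meas [measurable]: "F \<in> borel_measurable borel" by (rule C_k_1_borel_measurable[OF F])
  have [measurable]: "partial j F \<in> borel_measurable borel"
    by (intro borel_measurable_continuous_onI cont)
  have Fi: "integrable lborel F"
    by (rule integrable_continuous_bounded_support[of _ "cball 0 R"]) (use C_k_1_continuous[OF F] supp in auto)
  have "bounded (partial j F ` cball 0 (R + 1))"
    by (intro compact_imp_bounded compact_continuous_image continuous_on_subset[OF cont]) auto
  then obtain K where K: "\<And>x. norm x \<le> R + 1 \<Longrightarrow> \<bar>partial j F x\<bar> \<le> K"
    unfolding bounded_iff by (auto simp del: One_nat_def) (metis mem_cball_0)
  have zero: "partial j F x = 0" if "norm x > R" for x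
    by (rule partial_eq_0_cball[OF supp that])
  have a0: "axis j 0 = (0 :: real^'n)" by (simp add: axis_eq_0_iff)
  define q where "q = (\<lambda>k x. (F (x + axis j (1 / real (Suc k))) - F x) * real (Suc k))"
  \<comment> \<open>By the mean value theorem the quotient is itself a value of the derivative at a
    nearby point, which yields both its limit and its bound.\<close>
  have mv: "\<exists>z. 0 < z \<and> z < 1 / real (Suc k) \<and> q k x = partial j F (x + axis j z)" for k x
  proof -
    have "((\<lambda>t. F (x + axis j t)) has_real_derivative partial j F (x + axis j t)) (at t)" for t
    proof -
      have "((\<lambda>t. x + axis j t) has_derivative (\<lambda>t. axis j t)) (at t)"
        by (auto intro!: derivative_eq_intros bounded_linear_imp_has_derivative bounded_linear_axis)
      from has_derivative_compose[OF this has_derivative_partial[of F]] F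
      have "((\<lambda>t. F (x + axis j t)) has_derivative (\<lambda>v. \<Sum>i\<in>UNIV. axis j v $ i *\<^sub>R partial i F (x + axis j t))) (at t)"
        by simp
      moreover have "(\<Sum>i\<in>UNIV. axis j v $ i *\<^sub>R partial i F (x + axis j t)) = partial j F (x + axis j t) * v" for v
        by (simp add: axis_def if_distrib[of "\<lambda>a. a * _"] sum.delta cong: if_cong)
      ultimately show ?thesis by (simp add: has_field_derivative_def)
    qed
    then have "\<exists>z>0. z < 1 / real (Suc k) \<and> F (x + axis j (1 / real (Suc k))) - F (x + axis j 0)
       = (1 / real (Suc k) - 0) * partial j F (x + axis j z)"
      by (intro MVT2) auto
    then show ?thesis by (auto simp: q_def a0 field_simps)
  qed
  have "(\<lambda>k. LINT x|lborel. q k x) \<longlonglongrightarrow> (LINT x|lborel. partial j F x)"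
  \<comment> \<open>All shifts have length at most 1, so every quotient vanishes outside the ball of
    radius \<open>R + 1\<close> and is bounded by K inside it.\<close>
  proof (rule integral_dominated_convergence[where w="\<lambda>x. indicator (cball 0 (R + 1)) x *\<^sub>R K"])
    show "integrable lborel (\<lambda>x::real^'n. indicator (cball 0 (R + 1)) x *\<^sub>R K)"
      by (intro borel_integrable_compact) auto
    show "AE x in lborel. (\<lambda>k. q k x) \<longlonglongrightarrow> partial j F x"
    proof (rule AE_I2)
      fix x
      obtain z where z: "\<And>k. 0 < z k \<and> z k < 1 / real (Suc k) \<and> q k x = partial j F (x + axis j (z k))"
        using mv[of _ x] by metis
      have "z \<longlonglongrightarrow> 0"
      proof (rule tendsto_sandwich[OF always_eventually always_eventually tendsto_const])
        show "(\<lambda>k. 1 / real (Suc k)) \<longlonglongrightarrow> 0" by (rule LIMSEQ_Suc[OF lim_1_over_n])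
      qed (use z less_imp_le in blast)+
      then have "(\<lambda>k. x + axis j (z k)) \<longlonglongrightarrow> x + axis j 0"
        by (intro tendsto_intros bounded_linear.tendsto[OF bounded_linear_axis])
      then have "(\<lambda>k. x + axis j (z k)) \<longlonglongrightarrow> x" by (simp add: a0)
      then have "(\<lambda>k. partial j F (x + axis j (z k))) \<longlonglongrightarrow> partial j F x"
        using cont by (metis (no_types) UNIV_I continuous_on_eq_continuous_at isCont_tendsto_compose open_UNIV)
      then show "(\<lambda>k. q k x) \<longlonglongrightarrow> partial j F x" using z by simp
    qed
    show "AE x in lborel. norm (q k x) \<le> indicator (cball 0 (R + 1)) x *\<^sub>R K" for k
    proof (rule AE_I2)
      fix x
      obtain z where z: "0 < z" "z < 1 / real (Suc k)" "q k x = partial j F (x + axis j z)"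
        using mv[of k x] by blast
      have "1 / real (Suc k) \<le> 1" by simp
      with z(2) have "z \<le> 1" by linarith
      with z(1) have "norm (axis j z :: real^'n) \<le> 1" by (simp add: norm_axis)
      moreover have "norm x \<le> norm (x + axis j z) + norm (axis j z :: real^'n)"
        by (metis add_diff_cancel_right' norm_triangle_ineq4)
      ultimately have "norm (x + axis j z) > R" if "norm x > R + 1" using that by linarith
      then have "q k x = 0" if "norm x > R + 1" using z(3) zero that by simp
      moreover have "\<bar>q k x\<bar> \<le> K" if "norm x \<le> R + 1"
        using zero[of "x + axis j z"] K[of "x + axis j z"] K[OF that] unfolding z(3)
        by (cases "norm (x + axis j z) > R") auto
      ultimately show "norm (q k x) \<le> indicator (cball 0 (R + 1)) x *\<^sub>R K"
        by (auto simp: indicator_def)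
    qed
  qed (auto simp: q_def)
  moreover have "(LINT x|lborel. q k x) = 0" for k
  proof -
    have "(LINT x|lborel. F (axis j (1 / real (Suc k)) + x)) = (LINT x|lborel. F x)"
      by (rule lborel_integral_translation[OF F_meas])
    moreover have "integrable lborel (\<lambda>x. F (axis j (1 / real (Suc k)) + x))"
      using Fi integrable_distr_eq[of "(+) (axis j (1 / real (Suc k)))" lborel borel F]
      by (simp add: lborel_distr_plus)
    ultimately show ?thesis using Fi by (simp add: q_def add.commute)
  qed
  ultimately have "(\<lambda>k::nat. 0) \<longlonglongrightarrow> (LINT x|lborel. partial j F x)" by (simp only:)
  then show ?thesis by (simp add: LIMSEQ_const_iff)
qed

definition twisted :: "(real^'n::finite \<Rightarrow> real) \<Rightarrow> 'n \<Rightarrow> (real^'n \<Rightarrow> complex) \<Rightarrow> real^'n \<Rightarrow> complex" where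
  "twisted \<phi> j w x = partial j w x + (partial j \<phi> x / 2) *\<^sub>R w x"

definition potential :: "(real^'n::finite \<Rightarrow> real) \<Rightarrow> real^'n \<Rightarrow> real" where
  "potential \<phi> x = 1/4 * (norm (gradient \<phi> x))\<^sup>2 - 1/2 * laplacian \<phi> x"

lemma continuous_on_partial: "smooth f \<Longrightarrow> continuous_on A (partial j f)"
  by (intro smooth_continuous_on smooth_partial)

lemma twisted_measurable:
  assumes "smooth \<phi>" "C_k 1 w"
  shows "twisted \<phi> j w \<in> borel_measurable borel"
proof -
  have "continuous_on UNIV (partial j w)" using assms(2) by simp
  then have "continuous_on UNIV (twisted \<phi> j w)"
    unfolding twisted_def[abs_def]
    by (intro continuous_intros continuous_on_partial[OF assms(1)] C_k_1_continuous[OF assms(2)]) simp_all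
  then show ?thesis by (rule borel_measurable_continuous_onI)
qed

lemma norm_gradient_sq: "(norm (gradient \<phi> x))\<^sup>2 = (\<Sum>j\<in>UNIV. (partial j \<phi> x)\<^sup>2)"
  by (simp add: gradient_def norm_vec_def L2_set_def sum_nonneg)

lemma continuous_on_potential: "smooth \<phi> \<Longrightarrow> continuous_on A (potential \<phi>)"
  unfolding potential_def[abs_def] norm_gradient_sq laplacian_def
  by (intro continuous_intros continuous_on_partial smooth_partial)

lemma partial_norm_sq:
  fixes w :: "real^'n::finite \<Rightarrow> complex"
  assumes "w differentiable (at x)"
  shows "(\<lambda>x. (norm (w x))\<^sup>2) differentiable (at x)"
    and "partial j (\<lambda>x. (norm (w x))\<^sup>2) x = 2 * (w x \<bullet> partial j w x)"
proof -
  have D: "((\<lambda>x. (norm (w x))\<^sup>2) has_derivative (\<lambda>v. 2 * (w x \<bullet> frechet_derivative w (at x) v))) (at x)"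
    unfolding power2_norm_eq_inner
    using has_derivative_inner[OF assms[unfolded frechet_derivative_works] assms[unfolded frechet_derivative_works]]
    by (simp add: inner_commute)
  then show "(\<lambda>x. (norm (w x))\<^sup>2) differentiable (at x)" by (auto simp: differentiable_def)
  show "partial j (\<lambda>x. (norm (w x))\<^sup>2) x = 2 * (w x \<bullet> partial j w x)"
    by (subst partial_eq[OF D]) (simp add: partial_def)
qed

lemma C_k_1_norm_sq:
  fixes w :: "real^'n::finite \<Rightarrow> complex"
  assumes w: "C_k 1 w"
  shows "C_k 1 (\<lambda>x. (norm (w x))\<^sup>2)"
proof -
  have "w differentiable (at x)" "continuous_on UNIV (partial j w)" for x j using w by auto
  moreover from this have "partial j (\<lambda>x. (norm (w x))\<^sup>2) = (\<lambda>x. 2 * (w x \<bullet> partial j w x))" for j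
    by (simp add: partial_norm_sq fun_eq_iff)
  ultimately show ?thesis
    unfolding C_k_1_iff by (auto intro!: partial_norm_sq continuous_intros C_k_1_continuous[OF w])
qed

text \<open>Expanding the square leaves the cross term
  \<open>partial j \<phi> x * (w x \<bullet> partial j w x)\<close>, which is half of
  \<open>partial j \<phi>\<close> times the derivative of \<open>(norm (w x))\<^sup>2\<close>. By
  the product rule it equals half of \<open>partial j (g j)\<close> minus half of the second
  derivative of \<phi> times \<open>(norm (w x))\<^sup>2\<close>. The former integrates to zero; the
  latter, summed over j, gives the Laplacian in \<open>potential\<close>.\<close>

lemma energy_identity:
  fixes \<phi> :: "real^'n::finite \<Rightarrow> real"
  assumes \<phi>: "smooth \<phi>" and w: "C_k 1 w" and supp: "\<And>x. norm x > R \<Longrightarrow> w x = 0"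
  shows "(LINT x|lborel. (\<Sum>j\<in>UNIV. (norm (twisted \<phi> j w x))\<^sup>2))
    = (LINT x|lborel. grad_sq w x) + (LINT x|lborel. potential \<phi> x * (norm (w x))\<^sup>2)"
    and "integrable lborel (grad_sq w)"
    and "integrable lborel (\<lambda>x. potential \<phi> x * (norm (w x))\<^sup>2)"
    and "integrable lborel (\<lambda>x. (norm (w x))\<^sup>2)"
proof -
  define g where "g = (\<lambda>j x. partial j \<phi> x * (norm (w x))\<^sup>2)"
  have w_diff: "w differentiable (at x)" for x using w by simp
  have \<phi>1: "C_k 1 (partial j \<phi>)" for j
    using smooth_partial[OF \<phi>] by (simp only: smooth_def)
  have g1: "C_k 1 (g j)" for j
    unfolding g_def by (intro C_k_mult C_k_1_norm_sq w \<phi>1)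
  have g0: "g j x = 0" if "norm x > R" for j x using supp[OF that] by (simp add: g_def)
  have pw0: "partial j w x = 0" if "norm x > R" for j x by (rule partial_eq_0_cball[OF supp that])
  have pg0: "partial j (g i) x = 0" if "norm x > R" for i j x by (rule partial_eq_0_cball[OF g0 that])
  have int: "integrable lborel f" if "continuous_on UNIV f" "\<And>x. norm x > R \<Longrightarrow> f x = 0" for f :: "real^'n \<Rightarrow> real"
    by (rule integrable_continuous_bounded_support[OF that(1), of "cball 0 R"]) (use that(2) in auto)
  show Ig: "integrable lborel (grad_sq w)"
    by (rule int[OF continuous_on_grad_sq[OF w]]) (simp add: grad_sq_def pw0)
  show Iw: "integrable lborel (\<lambda>x. (norm (w x))\<^sup>2)"
    by (rule int[OF C_k_1_continuous[OF C_k_1_norm_sq[OF w]]]) (simp add: supp)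
  show Iv: "integrable lborel (\<lambda>x. potential \<phi> x * (norm (w x))\<^sup>2)"
    by (rule int[OF continuous_on_mult[OF continuous_on_potential[OF \<phi>] C_k_1_continuous[OF C_k_1_norm_sq[OF w]]]])
       (simp add: supp)
  have Ip: "integrable lborel (partial j (g j))" for j
    by (rule int) (use g1[of j] pg0 in \<open>auto simp: C_k_1_iff\<close>)
  have pg: "partial j (g j) x = partial j \<phi> x * (2 * (w x \<bullet> partial j w x)) + partial j (partial j \<phi>) x * (norm (w x))\<^sup>2" for j x
    unfolding g_def
    by (subst partial_mult) (auto simp: partial_norm_sq w_diff intro!: smooth_differentiable smooth_partial \<phi>)
  have "(\<Sum>j\<in>UNIV. (norm (twisted \<phi> j w x))\<^sup>2)
     = grad_sq w x + potential \<phi> x * (norm (w x))\<^sup>2 + 1/2 * (\<Sum>j\<in>UNIV. partial j (g j) x)" for x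
  proof -
    have "(norm (twisted \<phi> j w x))\<^sup>2 = (norm (partial j w x))\<^sup>2
        + partial j \<phi> x * (w x \<bullet> partial j w x) + 1/4 * (partial j \<phi> x)\<^sup>2 * (norm (w x))\<^sup>2" for j
      unfolding twisted_def power2_norm_eq_inner
      by (simp add: inner_add_left inner_add_right inner_commute power2_eq_square field_simps)
    then show ?thesis
      unfolding pg potential_def norm_gradient_sq laplacian_def grad_sq_def
      by (simp add: sum.distrib sum_distrib_left sum_distrib_right algebra_simps)
  qed
  then have "(LINT x|lborel. (\<Sum>j\<in>UNIV. (norm (twisted \<phi> j w x))\<^sup>2))
    = (LINT x|lborel. grad_sq w x) + (LINT x|lborel. potential \<phi> x * (norm (w x))\<^sup>2)
      + 1/2 * (\<Sum>j\<in>UNIV. LINT x|lborel. partial j (g j) x)"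
    using Ig Iv Ip by simp
  moreover have "(LINT x|lborel. partial j (g j) x) = 0" for j
    by (rule integral_partial_eq_0[OF g1 g0])
  ultimately show "(LINT x|lborel. (\<Sum>j\<in>UNIV. (norm (twisted \<phi> j w x))\<^sup>2))
    = (LINT x|lborel. grad_sq w x) + (LINT x|lborel. potential \<phi> x * (norm (w x))\<^sup>2)" by simp
qed

section \<open>The main inequality\<close>

text \<open>If no radius R worked, each l would provide a bad ball with center of norm at least l
  and a bad compact set in it; these form sequences that contradict the sequential
  hypothesis.\<close>

lemma diverges_off_small_sets_uniform:
  fixes V :: "real^'n::finite \<Rightarrow> real"
  assumes V: "continuous_on UNIV V" and div: "diverges_off_small_sets V \<gamma>" and r: "r > 0"
  obtains R where "\<And>a F. norm a \<ge> R \<Longrightarrow> compact F \<Longrightarrow> F \<subseteq> ball a r \<Longrightarrow>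
    measure lborel F \<le> \<gamma> * r ^ CARD('n) \<Longrightarrow> M \<le> (LINT y:ball a r - F|lborel. V y)"
proof (rule ccontr)
  assume neg: "\<not> thesis"
  let ?bad = "\<lambda>a F. compact F \<and> F \<subseteq> ball a r \<and> measure lborel F \<le> \<gamma> * r ^ CARD('n) \<and>
      (LINT y:ball a r - F|lborel. V y) < M"
  have "\<exists>a F. norm a \<ge> real l \<and> ?bad a F" for l :: nat
    using neg that[of "real l"] by (metis not_le)
  then obtain x F where xF: "\<And>l. norm (x l) \<ge> real l" "\<And>l. ?bad (x l) (F l)" by metis
  have [measurable]: "V \<in> borel_measurable borel" by (intro borel_measurable_continuous_onI V)
  have "filterlim (\<lambda>l. norm (x l)) at_top sequentially"
    by (rule filterlim_at_top_mono[OF filterlim_real_sequentially]) (use xF in auto)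
  moreover have Fm: "F l \<in> sets lborel" for l using xF(2)[of l] by (simp add: borel_compact)
  ultimately have "filterlim (\<lambda>l. LINT y:(ball (x l) r - F l)|lebesgue. V y) at_top sequentially"
    using div r xF(2) unfolding diverges_off_small_sets_def by (simp add: measure_completion)
  moreover have "(LINT y:(ball (x l) r - F l)|lebesgue. V y) = (LINT y:(ball (x l) r - F l)|lborel. V y)" for l
    unfolding set_lebesgue_integral_def
    by (intro integral_completion borel_measurable_scaleR borel_measurable_indicator)
       (use Fm[of l] in \<open>auto intro!: sets.Diff\<close>)
  ultimately have "\<forall>\<^sub>F l in sequentially. M \<le> (LINT y:(ball (x l) r - F l)|lborel. V y)"
    by (simp add: filterlim_at_top)
  then obtain l where "M \<le> (LINT y:(ball (x l) r - F l)|lborel. V y)"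
    by (meson eventually_happens sequentially_bot)
  with xF(2)[of l] show False by auto
qed

text \<open>The data m, I and c depend on \<epsilon> but not on w. The side of the cubes is given
  through m so that only countably many cubes can ever occur.\<close>

lemma main_inequality:
  fixes \<phi> :: "real^'n::finite \<Rightarrow> real"
  assumes \<phi>: "smooth \<phi>" and C: "C > 0" "\<And>x. potential \<phi> x \<ge> - C"
    and \<gamma>: "\<gamma> > 0" and div: "diverges_off_small_sets (potential \<phi>) \<gamma>" and \<epsilon>: "\<epsilon> > 0"
  obtains m :: nat and I :: "('n \<Rightarrow> int) set" and c :: real where "finite I" "c \<ge> 0"
    "\<And>w R. C_k 1 w \<Longrightarrow> (\<And>x. norm x > R \<Longrightarrow> w x = 0) \<Longrightarrow>
      (LINT x|lborel. (norm (w x))\<^sup>2) \<le>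
      \<epsilon> * ((LINT x|lborel. (\<Sum>j\<in>UNIV. (norm (twisted \<phi> j w x))\<^sup>2)) + (LINT x|lborel. (norm (w x))\<^sup>2))
      + c * (\<Sum>k\<in>I. (norm (LINT x:cube (1 / real (Suc m)) k|lborel. w x))\<^sup>2)"
proof -
  let ?n = "CARD('n)"
  let ?V = "potential \<phi>"
  define W where "W = (\<lambda>x. ?V x + C)"
  \<comment> \<open>The energy of w with W in place of the potential exceeds the twisted energy by C
    times the squared norm; dividing by \<open>1 + C\<close> absorbs this excess.\<close>
  define \<epsilon>' where "\<epsilon>' = \<epsilon> / (1 + C)"
  have \<epsilon>': "\<epsilon>' > 0" using \<epsilon> C by (simp add: \<epsilon>'_def)
  \<comment> \<open>On a cube of side s the squared diameter is at most n \<open>s\<^sup>2\<close>,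
    so Poincare costs n \<open>s\<^sup>2\<close> 2 ^ n s ^ n. The near factor 2 / s ^ n turns this
    into \<open>s\<^sup>2\<close> times the first summand of A, the far factor 4 / (\<gamma> (s / 2)
    ^ n) into \<open>s\<^sup>2\<close> times the second; 4 ^ n arises as 2 ^ n * 2 ^ n.\<close>
  define A where "A = 2 * (real ?n * 2 ^ ?n) + 4 * (real ?n * 4 ^ ?n) / \<gamma>"
  have A: "A > 0" using \<gamma> by (simp add: A_def add_pos_pos)
  obtain m where m: "1 / real (Suc m) < \<epsilon>' / A"
    using reals_Archimedean[of "\<epsilon>' / A"] \<epsilon>' A by (auto simp: inverse_eq_divide)
  define s where "s = 1 / real (Suc m)"
  have s: "s > 0" "s \<le> 1" by (auto simp: s_def)
  have "s\<^sup>2 * A \<le> s * A" using s A by (simp add: power2_eq_square mult_left_le_one_le)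
  also have "\<dots> \<le> \<epsilon>'" using m A by (simp add: s_def field_simps)
  finally have sA: "s\<^sup>2 * A \<le> \<epsilon>'" .
  have near_c: "2 * (real ?n * s\<^sup>2 * 2 ^ ?n) \<le> \<epsilon>'"
    and far_c: "4 * (real ?n * s\<^sup>2 * 4 ^ ?n) / \<gamma> \<le> \<epsilon>'"
  proof -
    have "s\<^sup>2 * A = 2 * (real ?n * s\<^sup>2 * 2 ^ ?n) + 4 * (real ?n * s\<^sup>2 * 4 ^ ?n) / \<gamma>"
      by (simp add: A_def field_simps)
    moreover have "0 \<le> 2 * (real ?n * s\<^sup>2 * 2 ^ ?n)" "0 \<le> 4 * (real ?n * s\<^sup>2 * 4 ^ ?n) / \<gamma>"
      using \<gamma> by auto
    ultimately show "2 * (real ?n * s\<^sup>2 * 2 ^ ?n) \<le> \<epsilon>'" "4 * (real ?n * s\<^sup>2 * 4 ^ ?n) / \<gamma> \<le> \<epsilon>'"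
      using sA by linarith+
  qed
  \<comment> \<open>Chosen so that the factor 4 / M times the cube volume s ^ n in
    \<open>far_estimate\<close> is exactly \<epsilon>'.\<close>
  define M where "M = 4 * s ^ ?n / \<epsilon>'"
  define r where "r = s / 2"
  have M: "M > 0" and r: "r > 0" using s \<epsilon>' by (auto simp: M_def r_def)
  have Vc: "continuous_on B ?V" for B by (rule continuous_on_potential[OF \<phi>])
  have Wc: "continuous_on B W" for B unfolding W_def by (intro continuous_intros Vc)
  have W0: "W x \<ge> 0" for x using C(2)[of x] by (simp add: W_def)
  obtain R0 where R0: "\<And>a F. norm a \<ge> R0 \<Longrightarrow> compact F \<Longrightarrow> F \<subseteq> ball a r \<Longrightarrow>
    measure lborel F \<le> \<gamma> * r ^ ?n \<Longrightarrow> M \<le> (LINT y:ball a r - F|lborel. ?V y)"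
    using diverges_off_small_sets_uniform[OF Vc div r, of M] by blast
  \<comment> \<open>Since W dominates the potential, the mass bound passes to W, which is
    nonnegative as the far estimate requires.\<close>
  have H: "M \<le> (LINT y:ball a r - F|lborel. W y)"
    if "norm a \<ge> R0" "compact F" "F \<subseteq> ball a r" "measure lborel F \<le> \<gamma> * r ^ ?n" for a F
  proof -
    have ii: "set_integrable lborel (ball a r - F) f" if "continuous_on UNIV f" for f :: "real^'n \<Rightarrow> real"
    proof (rule set_integrable_subset)
      show "set_integrable lborel (cball a r) f"
        unfolding set_integrable_def by (intro borel_integrable_compact continuous_on_subset[OF that]) auto
    qed (use borel_compact[OF \<open>compact F\<close>] in \<open>auto intro!: sets.Diff\<close>)
    have "(LINT y:ball a r - F|lborel. ?V y) \<le> (LINT y:ball a r - F|lborel. W y)"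
      by (intro set_integral_mono ii Vc Wc) (use C(1) in \<open>auto simp: W_def\<close>)
    with R0[OF that] show ?thesis by linarith
  qed
  define I where "I = {k :: 'n \<Rightarrow> int. norm (cube_center s k :: real^'n) < R0}"
  have I: "finite I" unfolding I_def by (rule finite_near_cubes[OF s(1)])
  \<comment> \<open>The factor 2 / \<mu> of the squared mean in \<open>near_estimate\<close>, for
    the cube volume \<mu> = s ^ n.\<close>
  define c where "c = 2 / s ^ ?n"
  have c: "c \<ge> 0" using s by (simp add: c_def)
  have main: "(LINT x|lborel. (norm (w x))\<^sup>2) \<le>
      \<epsilon> * ((LINT x|lborel. (\<Sum>j\<in>UNIV. (norm (twisted \<phi> j w x))\<^sup>2)) + (LINT x|lborel. (norm (w x))\<^sup>2))
      + c * (\<Sum>k\<in>I. (norm (LINT x:cube s k|lborel. w x))\<^sup>2)"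
    if w: "C_k 1 w" and supp: "\<And>x. norm x > R \<Longrightarrow> w x = 0" for w R
  proof -
    note en = energy_identity[of \<phi> w R, OF \<phi> w supp]
    have [measurable]: "w \<in> borel_measurable borel" "W \<in> borel_measurable borel" "grad_sq w \<in> borel_measurable borel"
      by (intro C_k_1_borel_measurable w borel_measurable_continuous_onI Wc continuous_on_grad_sq)+
    \<comment> \<open>The mean terms of the near cubes only; extended by zero, so that summing over
      all cubes leaves a finite sum over I.\<close>
    define b where "b = (\<lambda>k. if k \<in> I then ennreal (c * (norm (LINT x:cube s k|lborel. w x))\<^sup>2) else 0)"
    let ?G = "\<lambda>k. \<integral>\<^sup>+x\<in>cube s k. ennreal (grad_sq w x) \<partial>lborel"
    let ?U = "\<lambda>k. \<integral>\<^sup>+x\<in>cube s k. ennreal (W x * (norm (w x))\<^sup>2) \<partial>lborel"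
    let ?P = "\<lambda>k. \<integral>\<^sup>+x\<in>cube s k. (\<integral>\<^sup>+y\<in>cube s k. ennreal ((norm (w y - w x))\<^sup>2) \<partial>lborel) \<partial>lborel"
    have cell: "(\<integral>\<^sup>+x\<in>cube s k. ennreal ((norm (w x))\<^sup>2) \<partial>lborel) \<le> ennreal \<epsilon>' * ?G k + ennreal \<epsilon>' * ?U k + b k" for k
    proof -
      have "?P k \<le> ennreal (real ?n * s\<^sup>2) * 2 ^ ?n * emeasure lborel (cube s k) * ?G k"
        by (rule poincare_convex[OF w convex_cube _ cube_diameter]) simp_all
      also have "ennreal (real ?n * s\<^sup>2) * 2 ^ ?n * emeasure lborel (cube s k) = ennreal (real ?n * s\<^sup>2 * 2 ^ ?n * s ^ ?n)"
        using s by (simp add: emeasure_cube ennreal_mult ennreal_power[symmetric])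
      finally have P: "ennreal a * ?P k \<le> ennreal (a * (real ?n * s\<^sup>2 * 2 ^ ?n * s ^ ?n)) * ?G k" if "a \<ge> 0" for a
        using that by (simp add: ennreal_mult' mult.assoc mult_left_mono)
      show ?thesis
      proof (cases "k \<in> I")
        case True
        have "(\<integral>\<^sup>+x\<in>cube s k. ennreal ((norm (w x))\<^sup>2) \<partial>lborel) \<le> ennreal (2 / s ^ ?n) * ?P k + b k"
          using near_estimate[OF w _ bounded_cube emeasure_cube[OF s(1)]] s True by (simp add: b_def c_def)
        also have "ennreal (2 / s ^ ?n) * ?P k \<le> ennreal (2 / s ^ ?n * (real ?n * s\<^sup>2 * 2 ^ ?n * s ^ ?n)) * ?G k"
          using s by (intro P) simp
        also have "2 / s ^ ?n * (real ?n * s\<^sup>2 * 2 ^ ?n * s ^ ?n) = 2 * (real ?n * s\<^sup>2 * 2 ^ ?n)"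
          using s by simp
        also have "ennreal (2 * (real ?n * s\<^sup>2 * 2 ^ ?n)) * ?G k \<le> ennreal \<epsilon>' * ?G k"
          by (intro mult_right_mono ennreal_leI near_c) simp
        finally show ?thesis
          by (rule order_trans) (auto intro!: add_mono add_increasing2)
      next
        case False
        let ?m = "\<gamma> * r ^ ?n"
        have m0: "?m > 0" using \<gamma> r by simp
        have "(\<integral>\<^sup>+x\<in>cube s k. ennreal ((norm (w x))\<^sup>2) \<partial>lborel) \<le>
          ennreal (4 / M) * emeasure lborel (cube s k) * ?U k + ennreal (4 / ?m) * ?P k"
        proof (rule far_estimate[OF w Wc W0 M m0 r])
          show "ball (cube_center s k) r \<subseteq> cube s k" unfolding r_def by (rule ball_subset_cube[OF s(1)])
          show "M \<le> (LINT x:ball (cube_center s k) r - F|lborel. W x)"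
            if "compact F" "F \<subseteq> ball (cube_center s k) r" "measure lborel F \<le> ?m" for F
            using False that by (intro H) (auto simp: I_def)
        qed simp
        also have "ennreal (4 / M) * emeasure lborel (cube s k) = ennreal \<epsilon>'"
          using s \<epsilon>' by (simp add: emeasure_cube M_def ennreal_mult[symmetric])
        also have "ennreal (4 / ?m) * ?P k \<le> ennreal (4 / ?m * (real ?n * s\<^sup>2 * 2 ^ ?n * s ^ ?n)) * ?G k"
          using m0 by (intro P) simp
        also have "4 / ?m * (real ?n * s\<^sup>2 * 2 ^ ?n * s ^ ?n) = 4 * (real ?n * s\<^sup>2 * 4 ^ ?n) / \<gamma>"
        proof -
          have "(4::real) ^ ?n = 2 ^ ?n * 2 ^ ?n" by (simp add: power_mult_distrib[symmetric])
          then show ?thesis using s \<gamma> by (simp add: r_def power_divide field_simps)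
        qed
        also have "ennreal (4 * (real ?n * s\<^sup>2 * 4 ^ ?n) / \<gamma>) * ?G k \<le> ennreal \<epsilon>' * ?G k"
          by (intro mult_right_mono ennreal_leI far_c) simp
        finally show ?thesis
          by (rule order_trans) (auto simp: add.commute b_def False)
      qed
    qed
    have "(\<integral>\<^sup>+x. ennreal ((norm (w x))\<^sup>2) \<partial>lborel) \<le> (\<integral>\<^sup>+k. ennreal \<epsilon>' * ?G k + ennreal \<epsilon>' * ?U k + b k \<partial>count_space UNIV)"
      by (subst nn_integral_cubes[OF s(1)], measurable) (intro nn_integral_mono cell)
    also have "\<dots> = ennreal \<epsilon>' * (\<integral>\<^sup>+x. ennreal (grad_sq w x) \<partial>lborel)
       + ennreal \<epsilon>' * (\<integral>\<^sup>+x. ennreal (W x * (norm (w x))\<^sup>2) \<partial>lborel) + (\<integral>\<^sup>+k. b k \<partial>count_space UNIV)"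
      by (simp add: nn_integral_add nn_integral_cmult nn_integral_cubes[OF s(1), of "\<lambda>x. ennreal (grad_sq w x)"]
        nn_integral_cubes[OF s(1), of "\<lambda>x. ennreal (W x * (norm (w x))\<^sup>2)"])
    also have "(\<integral>\<^sup>+k. b k \<partial>count_space UNIV) = (\<Sum>k\<in>I. b k)"
      by (rule nn_integral_count_space') (auto simp: b_def I)
    also have "\<dots> = ennreal (c * (\<Sum>k\<in>I. (norm (LINT x:cube s k|lborel. w x))\<^sup>2))"
      using c by (simp add: b_def sum_distrib_left sum_ennreal)
    also have "(\<integral>\<^sup>+x. ennreal (grad_sq w x) \<partial>lborel) = ennreal (LINT x|lborel. grad_sq w x)"
      by (rule nn_integral_eq_integral[OF en(2)]) simp_all
    also have "(\<integral>\<^sup>+x. ennreal (W x * (norm (w x))\<^sup>2) \<partial>lborel) = ennreal (LINT x|lborel. W x * (norm (w x))\<^sup>2)"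
    proof (rule nn_integral_eq_integral)
      show "integrable lborel (\<lambda>x. W x * (norm (w x))\<^sup>2)"
        using en(3,4) by (simp add: W_def distrib_right)
    qed (simp add: W0)
    also have "(\<integral>\<^sup>+x. ennreal ((norm (w x))\<^sup>2) \<partial>lborel) = ennreal (LINT x|lborel. (norm (w x))\<^sup>2)"
      by (rule nn_integral_eq_integral[OF en(4)]) simp_all
    finally have "(LINT x|lborel. (norm (w x))\<^sup>2) \<le> \<epsilon>' * (LINT x|lborel. grad_sq w x)
      + \<epsilon>' * (LINT x|lborel. W x * (norm (w x))\<^sup>2) + c * (\<Sum>k\<in>I. (norm (LINT x:cube s k|lborel. w x))\<^sup>2)"
      using \<epsilon>' c W0
      by (simp add: ennreal_mult[symmetric] ennreal_plus[symmetric] sum_nonneg ennreal_le_iff add_nonneg_nonneg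
        del: ennreal_plus)
    also have "(LINT x|lborel. W x * (norm (w x))\<^sup>2) =
        (LINT x|lborel. potential \<phi> x * (norm (w x))\<^sup>2) + C * (LINT x|lborel. (norm (w x))\<^sup>2)"
      using en(3,4) by (simp add: W_def distrib_right)
    finally have "(LINT x|lborel. (norm (w x))\<^sup>2) \<le> \<epsilon>' * ((LINT x|lborel. (\<Sum>j\<in>UNIV. (norm (twisted \<phi> j w x))\<^sup>2))
       + C * (LINT x|lborel. (norm (w x))\<^sup>2)) + c * (\<Sum>k\<in>I. (norm (LINT x:cube s k|lborel. w x))\<^sup>2)"
      using en(1) by (simp add: algebra_simps)
    also have "\<epsilon>' * ((LINT x|lborel. (\<Sum>j\<in>UNIV. (norm (twisted \<phi> j w x))\<^sup>2)) + C * (LINT x|lborel. (norm (w x))\<^sup>2))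
       \<le> \<epsilon>' * ((1 + C) * ((LINT x|lborel. (\<Sum>j\<in>UNIV. (norm (twisted \<phi> j w x))\<^sup>2)) + (LINT x|lborel. (norm (w x))\<^sup>2)))"
      using \<epsilon>' C by (intro mult_left_mono) (auto simp: algebra_simps intro!: add_nonneg_nonneg mult_nonneg_nonneg Bochner_Integration.integral_nonneg sum_nonneg)
    also have "\<dots> = \<epsilon> * ((LINT x|lborel. (\<Sum>j\<in>UNIV. (norm (twisted \<phi> j w x))\<^sup>2)) + (LINT x|lborel. (norm (w x))\<^sup>2))"
      using C by (simp add: \<epsilon>'_def)
    finally show ?thesis by simp
  qed
  show thesis by (rule that[OF I c main[unfolded s_def]])
qed

section \<open>Mollification\<close>

lemma bounded_range_bounded_support:
  fixes f :: "'a::euclidean_space \<Rightarrow> 'b::real_normed_vector"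
  assumes "continuous_on UNIV f" "\<And>x. norm x > R \<Longrightarrow> f x = 0"
  obtains K where "K \<ge> 0" "\<And>x. norm (f x) \<le> K"
proof -
  have "bounded (f ` cball 0 R)"
    by (intro compact_imp_bounded compact_continuous_image continuous_on_subset[OF assms(1)]) auto
  then obtain K where K: "\<And>x. x \<in> cball 0 R \<Longrightarrow> norm (f x) \<le> K"
    unfolding bounded_iff by blast
  have "norm (f x) \<le> max K 0" for x
    using K[of x] assms(2)[of x] by (cases "norm x > R") auto
  then show ?thesis by (intro that[of "max K 0"]) auto
qed

lemma uniformly_continuous_bounded_support:
  fixes f :: "'a::euclidean_space \<Rightarrow> 'b::real_normed_vector"
  assumes "continuous_on UNIV f" "\<And>x. norm x > R \<Longrightarrow> f x = 0" "\<eta> > 0"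
  obtains d where "d > 0" "\<And>x y. norm (y - x) < d \<Longrightarrow> norm (f y - f x) < \<eta>"
proof -
  have "uniformly_continuous_on (cball 0 (R + 1)) f"
    by (intro compact_uniformly_continuous continuous_on_subset[OF assms(1)]) auto
  then obtain d where d: "d > 0" "\<And>x y. x \<in> cball 0 (R + 1) \<Longrightarrow> y \<in> cball 0 (R + 1) \<Longrightarrow> dist y x < d \<Longrightarrow> dist (f y) (f x) < \<eta>"
    using assms(3) unfolding uniformly_continuous_on_def by meson
  \<comment> \<open>Points at distance less than 1 either both lie in the ball of radius
    \<open>R + 1\<close>, or both lie outside the ball of radius R, where f vanishes.\<close>
  have "norm (f y - f x) < \<eta>" if "norm (y - x) < min d 1" for x y
  proof (cases "norm x \<le> R + 1 \<and> norm y \<le> R + 1")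
    case True
    then show ?thesis using d(2)[of x y] that by (simp add: dist_norm)
  next
    case False
    moreover have "norm x \<le> norm y + norm (y - x)" "norm y \<le> norm x + norm (y - x)"
      using norm_triangle_sub[of x y] norm_triangle_sub[of y x] by (simp_all add: norm_minus_commute)
    ultimately have "norm x > R" "norm y > R" using that by auto
    then show ?thesis using assms by simp
  qed
  with d(1) show ?thesis by (intro that[of "min d 1"]) auto
qed

text \<open>The Taylor remainder is controlled by the oscillation of the derivative, and the partial
  derivatives are uniformly continuous because they too have bounded support. Uniformity in a
  matters because the remainder will be integrated against an arbitrary integrable function.\<close>

lemma uniformly_differentiable_bounded_support:
  fixes f :: "real^'n::finite \<Rightarrow> real"
  assumes f: "C_k 1 f" and supp: "\<And>x. norm x > R \<Longrightarrow> f x = 0" and \<eta>: "\<eta> > 0"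
  obtains d where "d > 0"
    "\<And>a b. norm (b - a) < d \<Longrightarrow> \<bar>f b - f a - (\<Sum>j\<in>UNIV. (b - a) $ j * partial j f a)\<bar> \<le> norm (b - a) * \<eta>"
proof -
  let ?\<eta> = "\<eta> / real CARD('n)"
  have "\<exists>d>0. \<forall>x y. norm (y - x) < d \<longrightarrow> norm (partial j f y - partial j f x) < ?\<eta>" for j
  proof -
    have c: "continuous_on UNIV (partial j f)" and pos: "?\<eta> > 0" using f \<eta> by auto
    obtain d where "d > 0" "\<And>x y. norm (y - x) < d \<Longrightarrow> norm (partial j f y - partial j f x) < ?\<eta>"
      by (rule uniformly_continuous_bounded_support[OF c _ pos]) (auto intro: partial_eq_0_cball[OF supp])
    then show ?thesis by blast
  qed
  then obtain d where d: "\<And>j. d j > 0" "\<And>j x y. norm (y - x) < d j \<Longrightarrow> norm (partial j f y - partial j f x) < ?\<eta>"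
    by metis
  define d' where "d' = Min (range d)"
  have d': "d' > 0" "\<And>j. d' \<le> d j" using d(1) by (auto simp: d'_def)
  have "\<bar>f b - f a - (\<Sum>j\<in>UNIV. (b - a) $ j * partial j f a)\<bar> \<le> norm (b - a) * \<eta>" if "norm (b - a) < d'" for a b
  proof -
    define D where "D = (\<lambda>x v. \<Sum>j\<in>UNIV. v $ j *\<^sub>R partial j f x)"
    have "norm (f b - f a - D a (b - a)) \<le> norm (b - a) * \<eta>"
    proof (rule differentiable_bound_linearization[where S="ball a d'"])
      show "(f has_derivative D x) (at x within ball a d')" for x
        unfolding D_def using f by (intro has_derivative_at_withinI[OF has_derivative_partial]) simp
      show "onorm (D x - D a) \<le> \<eta>" if "x \<in> ball a d'" for x
      proof (rule onorm_le)
        fix v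
        have "(D x - D a) v = (\<Sum>j\<in>UNIV. v $ j * (partial j f x - partial j f a))"
          by (simp add: D_def sum_subtractf right_diff_distrib)
        also have "norm \<dots> \<le> (\<Sum>j\<in>(UNIV::'n set). norm v * ?\<eta>)"
        proof (rule sum_norm_le)
          fix j
          have "norm (x - a) < d j" using that d'(2)[of j] by (simp add: dist_norm norm_minus_commute)
          then have "norm (partial j f x - partial j f a) \<le> ?\<eta>" using d(2) less_imp_le by blast
          then show "norm (v $ j * (partial j f x - partial j f a)) \<le> norm v * ?\<eta>"
            unfolding real_norm_def abs_mult by (intro mult_mono component_le_norm_cart) auto
        qed
        finally show "norm ((D x - D a) v) \<le> \<eta> * norm v" by (simp add: mult.commute)
      qed
      show "a \<in> ball a d'" using d' by simp
      show "a + t *\<^sub>R (b - a) \<in> ball a d'" if "t \<in> {0..1}" for t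
      proof -
        have "\<bar>t\<bar> * norm (b - a) \<le> norm (b - a)" using that by (intro mult_left_le_one_le) auto
        with \<open>norm (b - a) < d'\<close> show ?thesis by (simp add: dist_norm)
      qed
    qed
    then show ?thesis by (simp add: D_def)
  qed
  with d'(1) show ?thesis by (rule that)
qed

definition conv :: "(real^'n::finite \<Rightarrow> real) \<Rightarrow> (real^'n \<Rightarrow> complex) \<Rightarrow> real^'n \<Rightarrow> complex" where
  "conv f v x = (LINT y|lborel. f (x - y) *\<^sub>R v y)"

lemma integrable_bounded_mult:
  fixes f :: "real^'n::finite \<Rightarrow> real" and v :: "real^'n \<Rightarrow> complex"
  assumes [measurable]: "f \<in> borel_measurable borel" and "\<And>x. norm (f x) \<le> K" and v: "integrable lborel v"
  shows "integrable lborel (\<lambda>y. f y *\<^sub>R v y)"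
proof (rule Bochner_Integration.integrable_bound)
  show "integrable lborel (\<lambda>y. K * norm (v y))" using v by simp
  show "(\<lambda>y. f y *\<^sub>R v y) \<in> borel_measurable lborel"
    using borel_measurable_integrable[OF v] by measurable
  show "AE y in lborel. norm (f y *\<^sub>R v y) \<le> norm (K * norm (v y))"
    using assms(2) order_trans[OF norm_ge_zero assms(2)] by (auto intro!: mult_right_mono)
qed

lemma integrable_conv:
  fixes f :: "real^'n::finite \<Rightarrow> real" and v :: "real^'n \<Rightarrow> complex"
  assumes f: "continuous_on UNIV f" "\<And>x. norm x > R \<Longrightarrow> f x = 0" and v: "integrable lborel v"
  shows "integrable lborel (\<lambda>y. f (x - y) *\<^sub>R v y)"
proof -
  obtain K where K: "\<And>x. norm (f x) \<le> K" using bounded_range_bounded_support[OF f] by blast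
  have "continuous_on UNIV (\<lambda>y. f (x - y))"
    by (rule continuous_on_compose2[OF f(1)]) (auto intro!: continuous_intros)
  then show ?thesis
    by (rule integrable_bounded_mult[OF borel_measurable_continuous_onI _ v]) (rule K)
qed

lemma conv_continuous:
  fixes f :: "real^'n::finite \<Rightarrow> real"
  assumes f: "continuous_on UNIV f" "\<And>x. norm x > R \<Longrightarrow> f x = 0" and v: "integrable lborel v"
  shows "continuous_on UNIV (conv f v)"
proof -
  \<comment> \<open>The added 1 keeps N positive, so that one may divide by it even when v
    vanishes.\<close>
  define N where "N = (LINT y|lborel. norm (v y)) + 1"
  have N: "N > 0" by (simp add: N_def add_nonneg_pos)
  have if_: "integrable lborel (\<lambda>y. f (x - y) *\<^sub>R v y)" for x
    by (rule integrable_conv[OF f v])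
  have "\<exists>d>0. \<forall>x'. norm (x' - x) < d \<longrightarrow> norm (conv f v x' - conv f v x) < e" if "e > 0" for e x
  proof -
    obtain d where d: "d > 0" "\<And>x y. norm (y - x) < d \<Longrightarrow> norm (f y - f x) < e / (2 * N)"
    proof (rule uniformly_continuous_bounded_support[OF f])
      show "e / (2 * N) > 0" using N \<open>e > 0\<close> by simp
    qed auto
    have "norm (conv f v x' - conv f v x) < e" if "norm (x' - x) < d" for x'
    proof -
      have "conv f v x' - conv f v x = (LINT y|lborel. (f (x' - y) - f (x - y)) *\<^sub>R v y)"
        unfolding conv_def by (simp add: scaleR_left_diff_distrib if_)
      also have "norm \<dots> \<le> (LINT y|lborel. (e / (2 * N)) * norm (v y))"
      proof (rule Bochner_Integration.integral_norm_bound_integral)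
        show "integrable lborel (\<lambda>y. (f (x' - y) - f (x - y)) *\<^sub>R v y)"
          by (simp add: scaleR_left_diff_distrib if_)
        show "norm ((f (x' - y) - f (x - y)) *\<^sub>R v y) \<le> e / (2 * N) * norm (v y)" for y
        proof -
          have "\<bar>f (x' - y) - f (x - y)\<bar> \<le> e / (2 * N)"
            using d(2)[of "x' - y" "x - y"] that by simp
          then show ?thesis unfolding norm_scaleR by (rule mult_right_mono) simp
        qed
      qed (use v in simp)
      also have "\<dots> = e / (2 * N) * (LINT y|lborel. norm (v y))" by simp
      also have "\<dots> \<le> e / (2 * N) * N" using N \<open>e > 0\<close> by (intro mult_left_mono) (auto simp: N_def)
      also have "\<dots> < e" using N \<open>e > 0\<close> by simp
      finally show ?thesis .
    qed
    with d(1) show ?thesis by blast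
  qed
  then show ?thesis by (simp add: continuous_on_iff dist_norm)
qed

text \<open>All derivatives fall on the kernel. The first-order remainder of f is uniformly small
  relative to the increment, and integrating it against v costs only the integral of
  \<open>norm (v z)\<close>.\<close>

lemma conv_has_derivative:
  fixes f :: "real^'n::finite \<Rightarrow> real"
  assumes f: "C_k 1 f" "\<And>x. norm x > R \<Longrightarrow> f x = 0" and v: "integrable lborel v"
  shows "(conv f v has_derivative (\<lambda>h. \<Sum>j\<in>UNIV. h $ j *\<^sub>R conv (partial j f) v x)) (at x)"
  unfolding has_derivative_at_alt
proof (intro conjI allI impI)
  show "bounded_linear (\<lambda>h::real^'n. \<Sum>j\<in>UNIV. h $ j *\<^sub>R conv (partial j f) v x)"
    by (intro bounded_linear_sum bounded_linear_scaleR_const bounded_linear_vec_nth)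
  fix e :: real assume e: "e > 0"
  define N where "N = (LINT y|lborel. norm (v y)) + 1"
  have N: "N > 0" by (simp add: N_def add_nonneg_pos)
  have pc: "continuous_on UNIV (partial j f)" for j using f(1) by simp
  have p0: "partial j f x = 0" if "norm x > R" for j x by (rule partial_eq_0_cball[OF f(2) that])
  obtain d where d: "d > 0"
    "\<And>a b. norm (b - a) < d \<Longrightarrow> \<bar>f b - f a - (\<Sum>j\<in>UNIV. (b - a) $ j * partial j f a)\<bar> \<le> norm (b - a) * (e / N)"
  proof (rule uniformly_differentiable_bounded_support[OF f])
    show "e / N > 0" using N e by simp
  qed auto
  have if_: "integrable lborel (\<lambda>z. f (y - z) *\<^sub>R v z)" for y
    by (rule integrable_conv[OF C_k_1_continuous[OF f(1)] f(2) v])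
  have ip: "integrable lborel (\<lambda>z. partial j f (y - z) *\<^sub>R v z)" for y j
    by (rule integrable_conv[OF pc p0 v])
  have "norm (conv f v y - conv f v x - (\<Sum>j\<in>UNIV. (y - x) $ j *\<^sub>R conv (partial j f) v x)) \<le> e * norm (y - x)"
    if "norm (y - x) < d" for y
  proof -
    let ?q = "\<lambda>z. f (y - z) - f (x - z) - (\<Sum>j\<in>UNIV. (y - x) $ j * partial j f (x - z))"
    have q: "?q z *\<^sub>R v z = f (y - z) *\<^sub>R v z - f (x - z) *\<^sub>R v z - (\<Sum>j\<in>UNIV. (y - x) $ j *\<^sub>R (partial j f (x - z) *\<^sub>R v z))" for z
      by (simp add: scaleR_left_diff_distrib scaleR_left.sum)
    have "conv f v y - conv f v x - (\<Sum>j\<in>UNIV. (y - x) $ j *\<^sub>R conv (partial j f) v x)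
      = (LINT z|lborel. ?q z *\<^sub>R v z)"
      unfolding q conv_def
      by (simp add: if_ ip Bochner_Integration.integral_sum Bochner_Integration.integrable_sum del: scaleR_scaleR)
    also have "norm \<dots> \<le> (LINT z|lborel. (norm (y - x) * (e / N)) * norm (v z))"
    proof (rule Bochner_Integration.integral_norm_bound_integral)
      show "integrable lborel (\<lambda>z. ?q z *\<^sub>R v z)"
        unfolding q by (intro Bochner_Integration.integrable_diff Bochner_Integration.integrable_sum integrable_scaleR_right if_ ip)
      show "norm (?q z *\<^sub>R v z) \<le> norm (y - x) * (e / N) * norm (v z)" for z
      proof -
        have "\<bar>?q z\<bar> \<le> norm (y - x) * (e / N)"
          using d(2)[of "y - z" "x - z"] that by simp
        then show ?thesis unfolding norm_scaleR by (rule mult_right_mono) simp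
      qed
    qed (use v in simp)
    also have "\<dots> = norm (y - x) * (e / N) * (LINT z|lborel. norm (v z))" by simp
    also have "\<dots> \<le> norm (y - x) * (e / N) * N" using N e by (intro mult_left_mono) (auto simp: N_def)
    also have "\<dots> = e * norm (y - x)" using N by simp
    finally show ?thesis .
  qed
  with d(1) show "\<exists>d>0. \<forall>y. norm (y - x) < d \<longrightarrow>
      norm (conv f v y - conv f v x - (\<Sum>j\<in>UNIV. (y - x) $ j *\<^sub>R conv (partial j f) v x)) \<le> e * norm (y - x)"
    by blast
qed

lemma partial_conv:
  fixes f :: "real^'n::finite \<Rightarrow> real"
  assumes f: "C_k 1 f" "\<And>x. norm x > R \<Longrightarrow> f x = 0" and v: "integrable lborel v"
  shows "partial j (conv f v) = conv (partial j f) v"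
proof
  fix x
  show "partial j (conv f v) x = conv (partial j f) v x"
    by (subst partial_eq[OF conv_has_derivative[OF f v]])
       (simp_all add: axis_def if_distrib[of "\<lambda>a. a *\<^sub>R _"] cong: if_cong)
qed

lemma C_k_1_conv:
  fixes f :: "real^'n::finite \<Rightarrow> real"
  assumes f: "C_k 1 f" "\<And>x. norm x > R \<Longrightarrow> f x = 0" and v: "integrable lborel v"
  shows "C_k 1 (conv f v)"
  unfolding C_k_1_iff
proof (intro conjI allI)
  show "conv f v differentiable at x" for x
    using conv_has_derivative[OF f v] unfolding differentiable_def by blast
  show "continuous_on UNIV (partial j (conv f v))" for j
  proof -
    have "continuous_on UNIV (partial j f)" using f(1) by simp
    then have "continuous_on UNIV (conv (partial j f) v)"
      by (rule conv_continuous[OF _ partial_eq_0_cball[OF f(2)] v])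
    then show ?thesis by (simp add: partial_conv[OF f v])
  qed
qed

lemma conv_eq_0:
  fixes f :: "real^'n::finite \<Rightarrow> real"
  assumes "\<And>x. norm x > a \<Longrightarrow> f x = 0" "\<And>x. norm x > R \<Longrightarrow> v x = 0" "norm x > a + R"
  shows "conv f v x = 0"
proof -
  have "f (x - y) *\<^sub>R v y = 0" for y
  proof (cases "norm y > R")
    case False
    then have "norm (x - y) > a" using assms(3) norm_triangle_ineq2[of x y] by linarith
    then show ?thesis using assms(1) by simp
  qed (simp add: assms(2))
  then have "(\<lambda>y. f (x - y) *\<^sub>R v y) = (\<lambda>y. 0)" by blast
  then show ?thesis unfolding conv_def by simp
qed

definition mollifier :: "real \<Rightarrow> (real^'n::finite \<Rightarrow> real) \<Rightarrow> bool" where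
  "mollifier \<epsilon> \<rho> \<longleftrightarrow> smooth \<rho> \<and> (\<forall>x. \<rho> x \<ge> 0) \<and> (\<forall>x. norm x > \<epsilon> \<longrightarrow> \<rho> x = 0) \<and>
     (LINT x|lborel. \<rho> x) = 1"

lemma mollifier_exists:
  assumes "\<epsilon> > 0"
  obtains \<rho> :: "real^'n::finite \<Rightarrow> real" where "mollifier \<epsilon> \<rho>"
proof -
  \<comment> \<open>\<open>bump\<close> vanishes from norm n on, so this scaling puts the support
    into the ball of radius \<epsilon>.\<close>
  define c where "c = real CARD('n) / \<epsilon>"
  have c: "c > 0" using assms by (simp add: c_def)
  define b where "b = (\<lambda>x::real^'n. bump (0 + c *\<^sub>R x))"
  have b: "smooth b" unfolding b_def by (rule smooth_affine[OF smooth_bump])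
  have b0: "b x = 0" if "norm x > \<epsilon>" for x
    unfolding b_def
  proof (rule bump_eq_0)
    have "c * norm x \<ge> c * \<epsilon>" using that c by simp
    then show "real CARD('n) \<le> norm (0 + c *\<^sub>R x)" using c assms by (simp add: c_def)
  qed
  have bi: "integrable lborel b"
    by (rule integrable_continuous_bounded_support[of _ "cball 0 \<epsilon>"]) (use b0 smooth_continuous_on[OF b] in auto)
  \<comment> \<open>A vanishing integral would make the open set where b is nonzero negligible,
    hence empty, although b is 1 at the origin.\<close>
  have "(LINT x|lborel. b x) \<noteq> 0"
  proof
    assume "(LINT x|lborel. b x) = 0"
    then have "AE x in lborel. b x = 0"
      using integral_nonneg_eq_0_iff_AE[OF bi AE_I2] by (simp add: b_def bump_nonneg)
    moreover have op: "open {x. b x \<noteq> 0}"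
      by (intro open_Collect_neq smooth_continuous_on b continuous_intros)
    ultimately have "{x. b x \<noteq> 0} \<in> null_sets lborel"
      using AE_iff_null_sets[of "{x. b x \<noteq> 0}" lborel] by simp
    then have "negligible {x. b x \<noteq> 0}"
      by (simp add: negligible_iff_null_sets null_sets_completionI)
    then have "{x. b x \<noteq> 0} = {}" using open_not_negligible[OF op] by blast
    moreover have "b 0 = 1" by (simp add: b_def bump_0)
    ultimately show False by auto
  qed
  moreover have "(LINT x|lborel. b x) \<ge> 0"
    by (intro Bochner_Integration.integral_nonneg) (simp add: b_def bump_nonneg)
  ultimately have I: "(LINT x|lborel. b x) > 0" by simp
  have bn: "b x \<ge> 0" for x by (simp add: b_def bump_nonneg)
  have "mollifier \<epsilon> (\<lambda>x. inverse (LINT x|lborel. b x) * b x)"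
    unfolding mollifier_def
    using I b0 bn by (auto intro!: smooth_mult smooth_const b)
  then show ?thesis by (rule that)
qed

section \<open>Square integrable functions\<close>

text \<open>The squared norm is taken as an extended nonnegative number so that Tonelli, Young and
  Fatou apply without integrability side conditions; finiteness encodes square
  integrability.\<close>

definition l2sq :: "(real^'n::finite \<Rightarrow> complex) \<Rightarrow> ennreal" where
  "l2sq v = (\<integral>\<^sup>+x. ennreal ((norm (v x))\<^sup>2) \<partial>lborel)"

lemma integrable_l2sq:
  assumes [measurable]: "v \<in> borel_measurable borel" and "l2sq v < \<infinity>"
  shows "integrable lborel (\<lambda>x. (norm (v x))\<^sup>2)"
    and "ennreal (LINT x|lborel. (norm (v x))\<^sup>2) = l2sq v"
proof -
  show i: "integrable lborel (\<lambda>x. (norm (v x))\<^sup>2)"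
    using assms(2) unfolding l2sq_def by (intro integrableI_bounded) auto
  show "ennreal (LINT x|lborel. (norm (v x))\<^sup>2) = l2sq v"
    unfolding l2sq_def by (rule nn_integral_eq_integral[OF i, symmetric]) simp
qed

lemma l2sq_leI:
  assumes "v \<in> borel_measurable borel" "l2sq v < \<infinity>" "(LINT x|lborel. (norm (v x))\<^sup>2) \<le> \<delta>"
  shows "l2sq v \<le> ennreal \<delta>"
  using integrable_l2sq(2)[OF assms(1,2)] ennreal_leI[OF assms(3)] by simp

lemma l2sq_mono: "(\<And>x. norm (u x) \<le> norm (v x)) \<Longrightarrow> l2sq u \<le> l2sq v"
  unfolding l2sq_def by (intro nn_integral_mono ennreal_leI power_mono) auto

lemma l2sq_scaleR:
  assumes [measurable]: "v \<in> borel_measurable borel"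
  shows "l2sq (\<lambda>x. c *\<^sub>R v x) = ennreal (c\<^sup>2) * l2sq v"
  unfolding l2sq_def by (simp add: power_mult_distrib ennreal_mult nn_integral_cmult)

lemma norm_add_sq_le: "(norm (a + b))\<^sup>2 \<le> 2 * (norm a)\<^sup>2 + 2 * (norm (b :: 'a::real_normed_vector))\<^sup>2"
proof -
  have "(norm (a + b))\<^sup>2 \<le> (norm a + norm b)\<^sup>2" by (intro power_mono norm_triangle_ineq) simp
  also have "\<dots> \<le> 2 * (norm a)\<^sup>2 + 2 * (norm b)\<^sup>2"
    using sum_squares_bound[of "norm a" "norm b"] by (simp add: power2_sum)
  finally show ?thesis .
qed

lemma l2sq_add:
  assumes [measurable]: "u \<in> borel_measurable borel" "v \<in> borel_measurable borel"
  shows "l2sq (\<lambda>x. u x + v x) \<le> 2 * l2sq u + 2 * l2sq v"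
proof -
  have "l2sq (\<lambda>x. u x + v x) \<le> (\<integral>\<^sup>+x. 2 * ennreal ((norm (u x))\<^sup>2) + 2 * ennreal ((norm (v x))\<^sup>2) \<partial>lborel)"
    unfolding l2sq_def
  proof (rule nn_integral_mono)
    fix x
    have "ennreal ((norm (u x + v x))\<^sup>2) \<le> ennreal (2 * (norm (u x))\<^sup>2 + 2 * (norm (v x))\<^sup>2)"
      by (intro ennreal_leI norm_add_sq_le)
    then show "ennreal ((norm (u x + v x))\<^sup>2) \<le> 2 * ennreal ((norm (u x))\<^sup>2) + 2 * ennreal ((norm (v x))\<^sup>2)"
      by (simp add: ennreal_mult)
  qed
  also have "\<dots> = 2 * l2sq u + 2 * l2sq v"
    unfolding l2sq_def by (simp add: nn_integral_add nn_integral_cmult)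
  finally show ?thesis .
qed

lemma two_ennreal_add: "a \<ge> 0 \<Longrightarrow> b \<ge> 0 \<Longrightarrow> 2 * ennreal a + 2 * ennreal b = ennreal (2 * a + 2 * b)"
  by (simp add: ennreal_plus ennreal_mult)

lemma l2sq_bounded:
  assumes "\<And>x. norm (v x) \<le> \<eta>" "\<And>x. norm x > R \<Longrightarrow> v x = 0"
  shows "l2sq (v :: real^'n::finite \<Rightarrow> complex) \<le> ennreal (\<eta>\<^sup>2 * measure lborel (cball (0 :: real^'n) R))"
proof -
  have "l2sq v \<le> (\<integral>\<^sup>+x. ennreal (\<eta>\<^sup>2) * indicator (cball (0::real^'n) R) x \<partial>lborel)"
    unfolding l2sq_def
    by (intro nn_integral_mono) (use assms in \<open>auto simp: indicator_def intro!: ennreal_leI power_mono\<close>)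
  also have "\<dots> = ennreal (\<eta>\<^sup>2) * emeasure lborel (cball (0::real^'n) R)"
    by (simp add: nn_integral_cmult_indicator)
  also have "emeasure lborel (cball (0::real^'n) R) = ennreal (measure lborel (cball (0::real^'n) R))"
    using emeasure_bounded_finite[of "cball (0::real^'n) R"] by (intro emeasure_eq_ennreal_measure) auto
  finally show ?thesis by (simp add: ennreal_mult)
qed

text \<open>On the ball \<open>norm (v x)\<close> is at most 1 +
  \<open>(norm (v x))\<^sup>2\<close>, and outside it v vanishes.\<close>

lemma integrable_l2_bounded_support:
  assumes [measurable]: "v \<in> borel_measurable borel" and "l2sq v < \<infinity>" "\<And>x. norm x > R \<Longrightarrow> v x = 0"
  shows "integrable lborel (v :: real^'n::finite \<Rightarrow> complex)"
proof (rule Bochner_Integration.integrable_bound)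
  show "integrable lborel (\<lambda>x. indicator (cball (0::real^'n) R) x *\<^sub>R (1::real) + (norm (v x))\<^sup>2)"
    by (intro Bochner_Integration.integrable_add integrable_l2sq assms borel_integrable_compact) auto
  have "norm (v x) \<le> indicator (cball 0 R) x *\<^sub>R 1 + (norm (v x))\<^sup>2" for x
  proof (cases "norm x \<le> R")
    case True
    have "0 \<le> (norm (v x) - 1)\<^sup>2" by simp
    then have "2 * norm (v x) \<le> 1 + (norm (v x))\<^sup>2" by (simp add: power2_diff)
    then show ?thesis using True by (auto intro: order_trans[of _ "2 * norm (v x)"])
  qed (simp add: assms)
  then show "AE x in lborel. norm (v x) \<le> norm (indicator (cball 0 R) x *\<^sub>R (1::real) + (norm (v x))\<^sup>2)"
    by (auto intro!: AE_I2 order_trans[OF _ abs_ge_self] simp del: scaleR_conv_of_real)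
qed measurable

section \<open>Young's inequality and density of continuous functions\<close>

lemma norm_integral_le_nn_integral:
  fixes f :: "'a \<Rightarrow> 'b::{banach, second_countable_topology}"
  shows "ennreal (norm (LINT x|M. f x)) \<le> (\<integral>\<^sup>+x. ennreal (norm (f x)) \<partial>M)"
  by (cases "integrable M f") (auto intro: integral_norm_bound_ennreal simp: not_integrable_integral_eq)

lemma mollifier_measurable: "mollifier \<epsilon> \<rho> \<Longrightarrow> \<rho> \<in> borel_measurable borel"
  by (auto simp: mollifier_def intro: borel_measurable_continuous_onI smooth_continuous_on)

lemma nn_integral_mollifier:
  fixes \<rho> :: "real^'n::finite \<Rightarrow> real"
  assumes "mollifier \<epsilon> \<rho>"
  shows "(\<integral>\<^sup>+y. ennreal (\<rho> (x - y)) \<partial>lborel) = 1" "(\<integral>\<^sup>+x. ennreal (\<rho> (x - y)) \<partial>lborel) = 1"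
proof -
  note [measurable] = mollifier_measurable[OF assms]
  have "integrable lborel \<rho>"
    using assms unfolding mollifier_def by (metis not_integrable_integral_eq zero_neq_one)
  then have *: "(\<integral>\<^sup>+y. ennreal (\<rho> y) \<partial>lborel) = 1"
    using assms by (subst nn_integral_eq_integral) (auto simp: mollifier_def)
  show "(\<integral>\<^sup>+y. ennreal (\<rho> (x - y)) \<partial>lborel) = 1"
    using nn_integral_lborel_affine[of "\<lambda>y. ennreal (\<rho> y)" "-1" x] * by simp
  show "(\<integral>\<^sup>+x. ennreal (\<rho> (x - y)) \<partial>lborel) = 1"
    using nn_integral_lborel_affine[of "\<lambda>y. ennreal (\<rho> y)" 1 "- y"] * by simp
qed

lemma integral_mollifier:
  fixes \<rho> :: "real^'n::finite \<Rightarrow> real"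
  assumes "mollifier \<epsilon> \<rho>"
  shows "integrable lborel (\<lambda>y. \<rho> (x - y))" "(LINT y|lborel. \<rho> (x - y)) = 1"
proof -
  note [measurable] = mollifier_measurable[OF assms]
  have nn: "\<rho> y \<ge> 0" for y using assms by (simp add: mollifier_def)
  show "integrable lborel (\<lambda>y. \<rho> (x - y))"
    using nn nn_integral_mollifier(1)[OF assms, of x] by (intro integrableI_bounded) auto
  show "(LINT y|lborel. \<rho> (x - y)) = 1"
    using nn nn_integral_mollifier(1)[OF assms, of x] by (subst integral_eq_nn_integral) auto
qed

text \<open>Writing the kernel as the square of its root, Cauchy-Schwarz moves the square inside the
  average over the probability density \<open>\<rho> (x - y)\<close>; Tonelli then integrates the
  kernel in x to 1.\<close>

lemma young_inequality:
  fixes \<rho> :: "real^'n::finite \<Rightarrow> real" and g :: "real^'n \<Rightarrow> ennreal"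
  assumes \<rho>: "mollifier \<epsilon> \<rho>" and [measurable]: "g \<in> borel_measurable borel"
  shows "(\<integral>\<^sup>+x. (\<integral>\<^sup>+y. ennreal (\<rho> (x - y)) * g y \<partial>lborel)\<^sup>2 \<partial>lborel) \<le> (\<integral>\<^sup>+y. (g y)\<^sup>2 \<partial>lborel)"
proof -
  note [measurable] = mollifier_measurable[OF \<rho>]
  have nn: "\<rho> y \<ge> 0" for y using \<rho> by (simp add: mollifier_def)
  let ?s = "\<lambda>x y. ennreal (sqrt (\<rho> (x - y)))"
  have s2: "?s x y * ?s x y = ennreal (\<rho> (x - y))" for x y
    using nn[of "x - y"] by (simp add: ennreal_mult[symmetric])
  have "(\<integral>\<^sup>+y. ennreal (\<rho> (x - y)) * g y \<partial>lborel)\<^sup>2 \<le> (\<integral>\<^sup>+y. ennreal (\<rho> (x - y)) * (g y)\<^sup>2 \<partial>lborel)" for x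
  proof -
    have "(\<integral>\<^sup>+y. ennreal (\<rho> (x - y)) * g y \<partial>lborel)\<^sup>2 = (\<integral>\<^sup>+y. ?s x y * (?s x y * g y) \<partial>lborel)\<^sup>2"
      by (simp add: mult.assoc[symmetric] s2)
    also have "\<dots> \<le> (\<integral>\<^sup>+y. (?s x y)\<^sup>2 \<partial>lborel) * (\<integral>\<^sup>+y. (?s x y * g y)\<^sup>2 \<partial>lborel)"
      by (rule Cauchy_Schwarz_nn_integral) measurable
    also have "(\<lambda>y. (?s x y)\<^sup>2) = (\<lambda>y. ennreal (\<rho> (x - y)))"
      by (simp add: power2_eq_square s2)
    also have "(\<lambda>y. (?s x y * g y)\<^sup>2) = (\<lambda>y. ennreal (\<rho> (x - y)) * (g y)\<^sup>2)"
      using s2[of x] by (simp add: power2_eq_square mult_ac)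
    finally show ?thesis by (simp add: nn_integral_mollifier[OF \<rho>])
  qed
  then have "(\<integral>\<^sup>+x. (\<integral>\<^sup>+y. ennreal (\<rho> (x - y)) * g y \<partial>lborel)\<^sup>2 \<partial>lborel)
      \<le> (\<integral>\<^sup>+x. \<integral>\<^sup>+y. ennreal (\<rho> (x - y)) * (g y)\<^sup>2 \<partial>lborel \<partial>lborel)"
    by (rule nn_integral_mono)
  also have "\<dots> = (\<integral>\<^sup>+y. \<integral>\<^sup>+x. ennreal (\<rho> (x - y)) * (g y)\<^sup>2 \<partial>lborel \<partial>lborel)"
    by (rule lborel_pair.Fubini') measurable
  also have "\<dots> = (\<integral>\<^sup>+y. (g y)\<^sup>2 \<partial>lborel)"
    by (simp add: nn_integral_multc nn_integral_mollifier[OF \<rho>])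
  finally show ?thesis .
qed

text \<open>Phrased for any h dominated by a mollification, so that it covers both the convolution
  itself and the commutator term in \<open>mollify_approx\<close>.\<close>

lemma l2sq_young:
  assumes \<rho>: "mollifier \<epsilon> \<rho>" and v: "v \<in> borel_measurable borel"
    and le: "\<And>x. ennreal (norm (h x)) \<le> (\<integral>\<^sup>+y. ennreal (\<rho> (x - y)) * ennreal (norm (v y)) \<partial>lborel)"
  shows "l2sq h \<le> l2sq v"
proof -
  note [measurable] = v
  have "l2sq h \<le> (\<integral>\<^sup>+x. (\<integral>\<^sup>+y. ennreal (\<rho> (x - y)) * ennreal (norm (v y)) \<partial>lborel)\<^sup>2 \<partial>lborel)"
    unfolding l2sq_def by (intro nn_integral_mono) (simp add: ennreal_power[symmetric] power_mono le)
  also have "\<dots> \<le> (\<integral>\<^sup>+y. (ennreal (norm (v y)))\<^sup>2 \<partial>lborel)"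
    by (rule young_inequality[OF \<rho>]) measurable
  also have "\<dots> = l2sq v" by (simp add: l2sq_def ennreal_power)
  finally show ?thesis .
qed

lemma norm_mollified_le:
  fixes k v :: "real^'n::finite \<Rightarrow> complex"
  assumes "mollifier \<epsilon> \<rho>" "\<And>y. norm (k y) \<le> \<rho> (x - y) * norm (v y)"
  shows "ennreal (norm (LINT y|lborel. k y)) \<le> (\<integral>\<^sup>+y. ennreal (\<rho> (x - y)) * ennreal (norm (v y)) \<partial>lborel)"
  by (intro order_trans[OF norm_integral_le_nn_integral] nn_integral_mono)
     (use assms in \<open>auto simp: mollifier_def ennreal_mult[symmetric] intro!: ennreal_leI\<close>)

lemma l2sq_conv_le:
  assumes \<rho>: "mollifier \<epsilon> \<rho>" and v: "v \<in> borel_measurable borel"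
  shows "l2sq (conv \<rho> v) \<le> l2sq v"
  unfolding conv_def[abs_def]
  by (rule l2sq_young[OF \<rho> v norm_mollified_le[OF \<rho>]]) (use \<rho> in \<open>simp add: mollifier_def\<close>)

text \<open>Truncating the values of v makes it bounded. A measurable function is almost everywhere
  a limit of continuous ones; after the same truncation and a cutoff these are dominated, so they
  converge in square mean. Each of the two errors is at most \<delta> / 4, and
  \<open>l2sq_add\<close> doubles both.\<close>

lemma l2_dense_continuous:
  fixes v :: "real^'n::finite \<Rightarrow> complex"
  assumes v [measurable]: "v \<in> borel_measurable borel" and fin: "l2sq v < \<infinity>"
    and supp: "\<And>x. norm x > R \<Longrightarrow> v x = 0" and \<delta>: "\<delta> > 0"
  obtains g where "continuous_on UNIV g" "\<And>x. norm x > R + 1 \<Longrightarrow> g x = 0" "l2sq (\<lambda>x. v x - g x) \<le> ennreal \<delta>"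
proof -
  \<comment> \<open>The radial retraction of the complex plane onto the disc of radius M:
    continuous, norm decreasing, and the identity on the disc.\<close>
  define T where "T = (\<lambda>(M::real) (z::complex). z /\<^sub>R max 1 (norm z / M))"
  have T_cont: "continuous_on UNIV (T M)" if "M > 0" for M
    unfolding T_def using that by (intro continuous_intros) (auto simp: max_def)
  have T_le: "norm (T M z) \<le> norm z" for M z
  proof -
    have "norm z / max 1 (norm z / M) \<le> norm z / 1" by (intro divide_left_mono) auto
    then show ?thesis by (simp add: T_def divide_inverse_commute)
  qed
  have T_le_M: "norm (T M z) \<le> M" if "M > 0" for M z
    unfolding T_def using that by (auto simp: max_def field_simps)
  have T_eq: "T M z = z" if "norm z \<le> M" "M > 0" for M z
    unfolding T_def using that by (auto simp: max_def field_simps)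
  have [measurable]: "T M \<in> borel_measurable borel" if "M > 0" for M
    by (rule borel_measurable_continuous_onI[OF T_cont[OF that]])
  note vi = integrable_l2sq[OF v fin]
  have "(\<lambda>m. LINT x|lborel. (norm (v x - T (real (Suc m)) (v x)))\<^sup>2) \<longlonglongrightarrow> (LINT x::real^'n|lborel. 0)"
  proof (rule integral_dominated_convergence[where w="\<lambda>x. 4 * (norm (v x))\<^sup>2"])
    show "AE x in lborel. (\<lambda>m. (norm (v x - T (real (Suc m)) (v x)))\<^sup>2) \<longlonglongrightarrow> 0"
    proof (rule AE_I2)
      fix x
      have "\<forall>\<^sub>F m in sequentially. norm (v x) \<le> real (Suc m)"
      proof -
        obtain n where "norm (v x) \<le> real n" using real_arch_simple by blast
        then have "norm (v x) \<le> real (Suc m)" if "m \<ge> n" for m using that by simp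
        then show ?thesis unfolding eventually_sequentially by blast
      qed
      then have "\<forall>\<^sub>F m in sequentially. (norm (v x - T (real (Suc m)) (v x)))\<^sup>2 = 0"
        by eventually_elim (simp add: T_eq)
      then show "(\<lambda>m. (norm (v x - T (real (Suc m)) (v x)))\<^sup>2) \<longlonglongrightarrow> 0"
        by (rule tendsto_eventually)
    qed
    show "AE x in lborel. norm ((norm (v x - T (real (Suc m)) (v x)))\<^sup>2) \<le> 4 * (norm (v x))\<^sup>2" for m
    proof (rule AE_I2)
      fix x
      have "norm (v x - T (real (Suc m)) (v x)) \<le> 2 * norm (v x)"
        using norm_triangle_ineq4[of "v x" "T (real (Suc m)) (v x)"] T_le[of "real (Suc m)" "v x"] by linarith
      then have "(norm (v x - T (real (Suc m)) (v x)))\<^sup>2 \<le> (2 * norm (v x))\<^sup>2" by (rule power_mono) simp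
      then show "norm ((norm (v x - T (real (Suc m)) (v x)))\<^sup>2) \<le> 4 * (norm (v x))\<^sup>2"
        by (simp add: power_mult_distrib)
    qed
  qed (use vi in \<open>auto intro!: borel_measurable_power borel_measurable_norm borel_measurable_diff measurable_compose[OF v]\<close>)
  then have "(\<lambda>m. LINT x|lborel. (norm (v x - T (real (Suc m)) (v x)))\<^sup>2) \<longlonglongrightarrow> 0" by simp
  then have "\<forall>\<^sub>F m in sequentially. (LINT x|lborel. (norm (v x - T (real (Suc m)) (v x)))\<^sup>2) < \<delta> / 4"
    using \<delta> by (intro order_tendstoD) auto
  then obtain m where m: "(LINT x|lborel. (norm (v x - T (real (Suc m)) (v x)))\<^sup>2) < \<delta> / 4"
    by (meson eventually_happens sequentially_bot)
  define M where "M = real (Suc m)"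
  have M: "M > 0" by (simp add: M_def)
  define t where "t = (\<lambda>x. T M (v x))"
  have t [measurable]: "t \<in> borel_measurable borel"
    unfolding t_def using M by measurable
  have l2t: "l2sq (\<lambda>x. v x - t x) \<le> ennreal (\<delta> / 4)"
  proof -
    have "l2sq (\<lambda>x. v x - t x) \<le> l2sq (\<lambda>x. 2 *\<^sub>R v x)"
    proof (rule l2sq_mono)
      show "norm (v x - t x) \<le> norm (2 *\<^sub>R v x)" for x
        using norm_triangle_ineq4[of "v x" "t x"] T_le[of M "v x"] by (simp add: t_def)
    qed
    also have "\<dots> < \<infinity>" using fin by (simp add: l2sq_scaleR ennreal_mult_less_top)
    finally have "l2sq (\<lambda>x. v x - t x) < \<infinity>" .
    then show ?thesis
      by (rule l2sq_leI[rotated]) (use m[folded M_def] in \<open>auto simp: t_def intro: borel_measurable_diff v t[unfolded t_def]\<close>)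
  qed
  have "v measurable_on UNIV"
    by (rule lebesgue_measurable_imp_measurable_on) (auto intro: measurable_completion)
  then obtain N G where N: "negligible N" and G: "\<And>n. continuous_on UNIV (G n)"
    "\<And>x. x \<notin> N \<Longrightarrow> (\<lambda>n. G n x) \<longlonglongrightarrow> v x"
    by (auto simp: measurable_on_def)
  define cut where "cut = (\<lambda>x::real^'n. max 0 (min 1 (R + 1 - norm x)))"
  have cut: "continuous_on UNIV cut" "\<And>x. 0 \<le> cut x" "\<And>x. cut x \<le> 1" "\<And>x. norm x > R + 1 \<Longrightarrow> cut x = 0" "\<And>x. norm x \<le> R \<Longrightarrow> cut x = 1"
    unfolding cut_def by (auto intro!: continuous_intros)
  \<comment> \<open>Truncation and cutoff together bound all \<open>h n\<close> by M on one ball;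
    this provides the dominating function for the limit in n.\<close>
  define h where "h = (\<lambda>n x. cut x *\<^sub>R T M (G n x))"
  have h_cont: "continuous_on UNIV (h n)" for n
    unfolding h_def by (intro continuous_intros cut continuous_on_compose2[OF T_cont[OF M] G(1)]) auto
  have h_meas [measurable]: "h n \<in> borel_measurable borel" for n
    by (intro borel_measurable_continuous_onI h_cont)
  have t0: "t x = cut x *\<^sub>R T M (v x)" for x
    using supp[of x] cut(5)[of x] by (cases "norm x > R") (auto simp: t_def T_def)
  have h_norm: "norm (h n x) \<le> M" and t_norm: "norm (t x) \<le> M" for n x
    unfolding h_def t_def using T_le_M[OF M] cut(2,3)[of x] 
    by (auto intro: order_trans[OF mult_left_le_one_le])
  have "(\<lambda>n. LINT x|lborel. (norm (t x - h n x))\<^sup>2) \<longlonglongrightarrow> (LINT x::real^'n|lborel. 0)"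
  proof (rule integral_dominated_convergence[where w="\<lambda>x. indicator (cball 0 (R + 1)) x *\<^sub>R (2 * M)\<^sup>2"])
    show "integrable lborel (\<lambda>x::real^'n. indicator (cball 0 (R + 1)) x *\<^sub>R (2 * M)\<^sup>2)"
      by (intro borel_integrable_compact) auto
    have "N \<in> null_sets lebesgue" using N by (simp add: negligible_iff_null_sets)
    then have "AE x in lborel. x \<notin> N"
      using AE_completion_iff[of "\<lambda>x. x \<notin> N" lborel] AE_not_in by blast
    then show "AE x in lborel. (\<lambda>n. (norm (t x - h n x))\<^sup>2) \<longlonglongrightarrow> 0"
    proof eventually_elim
      case (elim x)
      have "(\<lambda>n. T M (G n x)) \<longlonglongrightarrow> T M (v x)"
        by (rule continuous_on_tendsto_compose[OF T_cont[OF M] G(2)[OF elim]]) auto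
      then have "(\<lambda>n. (norm (t x - h n x))\<^sup>2) \<longlonglongrightarrow> (norm (t x - cut x *\<^sub>R T M (v x)))\<^sup>2"
        unfolding h_def by (intro tendsto_intros)
      then show ?case by (simp add: t0)
    qed
    show "AE x in lborel. norm ((norm (t x - h n x))\<^sup>2) \<le> indicator (cball 0 (R + 1)) x *\<^sub>R (2 * M)\<^sup>2" for n
    proof (rule AE_I2)
      fix x
      have "norm (t x - h n x) \<le> 2 * M"
        using norm_triangle_ineq4[of "t x" "h n x"] h_norm[of n x] t_norm[of x] by linarith
      then have "(norm (t x - h n x))\<^sup>2 \<le> (2 * M)\<^sup>2" by (rule power_mono) simp
      moreover have "t x - h n x = 0" if "norm x > R + 1"
        unfolding t0 h_def using cut(4)[OF that] by simp
      ultimately show "norm ((norm (t x - h n x))\<^sup>2) \<le> indicator (cball 0 (R + 1)) x *\<^sub>R (2 * M)\<^sup>2"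
        by (auto simp: indicator_def)
    qed
  qed measurable
  then have "\<forall>\<^sub>F n in sequentially. (LINT x|lborel. (norm (t x - h n x))\<^sup>2) < \<delta> / 4"
    using \<delta> by (intro order_tendstoD) auto
  then obtain n where n: "(LINT x|lborel. (norm (t x - h n x))\<^sup>2) < \<delta> / 4"
    by (meson eventually_happens sequentially_bot)
  have h0: "h n x = 0" if "norm x > R + 1" for x using cut(4)[OF that] by (simp add: h_def)
  have "l2sq (\<lambda>x. t x - h n x) \<le> ennreal (\<delta> / 4)"
  proof -
    have "l2sq (\<lambda>x. t x - h n x) \<le> ennreal ((2 * M)\<^sup>2 * measure lborel (cball (0 :: real^'n) (R + 1)))"
    proof (rule l2sq_bounded)
      show "norm (t x - h n x) \<le> 2 * M" for x
        using norm_triangle_ineq4[of "t x" "h n x"] h_norm[of n x] t_norm[of x] by linarith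
      show "t x - h n x = 0" if "norm x > R + 1" for x
        unfolding t0 h_def using cut(4)[OF that] by simp
    qed
    also have "\<dots> < \<infinity>" by simp
    finally have "l2sq (\<lambda>x. t x - h n x) < \<infinity>" .
    then show ?thesis
      by (rule l2sq_leI[rotated]) (use n in \<open>auto intro: borel_measurable_diff h_meas t\<close>)
  qed
  then have "l2sq (\<lambda>x. (v x - t x) + (t x - h n x)) \<le> 2 * ennreal (\<delta> / 4) + 2 * ennreal (\<delta> / 4)"
    using l2t by (intro order_trans[OF l2sq_add]) (auto intro!: add_mono mult_left_mono)
  also have "\<dots> = ennreal (2 * (\<delta> / 4) + 2 * (\<delta> / 4))"
    by (rule two_ennreal_add) (use \<delta> in auto)
  finally have "l2sq (\<lambda>x. v x - h n x) \<le> ennreal \<delta>" by simp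
  then show thesis by (intro that[OF h_cont h0])
qed

lemma mollifier_C_k: "mollifier \<epsilon> \<rho> \<Longrightarrow> C_k k \<rho>"
  by (simp add: mollifier_def smooth_def)

lemma mollifier_support: "mollifier \<epsilon> \<rho> \<Longrightarrow> norm x > \<epsilon> \<Longrightarrow> \<rho> x = 0"
  by (simp add: mollifier_def)

lemma integrable_mollifier_mult:
  assumes "mollifier \<epsilon> \<rho>" "integrable lborel v"
  shows "integrable lborel (\<lambda>y. \<rho> (x - y) *\<^sub>R (v y :: complex))"
  by (rule integrable_conv[OF C_k_1_continuous[OF mollifier_C_k[OF assms(1)]] mollifier_support[OF assms(1)] assms(2)])

lemma conv_diff:
  assumes "mollifier \<epsilon> \<rho>" "integrable lborel u" "integrable lborel v"
  shows "conv \<rho> (\<lambda>x. u x - v x) x = conv \<rho> u x - conv \<rho> v x"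
  unfolding conv_def
  by (simp add: scaleR_right_diff_distrib integrable_mollifier_mult[OF assms(1)] assms)

lemma C_k_1_mollified:
  assumes "mollifier \<epsilon> \<rho>" "integrable lborel v"
  shows "C_k 1 (conv \<rho> v)"
  by (rule C_k_1_conv[OF mollifier_C_k[OF assms(1)] mollifier_support[OF assms(1)] assms(2)])

text \<open>Insert a continuous g close to v. Convolution does not increase \<open>l2sq\<close>, so
  the error of v - g stays small after mollifying; the error for g itself is uniformly small by
  uniform continuity and lives in the ball of radius \<open>R + 2\<close>, one unit for the cutoff
  and one for the kernel.\<close>

lemma mollifier_approx:
  fixes v :: "real^'n::finite \<Rightarrow> complex"
  assumes v [measurable]: "v \<in> borel_measurable borel" and fin: "l2sq v < \<infinity>"
    and supp: "\<And>x. norm x > R \<Longrightarrow> v x = 0" and \<delta>: "\<delta> > 0"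
  obtains \<epsilon>0 where "\<epsilon>0 > 0"
    "\<And>\<epsilon> \<rho>. \<epsilon> \<le> \<epsilon>0 \<Longrightarrow> mollifier \<epsilon> \<rho> \<Longrightarrow> l2sq (\<lambda>x. conv \<rho> v x - v x) \<le> ennreal \<delta>"
proof -
  \<comment> \<open>Adding three errors by two uses of \<open>l2sq_add\<close> gives 2 + 2 * (2 + 2)
    = 10 parts.\<close>
  define \<delta>' where "\<delta>' = \<delta> / 10"
  have \<delta>': "\<delta>' > 0" using \<delta> by (simp add: \<delta>'_def)
  obtain g where g: "continuous_on UNIV g" "\<And>x. norm x > R + 1 \<Longrightarrow> g x = 0" "l2sq (\<lambda>x. v x - g x) \<le> ennreal \<delta>'"
    using l2_dense_continuous[OF v fin supp \<delta>'] by blast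
  have [measurable]: "g \<in> borel_measurable borel" by (intro borel_measurable_continuous_onI g)
  have vi: "integrable lborel v" by (rule integrable_l2_bounded_support[OF v fin supp])
  have gi: "integrable lborel g"
    by (rule integrable_continuous_bounded_support[OF g(1), of "cball 0 (R + 1)"]) (use g(2) in auto)
  define \<mu> where "\<mu> = measure lborel (cball (0::real^'n) (R + 2))"
  \<comment> \<open>A uniform error \<eta> on a ball of volume \<mu> then costs at most \<delta>';
    the added 1 avoids division by zero.\<close>
  define \<eta> where "\<eta> = sqrt (\<delta>' / (\<mu> + 1))"
  have \<mu>: "\<mu> \<ge> 0" by (simp add: \<mu>_def)
  have \<eta>: "\<eta> > 0" using \<delta>' \<mu> by (simp add: \<eta>_def)
  have \<eta>\<mu>: "\<eta>\<^sup>2 * \<mu> \<le> \<delta>'" using \<delta>' \<mu> by (simp add: \<eta>_def field_simps)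
  obtain d where d: "d > 0" "\<And>x y. norm (y - x) < d \<Longrightarrow> norm (g y - g x) < \<eta>"
    by (rule uniformly_continuous_bounded_support[OF g(1,2) \<eta>]) auto
  have "l2sq (\<lambda>x. conv \<rho> v x - v x) \<le> ennreal \<delta>" if \<epsilon>: "\<epsilon> \<le> min 1 (d / 2)" and \<rho>: "mollifier \<epsilon> \<rho>" for \<epsilon> and \<rho> :: "real^'n \<Rightarrow> real"
  proof -
    have \<rho>0: "\<rho> z \<ge> 0" for z using \<rho> by (simp add: mollifier_def)
    have [measurable]: "conv \<rho> v \<in> borel_measurable borel" "conv \<rho> g \<in> borel_measurable borel"
      by (intro C_k_1_borel_measurable C_k_1_mollified[OF \<rho>] vi gi)+
    have "l2sq (\<lambda>x. conv \<rho> g x - g x) \<le> ennreal (\<eta>\<^sup>2 * \<mu>)"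
      unfolding \<mu>_def
    proof (rule l2sq_bounded)
      fix x :: "real^'n"
      have "conv \<rho> g x - g x = (LINT y|lborel. \<rho> (x - y) *\<^sub>R (g y - g x))"
        using integral_mollifier[OF \<rho>, of x] integrable_mollifier_mult[OF \<rho> gi, of x]
        by (simp add: conv_def scaleR_right_diff_distrib)
      also have "norm \<dots> \<le> (LINT y|lborel. \<rho> (x - y) * \<eta>)"
      proof (rule Bochner_Integration.integral_norm_bound_integral)
        show "integrable lborel (\<lambda>y. \<rho> (x - y) *\<^sub>R (g y - g x))"
          using integral_mollifier[OF \<rho>, of x] integrable_mollifier_mult[OF \<rho> gi, of x]
          by (simp add: scaleR_right_diff_distrib)
        show "norm (\<rho> (x - y) *\<^sub>R (g y - g x)) \<le> \<rho> (x - y) * \<eta>" for y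
        proof (cases "norm (x - y) > \<epsilon>")
          case False
          then have "norm (g y - g x) \<le> \<eta>"
            using d(2)[of y x] \<epsilon> d(1) by (simp add: norm_minus_commute)
          then show ?thesis using \<rho>0 by (simp add: mult_left_mono)
        qed (simp add: mollifier_support[OF \<rho>])
      qed (use integral_mollifier[OF \<rho>, of x] in simp)
      also have "\<dots> = \<eta>" using integral_mollifier[OF \<rho>, of x] by simp
      finally show "norm (conv \<rho> g x - g x) \<le> \<eta>" .
      show "conv \<rho> g x - g x = 0" if "norm x > R + 2"
      proof -
        have "conv \<rho> g x = 0"
          by (rule conv_eq_0[where a=\<epsilon> and R="R + 1", OF mollifier_support[OF \<rho>] g(2)]) (use that \<epsilon> in auto)
        then show ?thesis using g(2)[of x] that by simp
      qed
    qed
    also have "\<dots> \<le> ennreal \<delta>'" by (rule ennreal_leI[OF \<eta>\<mu>])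
    finally have mid: "l2sq (\<lambda>x. conv \<rho> g x - g x) \<le> ennreal \<delta>'" .
    have "l2sq (conv \<rho> (\<lambda>x. v x - g x)) \<le> l2sq (\<lambda>x. v x - g x)"
      by (rule l2sq_conv_le[OF \<rho>]) measurable
    then have left: "l2sq (\<lambda>x. conv \<rho> v x - conv \<rho> g x) \<le> ennreal \<delta>'"
      using g(3) by (simp add: conv_diff[OF \<rho> vi gi, abs_def] cong: if_cong)
    have right: "l2sq (\<lambda>x. g x - v x) \<le> ennreal \<delta>'"
      using g(3) by (simp add: l2sq_def norm_minus_commute)
    have "l2sq (\<lambda>x. (conv \<rho> v x - conv \<rho> g x) + ((conv \<rho> g x - g x) + (g x - v x)))
      \<le> 2 * ennreal \<delta>' + 2 * (2 * ennreal \<delta>' + 2 * ennreal \<delta>')"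
      by (intro order_trans[OF l2sq_add] add_mono mult_left_mono left mid right) measurable
    also have "\<dots> = ennreal (2 * \<delta>' + 2 * (2 * \<delta>' + 2 * \<delta>'))"
      using \<delta>' by (simp add: two_ennreal_add)
    finally show ?thesis by (simp add: \<delta>'_def)
  qed
  then show thesis using d(1) by (intro that[of "min 1 (d / 2)"]) auto
qed

section \<open>Approximation by compactly supported functions\<close>

text \<open>The distributional form of \<open>D\<^sub>j\<close> u = G, with the term of order zero
  moved to the right so that only the plain derivative is transferred to the test function.\<close>

definition weak_twisted :: "(real^'n::finite \<Rightarrow> real) \<Rightarrow> 'n \<Rightarrow> (real^'n \<Rightarrow> complex) \<Rightarrow> (real^'n \<Rightarrow> complex) \<Rightarrow> bool" where
  "weak_twisted \<phi> j u G \<longleftrightarrow> (\<forall>\<psi>\<in>test_functions.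
     (LINT x|lborel. u x * partial j \<psi> x) = - (LINT x|lborel. (G x - (partial j \<phi> x / 2) *\<^sub>R u x) * \<psi> x))"

lemma test_functionsI:
  assumes "smooth \<psi>" "\<And>x. norm x > R \<Longrightarrow> \<psi> x = 0"
  shows "\<psi> \<in> test_functions"
proof -
  have "{x. \<psi> x \<noteq> 0} \<subseteq> cball 0 R" using assms(2) by (auto simp: not_less[symmetric])
  then have "bounded {x. \<psi> x \<noteq> 0}" using bounded_cball bounded_subset by blast
  then show ?thesis using assms(1) by (simp add: test_functions_def compact_closure)
qed

lemma test_functionsE:
  assumes "\<psi> \<in> test_functions"
  obtains R where "smooth \<psi>" "\<And>x. norm x > R \<Longrightarrow> \<psi> x = 0"
proof -
  have "bounded {x. \<psi> x \<noteq> 0}" using assms by (simp add: test_functions_def compact_closure)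
  then obtain R where "\<And>x. \<psi> x \<noteq> 0 \<Longrightarrow> norm x \<le> R" by (auto simp: bounded_iff)
  then have "\<And>x. norm x > R \<Longrightarrow> \<psi> x = 0" using not_less by blast
  moreover have "smooth \<psi>" using assms by (simp add: test_functions_def)
  ultimately show ?thesis by (intro that)
qed

lemma smooth_of_real: "smooth a \<Longrightarrow> smooth (\<lambda>x. complex_of_real (a x))"
  by (rule smooth_bounded_linear[OF bounded_linear_of_real])

lemma partial_of_real:
  "a differentiable (at x) \<Longrightarrow> partial j (\<lambda>x. complex_of_real (a x)) x = of_real (partial j a x)"
  by (rule partial_bounded_linear[OF bounded_linear_of_real])

lemma test_functions_mult:
  assumes "smooth a" "\<psi> \<in> test_functions"
  shows "(\<lambda>x. complex_of_real (a x) * \<psi> x) \<in> test_functions"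
proof -
  obtain R where "smooth \<psi>" "\<And>x. norm x > R \<Longrightarrow> \<psi> x = 0" using test_functionsE[OF assms(2)] by blast
  then show ?thesis by (intro test_functionsI[of _ R] smooth_mult smooth_of_real assms(1)) auto
qed

lemma partial_of_real_mult:
  assumes "smooth a" "smooth \<psi>"
  shows "partial j (\<lambda>x. complex_of_real (a x) * \<psi> x) x = a x *\<^sub>R partial j \<psi> x + partial j a x *\<^sub>R \<psi> x"
  using smooth_differentiable[OF assms(1), of x] smooth_differentiable[OF smooth_of_real[OF assms(1)], of x]
    smooth_differentiable[OF assms(2), of x]
  by (simp add: partial_mult partial_of_real scaleR_conv_of_real)

lemma integrable_l2_mult:
  fixes u \<theta> :: "real^'n::finite \<Rightarrow> complex"
  assumes u [measurable]: "u \<in> borel_measurable borel" and fin: "l2sq u < \<infinity>"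
    and \<theta>: "continuous_on UNIV \<theta>" "\<And>x. norm x > R \<Longrightarrow> \<theta> x = 0"
  shows "integrable lborel (\<lambda>x. u x * \<theta> x)"
proof (rule Bochner_Integration.integrable_bound)
  have [measurable]: "\<theta> \<in> borel_measurable borel" by (intro borel_measurable_continuous_onI \<theta>)
  have "integrable lborel (\<lambda>x. (norm (\<theta> x))\<^sup>2)"
    by (rule integrable_continuous_bounded_support[of _ "cball 0 R"]) (use \<theta> in \<open>auto intro!: continuous_intros\<close>)
  then show "integrable lborel (\<lambda>x. (norm (u x))\<^sup>2 + (norm (\<theta> x))\<^sup>2)"
    by (rule Bochner_Integration.integrable_add[OF integrable_l2sq(1)[OF u fin]])
  have "norm (u x * \<theta> x) \<le> (norm (u x))\<^sup>2 + (norm (\<theta> x))\<^sup>2" for x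
    using sum_squares_bound[of "norm (u x)" "norm (\<theta> x)"] mult_nonneg_nonneg[OF norm_ge_zero[of "u x"] norm_ge_zero[of "\<theta> x"]]
    unfolding norm_mult mult.assoc by linarith
  then show "AE x in lborel. norm (u x * \<theta> x) \<le> norm ((norm (u x))\<^sup>2 + (norm (\<theta> x))\<^sup>2)"
    by (intro AE_I2) (simp add: order_trans[OF _ abs_ge_self])
  show "(\<lambda>x. u x * \<theta> x) \<in> borel_measurable lborel" by measurable
qed

text \<open>In each coordinate the exponent is at most zero, because 1/(1+t) + 1/(1-t) =
  2/((1+t)(1-t)) is at least 2 on the open interval from -1 to 1.\<close>

lemma bump_le_1: "bump x \<le> 1"
proof -
  have "exp 2 * (flat_exp 1 (1 + t) * flat_exp 1 (1 - t)) \<le> 1" for t :: real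
  proof (cases "\<bar>t\<bar> < 1")
    case True
    have p: "1 + t > 0" "1 - t > 0" using True by auto
    have "(1 + t) * (1 - t) \<le> 1" by (simp add: algebra_simps)
    then have "2 \<le> 2 / ((1 + t) * (1 - t))" using p by (subst pos_le_divide_eq) auto
    also have "\<dots> = 1 / (1 + t) + 1 / (1 - t)" using p by (simp add: field_simps)
    finally have "exp (2 + (- 1 / (1 + t)) + (- 1 / (1 - t))) \<le> 1" by simp
    moreover have "exp 2 * (flat_exp 1 (1 + t) * flat_exp 1 (1 - t)) = exp (2 + (- 1 / (1 + t)) + (- 1 / (1 - t)))"
      using p by (simp add: flat_exp_def exp_add[symmetric] mult.assoc[symmetric] del: exp_add)
    ultimately show ?thesis by simp
  qed (auto simp: flat_exp_def)
  then show ?thesis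
    unfolding bump_def by (intro prod_le_1) (auto simp: flat_exp_def)
qed

text \<open>Test the equation for u with a times \<psi>. The derivative that falls on a is moved to
  the right-hand side and becomes the extra term of the product rule.\<close>

lemma weak_twisted_cutoff:
  fixes \<phi> a :: "real^'n::finite \<Rightarrow> real"
  assumes \<phi>: "smooth \<phi>" and a: "smooth a"
    and u: "u \<in> borel_measurable borel" "l2sq u < \<infinity>" and G: "G \<in> borel_measurable borel" "l2sq G < \<infinity>"
    and w: "weak_twisted \<phi> j u G"
  shows "weak_twisted \<phi> j (\<lambda>x. a x *\<^sub>R u x) (\<lambda>x. a x *\<^sub>R G x + partial j a x *\<^sub>R u x)"
  unfolding weak_twisted_def
proof
  fix \<psi> :: "real^'n \<Rightarrow> complex" assume \<psi>: "\<psi> \<in> test_functions"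
  obtain R where sm: "smooth \<psi>" and R: "\<And>x. norm x > R \<Longrightarrow> \<psi> x = 0" using test_functionsE[OF \<psi>] by blast
  have pR: "partial i \<psi> x = 0" if "norm x > R" for i x by (rule partial_eq_0_cball[OF R that])
  have c: "continuous_on UNIV a" "continuous_on UNIV \<psi>" "continuous_on UNIV (partial j a)"
    "continuous_on UNIV (partial j \<psi>)" "continuous_on UNIV (partial j \<phi>)"
    by (intro smooth_continuous_on smooth_partial a sm \<phi>)+
  have iu: "integrable lborel (\<lambda>x. u x * \<theta> x)" if "continuous_on UNIV \<theta>" "\<And>x. norm x > R \<Longrightarrow> \<theta> x = 0" for \<theta>
    by (rule integrable_l2_mult[OF u that])
  have iG: "integrable lborel (\<lambda>x. G x * \<theta> x)" if "continuous_on UNIV \<theta>" "\<And>x. norm x > R \<Longrightarrow> \<theta> x = 0" for \<theta>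
    by (rule integrable_l2_mult[OF G that])
  have i1: "integrable lborel (\<lambda>x. u x * (a x *\<^sub>R partial j \<psi> x))"
    by (rule iu) (auto intro!: continuous_intros c simp: pR)
  have i2: "integrable lborel (\<lambda>x. u x * (partial j a x *\<^sub>R \<psi> x))"
    by (rule iu) (auto intro!: continuous_intros c simp: R)
  have i3: "integrable lborel (\<lambda>x. G x * (a x *\<^sub>R \<psi> x))"
    by (rule iG) (auto intro!: continuous_intros c simp: R)
  have i4: "integrable lborel (\<lambda>x. u x * ((partial j \<phi> x / 2) *\<^sub>R a x *\<^sub>R \<psi> x))"
    by (rule iu) (auto intro!: continuous_intros c simp: R)
  have "(LINT x|lborel. u x * partial j (\<lambda>x. complex_of_real (a x) * \<psi> x) x)
     = - (LINT x|lborel. (G x - (partial j \<phi> x / 2) *\<^sub>R u x) * (complex_of_real (a x) * \<psi> x))"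
    using w test_functions_mult[OF a \<psi>] unfolding weak_twisted_def by blast
  moreover have "(\<lambda>x. u x * partial j (\<lambda>x. complex_of_real (a x) * \<psi> x) x)
     = (\<lambda>x. u x * (a x *\<^sub>R partial j \<psi> x) + u x * (partial j a x *\<^sub>R \<psi> x))"
    by (simp add: partial_of_real_mult[OF a sm] distrib_left)
  moreover have "(\<lambda>x. (G x - (partial j \<phi> x / 2) *\<^sub>R u x) * (complex_of_real (a x) * \<psi> x))
     = (\<lambda>x. G x * (a x *\<^sub>R \<psi> x) - u x * ((partial j \<phi> x / 2) *\<^sub>R a x *\<^sub>R \<psi> x))"
    by (simp add: fun_eq_iff scaleR_conv_of_real algebra_simps)
  ultimately have "(LINT x|lborel. u x * (a x *\<^sub>R partial j \<psi> x)) + (LINT x|lborel. u x * (partial j a x *\<^sub>R \<psi> x))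
    = - ((LINT x|lborel. G x * (a x *\<^sub>R \<psi> x)) - (LINT x|lborel. u x * ((partial j \<phi> x / 2) *\<^sub>R a x *\<^sub>R \<psi> x)))"
    by (simp only: Bochner_Integration.integral_add[OF i1 i2] Bochner_Integration.integral_diff[OF i3 i4])
  moreover have "(\<lambda>x. (a x *\<^sub>R G x + partial j a x *\<^sub>R u x - (partial j \<phi> x / 2) *\<^sub>R a x *\<^sub>R u x) * \<psi> x)
     = (\<lambda>x. G x * (a x *\<^sub>R \<psi> x) + u x * (partial j a x *\<^sub>R \<psi> x) - u x * ((partial j \<phi> x / 2) *\<^sub>R a x *\<^sub>R \<psi> x))"
    by (simp add: fun_eq_iff scaleR_conv_of_real algebra_simps)
  moreover have "(\<lambda>x. a x *\<^sub>R u x * partial j \<psi> x) = (\<lambda>x. u x * (a x *\<^sub>R partial j \<psi> x))" by simp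
  ultimately show "(LINT x|lborel. a x *\<^sub>R u x * partial j \<psi> x)
    = - (LINT x|lborel. (a x *\<^sub>R G x + partial j a x *\<^sub>R u x - (partial j \<phi> x / 2) *\<^sub>R a x *\<^sub>R u x) * \<psi> x)"
    by (simp only: Bochner_Integration.integral_add[OF i3 i2]
      Bochner_Integration.integral_diff[OF Bochner_Integration.integrable_add[OF i3 i2] i4])
       (simp add: algebra_simps)
qed

text \<open>Widening cutoffs tend to 1 pointwise, so the truncated functions tend to u by dominated
  convergence, while the product rule term carries a factor of order 1 / (m + 1) and eventually
  contributes at most 1 to the energy.\<close>

lemma cutoff_approx:
  fixes \<phi> :: "real^'n::finite \<Rightarrow> real" and G :: "'n \<Rightarrow> real^'n \<Rightarrow> complex"
  assumes \<phi>: "smooth \<phi>"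
    and u: "u \<in> borel_measurable borel" "l2sq u < \<infinity>"
    and G: "\<And>j. G j \<in> borel_measurable borel" "\<And>j. l2sq (G j) < \<infinity>"
    and w: "\<And>j. weak_twisted \<phi> j u (G j)" and \<delta>: "\<delta> > 0"
  obtains v H R where "v \<in> borel_measurable borel" "\<And>j. H j \<in> borel_measurable borel"
    "\<And>x. norm x > R \<Longrightarrow> v x = 0" "\<And>j x. norm x > R \<Longrightarrow> H j x = 0"
    "\<And>j. weak_twisted \<phi> j v (H j)" "l2sq (\<lambda>x. v x - u x) \<le> ennreal \<delta>"
    "(\<Sum>j\<in>UNIV. l2sq (H j)) \<le> 2 * (\<Sum>j\<in>UNIV. l2sq (G j)) + 1"
proof -
  note [measurable] = u(1) G(1)
  \<comment> \<open>The summand 0 only matches the shape required by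
    \<open>smooth_affine\<close>.\<close>
  define a where "a = (\<lambda>m (x::real^'n). bump (0 + (1 / real (Suc m)) *\<^sub>R x))"
  have a: "smooth (a m)" for m unfolding a_def by (rule smooth_affine[OF smooth_bump])
  have a01: "0 \<le> a m x" "a m x \<le> 1" for m x by (auto simp: a_def bump_nonneg bump_le_1)
  have am [measurable]: "a m \<in> borel_measurable borel" "partial j (a m) \<in> borel_measurable borel" for m j
    by (intro borel_measurable_continuous_onI smooth_continuous_on smooth_partial a)+
  have a0: "a m x = 0" if "norm x > real CARD('n) * real (Suc m)" for m x
    unfolding a_def by (rule bump_eq_0) (use that in \<open>simp add: field_simps\<close>)
  have pa0: "partial j (a m) x = 0" if "norm x > real CARD('n) * real (Suc m)" for m j x
    by (rule partial_eq_0_cball[OF a0 that])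
  have "\<exists>B. \<forall>x. \<bar>partial j bump x\<bar> \<le> B" for j :: 'n
  proof -
    have "bump x = 0" if "norm x > real CARD('n)" for x :: "real^'n" using that by (intro bump_eq_0) simp
    then have *: "partial j bump x = 0" if "norm x > real CARD('n)" for x :: "real^'n"
      using that by (rule partial_eq_0_cball)
    show ?thesis
      by (rule bounded_range_bounded_support[OF smooth_continuous_on[OF smooth_partial[OF smooth_bump]] *]) auto
  qed
  then obtain B0 where B0: "\<And>j x. \<bar>partial j bump (x::real^'n)\<bar> \<le> B0 j" by metis
  define B where "B = Max (range B0)"
  have B: "\<bar>partial j bump (x::real^'n)\<bar> \<le> B" for j x
    using B0[of j x] by (auto simp: B_def intro: order_trans Max_ge)
  have pa: "\<bar>partial j (a m) x\<bar> \<le> B / real (Suc m)" for m j x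
  proof -
    have "partial j (a m) x = (1 / real (Suc m)) *\<^sub>R partial j bump (0 + (1 / real (Suc m)) *\<^sub>R x)"
      unfolding a_def by (rule partial_affine(2)[OF smooth_differentiable[OF smooth_bump]])
    then have "\<bar>partial j (a m) x\<bar> = \<bar>partial j bump (0 + (1 / real (Suc m)) *\<^sub>R x)\<bar> / real (Suc m)"
      by (simp only: real_scaleR_def abs_mult) simp
    then show ?thesis using B by (simp only: divide_right_mono of_nat_0_le_iff)
  qed
  have au: "norm (a m x *\<^sub>R u x - u x) \<le> norm (u x)" for m x
  proof -
    have "norm ((a m x - 1) *\<^sub>R u x) \<le> 1 * norm (u x)"
      unfolding norm_scaleR using a01[of m x] by (intro mult_right_mono) auto
    then show ?thesis by (simp add: scaleR_left_diff_distrib)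
  qed
  define H where "H = (\<lambda>m j x. a m x *\<^sub>R G j x + partial j (a m) x *\<^sub>R u x)"
  note ui = integrable_l2sq[OF u]
  let ?U = "LINT x|lborel. (norm (u x))\<^sup>2"
  have lim0: "(\<lambda>m. 1 / real (Suc m)) \<longlonglongrightarrow> 0" by (rule LIMSEQ_Suc[OF lim_1_over_n])
  have "(\<lambda>m. LINT x|lborel. (norm (a m x *\<^sub>R u x - u x))\<^sup>2) \<longlonglongrightarrow> (LINT x::real^'n|lborel. 0)"
  proof (rule integral_dominated_convergence[where w="\<lambda>x. (norm (u x))\<^sup>2"])
    show "AE x in lborel. (\<lambda>m. (norm (a m x *\<^sub>R u x - u x))\<^sup>2) \<longlonglongrightarrow> 0"
    proof (rule AE_I2)
      fix x :: "real^'n"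
      have "(\<lambda>m. 0 + (1 / real (Suc m)) *\<^sub>R x) \<longlonglongrightarrow> 0 + 0 *\<^sub>R x"
        by (rule tendsto_add[OF tendsto_const tendsto_scaleR[OF lim0 tendsto_const]])
      then have "(\<lambda>m. a m x) \<longlonglongrightarrow> bump (0 + 0 *\<^sub>R x)"
        unfolding a_def by (rule continuous_on_tendsto_compose[OF smooth_continuous_on[OF smooth_bump, of UNIV]]) auto
      then have "(\<lambda>m. (norm (a m x *\<^sub>R u x - u x))\<^sup>2) \<longlonglongrightarrow> (norm (bump (0 + 0 *\<^sub>R x) *\<^sub>R u x - u x))\<^sup>2"
        by (intro tendsto_intros)
      then show "(\<lambda>m. (norm (a m x *\<^sub>R u x - u x))\<^sup>2) \<longlonglongrightarrow> 0" by (simp add: bump_0)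
    qed
    show "AE x in lborel. norm ((norm (a m x *\<^sub>R u x - u x))\<^sup>2) \<le> (norm (u x))\<^sup>2" for m
    proof (rule AE_I2)
      fix x :: "real^'n"
      show "norm ((norm (a m x *\<^sub>R u x - u x))\<^sup>2) \<le> (norm (u x))\<^sup>2"
        using au[of m x] by (simp add: power_mono)
    qed
  qed (use ui in auto)
  then have ev1: "\<forall>\<^sub>F m in sequentially. (LINT x|lborel. (norm (a m x *\<^sub>R u x - u x))\<^sup>2) < \<delta>"
    using \<delta> by (intro order_tendstoD) auto
  \<comment> \<open>The total contribution of the gradients of the cutoff to the n energy terms,
    with the factor 2 from \<open>l2sq_add\<close>.\<close>
  have "(\<lambda>m. real CARD('n) * (2 * ((B * (1 / real (Suc m)))\<^sup>2 * ?U))) \<longlonglongrightarrow> real CARD('n) * (2 * ((B * 0)\<^sup>2 * ?U))"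
    by (rule tendsto_mult[OF tendsto_const tendsto_mult[OF tendsto_const
      tendsto_mult[OF tendsto_power[OF tendsto_mult[OF tendsto_const lim0]] tendsto_const]]])
  then have ev2: "\<forall>\<^sub>F m in sequentially. real CARD('n) * (2 * ((B * (1 / real (Suc m)))\<^sup>2 * ?U)) < 1"
    by (rule order_tendstoD(2)) simp
  obtain m where m: "(LINT x|lborel. (norm (a m x *\<^sub>R u x - u x))\<^sup>2) < \<delta>"
    "real CARD('n) * (2 * ((B * (1 / real (Suc m)))\<^sup>2 * ?U)) < 1"
    using eventually_happens[OF eventually_conj[OF ev1 ev2]] by auto
  show thesis
  proof (rule that[of "\<lambda>x. a m x *\<^sub>R u x" "H m" "real CARD('n) * real (Suc m)"])
    show "weak_twisted \<phi> j (\<lambda>x. a m x *\<^sub>R u x) (H m j)" for j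
      unfolding H_def by (rule weak_twisted_cutoff[OF \<phi> a u G w])
    have "l2sq (\<lambda>x. a m x *\<^sub>R u x - u x) \<le> l2sq u" by (rule l2sq_mono[OF au])
    then have "l2sq (\<lambda>x. a m x *\<^sub>R u x - u x) < \<infinity>" using u(2) by (rule le_less_trans)
    then show "l2sq (\<lambda>x. a m x *\<^sub>R u x - u x) \<le> ennreal \<delta>"
      by (rule l2sq_leI[rotated]) (use m(1) in auto)
    have Hj: "l2sq (H m j) \<le> 2 * l2sq (G j) + ennreal (2 * ((B * (1 / real (Suc m)))\<^sup>2 * ?U))" for j
    proof -
      have "l2sq (H m j) \<le> 2 * l2sq (\<lambda>x. a m x *\<^sub>R G j x) + 2 * l2sq (\<lambda>x. partial j (a m) x *\<^sub>R u x)"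
        unfolding H_def by (rule l2sq_add) measurable
      also have "l2sq (\<lambda>x. a m x *\<^sub>R G j x) \<le> l2sq (G j)"
        using a01 by (intro l2sq_mono) (simp add: mult_left_le_one_le)
      also have "l2sq (\<lambda>x. partial j (a m) x *\<^sub>R u x) \<le> l2sq (\<lambda>x. (B * (1 / real (Suc m))) *\<^sub>R u x)"
      proof (rule l2sq_mono)
        fix x :: "real^'n"
        have "\<bar>partial j (a m) x\<bar> \<le> \<bar>B * (1 / real (Suc m))\<bar>"
          using pa[of j m x] by (simp only: times_divide_eq_right mult_1_right order_trans[OF _ abs_ge_self])
        then show "norm (partial j (a m) x *\<^sub>R u x) \<le> norm ((B * (1 / real (Suc m))) *\<^sub>R u x)"
          unfolding norm_scaleR by (rule mult_right_mono) simp
      qed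
      also have "\<dots> = ennreal ((B * (1 / real (Suc m)))\<^sup>2) * ennreal ?U"
        unfolding ui(2) by (rule l2sq_scaleR) measurable
      also have "2 * (ennreal ((B * (1 / real (Suc m)))\<^sup>2) * ennreal ?U) = ennreal (2 * ((B * (1 / real (Suc m)))\<^sup>2 * ?U))"
        by (simp only: ennreal_mult'[of "_\<^sup>2"] zero_le_power2 ennreal_mult'[of 2] zero_le_numeral ennreal_numeral)
      finally show ?thesis by (simp add: add_mono mult_left_mono)
    qed
    have "(\<Sum>j\<in>UNIV. l2sq (H m j)) \<le> (\<Sum>j\<in>UNIV. 2 * l2sq (G j) + ennreal (2 * ((B * (1 / real (Suc m)))\<^sup>2 * ?U)))"
      by (intro sum_mono Hj)
    also have "\<dots> = 2 * (\<Sum>j\<in>UNIV. l2sq (G j)) + ennreal (real CARD('n) * (2 * ((B * (1 / real (Suc m)))\<^sup>2 * ?U)))"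
      unfolding sum.distrib sum_distrib_left[symmetric]
      by (simp only: sum_constant ennreal_mult'[of "real _"] of_nat_0_le_iff ennreal_of_nat_eq_real_of_nat)
    also have "ennreal (real CARD('n) * (2 * ((B * (1 / real (Suc m)))\<^sup>2 * ?U))) \<le> ennreal 1"
      using m(2) by (intro ennreal_leI less_imp_le)
    finally show "(\<Sum>j\<in>UNIV. l2sq (H m j)) \<le> 2 * (\<Sum>j\<in>UNIV. l2sq (G j)) + 1"
      by (simp add: add_left_mono)
  qed (auto simp: H_def a0 pa0)
qed

text \<open>Testing with y \<mapsto> \<open>\<rho> (x - y)\<close> makes the weak equation compute
  \<open>conv (partial j \<rho>) v x\<close>, the derivative of the mollified function. The
  coefficient then stands inside the convolution at y but outside at x; the last integral is this
  difference.\<close>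

lemma twisted_conv:
  fixes \<phi> :: "real^'n::finite \<Rightarrow> real"
  assumes \<phi>: "smooth \<phi>" and \<rho>: "mollifier \<epsilon> \<rho>" and v: "integrable lborel v"
    and H: "integrable lborel H" and \<phi>v: "integrable lborel (\<lambda>y. (partial j \<phi> y / 2) *\<^sub>R v y)"
    and w: "weak_twisted \<phi> j v H"
  shows "twisted \<phi> j (conv \<rho> v) x = conv \<rho> H x
    + (LINT y|lborel. (\<rho> (x - y) * ((partial j \<phi> x - partial j \<phi> y) / 2)) *\<^sub>R v y)"
proof -
  have sm: "smooth \<rho>" using \<rho> by (simp add: mollifier_def)
  let ?\<psi> = "\<lambda>y. complex_of_real (\<rho> (x + (- 1) *\<^sub>R y))"
  have "?\<psi> \<in> test_functions"
  proof (rule test_functionsI)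
    show "smooth ?\<psi>" by (rule smooth_of_real[OF smooth_affine[OF sm]])
    show "?\<psi> y = 0" if "norm y > norm x + \<epsilon>" for y
    proof -
      have "norm (x + (- 1) *\<^sub>R y) > \<epsilon>" using that norm_triangle_ineq2[of y x] by (simp add: norm_minus_commute)
      then show ?thesis using mollifier_support[OF \<rho>] by simp
    qed
  qed
  moreover have "partial j ?\<psi> y = - complex_of_real (partial j \<rho> (x - y))" for y
  proof -
    have D: "(\<lambda>y. \<rho> (x + (- 1) *\<^sub>R y)) differentiable (at y)"
      "partial j (\<lambda>y. \<rho> (x + (- 1) *\<^sub>R y)) y = (- 1) *\<^sub>R partial j \<rho> (x + (- 1) *\<^sub>R y)"
      by (rule partial_affine[OF smooth_differentiable[OF sm]])+
    show ?thesis unfolding partial_of_real[OF D(1)] D(2) by simp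
  qed
  ultimately have "(LINT y|lborel. v y * (- complex_of_real (partial j \<rho> (x - y))))
    = - (LINT y|lborel. (H y - (partial j \<phi> y / 2) *\<^sub>R v y) * complex_of_real (\<rho> (x - y)))"
    using w unfolding weak_twisted_def by (metis (no_types, lifting) Bochner_Integration.integral_cong diff_conv_add_uminus scaleR_minus1_left)
  moreover have "(\<lambda>y. v y * (- complex_of_real (partial j \<rho> (x - y)))) = (\<lambda>y. - (partial j \<rho> (x - y) *\<^sub>R v y))"
    by (simp add: fun_eq_iff scaleR_conv_of_real mult.commute)
  moreover have "(\<lambda>y. (H y - (partial j \<phi> y / 2) *\<^sub>R v y) * complex_of_real (\<rho> (x - y)))
     = (\<lambda>y. \<rho> (x - y) *\<^sub>R H y - \<rho> (x - y) *\<^sub>R ((partial j \<phi> y / 2) *\<^sub>R v y))"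
    by (simp add: fun_eq_iff scaleR_conv_of_real algebra_simps)
  ultimately have "(LINT y|lborel. - (partial j \<rho> (x - y) *\<^sub>R v y))
    = - (LINT y|lborel. \<rho> (x - y) *\<^sub>R H y - \<rho> (x - y) *\<^sub>R ((partial j \<phi> y / 2) *\<^sub>R v y))"
    by (simp only:)
  then have "conv (partial j \<rho>) v x = conv \<rho> H x - conv \<rho> (\<lambda>y. (partial j \<phi> y / 2) *\<^sub>R v y) x"
    using integrable_mollifier_mult[OF \<rho> H, of x] integrable_mollifier_mult[OF \<rho> \<phi>v, of x]
    by (simp add: conv_def)
  moreover have "partial j (conv \<rho> v) x = conv (partial j \<rho>) v x"
    by (simp add: partial_conv[OF mollifier_C_k[OF \<rho>] mollifier_support[OF \<rho>] v])
  moreover have "(LINT y|lborel. (\<rho> (x - y) * ((partial j \<phi> x - partial j \<phi> y) / 2)) *\<^sub>R v y)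
    = (partial j \<phi> x / 2) *\<^sub>R conv \<rho> v x - conv \<rho> (\<lambda>y. (partial j \<phi> y / 2) *\<^sub>R v y) x"
  proof -
    have "(\<lambda>y. (\<rho> (x - y) * ((partial j \<phi> x - partial j \<phi> y) / 2)) *\<^sub>R v y)
      = (\<lambda>y. (partial j \<phi> x / 2) *\<^sub>R (\<rho> (x - y) *\<^sub>R v y) - \<rho> (x - y) *\<^sub>R ((partial j \<phi> y / 2) *\<^sub>R v y))"
      by (simp add: fun_eq_iff scaleR_left_diff_distrib[symmetric] field_simps)
    then show ?thesis
      using integrable_mollifier_mult[OF \<rho> v, of x] integrable_mollifier_mult[OF \<rho> \<phi>v, of x]
      by (simp add: conv_def del: scaleR_scaleR)
  qed
  ultimately show ?thesis by (simp add: twisted_def)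
qed

text \<open>The commutator of \<open>\<rho>\<close>-convolution with multiplication by the coefficient \<open>\<nabla>\<phi>/2\<close> is small
  because that coefficient is uniformly continuous near the support of \<open>v\<close>.\<close>

lemma mollify_approx:
  fixes \<phi> :: "real^'n::finite \<Rightarrow> real" and H :: "'n \<Rightarrow> real^'n \<Rightarrow> complex"
  assumes \<phi>: "smooth \<phi>"
    and v [measurable]: "v \<in> borel_measurable borel" and v_fin: "l2sq v < \<infinity>"
    and H [measurable]: "\<And>j. H j \<in> borel_measurable borel" and H_fin: "\<And>j. l2sq (H j) < \<infinity>"
    and v0: "\<And>x. norm x > R \<Longrightarrow> v x = 0" and H0: "\<And>j x. norm x > R \<Longrightarrow> H j x = 0"
    and w: "\<And>j. weak_twisted \<phi> j v (H j)" and \<delta>: "\<delta> > 0"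
  obtains g R' where "C_k 1 g" "\<And>x. norm x > R' \<Longrightarrow> g x = 0" "l2sq (\<lambda>x. g x - v x) \<le> ennreal \<delta>"
    "(\<Sum>j\<in>UNIV. l2sq (twisted \<phi> j g)) \<le> 2 * (\<Sum>j\<in>UNIV. l2sq (H j)) + 1"
proof -
  have vi: "integrable lborel v" by (rule integrable_l2_bounded_support[OF v v_fin v0])
  have Hi: "integrable lborel (H j)" for j by (rule integrable_l2_bounded_support[OF H H_fin H0])
  have pc: "continuous_on A (partial j \<phi>)" for j A by (rule continuous_on_partial[OF \<phi>])
  have \<phi>vi: "integrable lborel (\<lambda>y. (partial j \<phi> y / 2) *\<^sub>R v y)" for j
  proof -
    \<comment> \<open>The coefficient \<open>partial j \<phi>\<close> may grow at infinity; a
      continuous cutoff equal to 1 where v lives makes it compactly supported without changing the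
      product.\<close>
    define c where "c = (\<lambda>y::real^'n. max 0 (min 1 (R + 1 - norm y)))"
    have c: "continuous_on UNIV c" "\<And>y. norm y > R + 1 \<Longrightarrow> c y = 0" "\<And>y. norm y \<le> R \<Longrightarrow> c y = 1"
      unfolding c_def by (auto intro!: continuous_intros)
    have "integrable lborel (\<lambda>y. v y * complex_of_real (c y * (partial j \<phi> y / 2)))"
      by (rule integrable_l2_mult[OF v v_fin, of _ "R + 1"]) (auto intro!: continuous_intros c pc)
    moreover have "(\<lambda>y. v y * complex_of_real (c y * (partial j \<phi> y / 2))) = (\<lambda>y. (partial j \<phi> y / 2) *\<^sub>R v y)"
    proof
      fix y
      show "v y * complex_of_real (c y * (partial j \<phi> y / 2)) = (partial j \<phi> y / 2) *\<^sub>R v y"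
        by (cases "norm y > R") (simp_all add: v0 c(3) scaleR_conv_of_real)
    qed
    ultimately show ?thesis by simp
  qed
  define U where "U = (LINT x|lborel. (norm (v x))\<^sup>2)"
  have U: "ennreal U = l2sq v" "U \<ge> 0" unfolding U_def by (auto simp: integrable_l2sq(2)[OF v v_fin])
  define D where "D = real CARD('n) * (2 * (U + 1))"
  have D: "D > 0" using U(2) by (simp add: D_def)
  \<comment> \<open>The admissible oscillation of \<open>partial j \<phi> / 2\<close>: it makes the
    n commutator terms, each doubled by \<open>l2sq_add\<close>, contribute at most 1
    altogether.\<close>
  define \<omega> where "\<omega> = sqrt (1 / D)"
  have \<omega>: "\<omega> > 0" using D by (simp add: \<omega>_def)
  have \<omega>U: "real CARD('n) * (2 * (\<omega>\<^sup>2 * U)) \<le> 1" 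
  proof -
    have "real CARD('n) * (2 * (\<omega>\<^sup>2 * U)) \<le> \<omega>\<^sup>2 * D" by (simp add: D_def algebra_simps)
    also have "\<dots> = 1" using D by (simp add: \<omega>_def)
    finally show ?thesis .
  qed
  have "\<exists>d>0. \<forall>x\<in>cball 0 (R + 1). \<forall>y\<in>cball 0 (R + 1). norm (x - y) < d \<longrightarrow> \<bar>partial j \<phi> x - partial j \<phi> y\<bar> < 2 * \<omega>" for j
  proof -
    have "uniformly_continuous_on (cball 0 (R + 1)) (partial j \<phi>)"
      by (rule compact_uniformly_continuous[OF pc]) simp
    moreover have "2 * \<omega> > 0" using \<omega> by simp
    ultimately obtain d where d: "d > 0" "\<And>x y. x \<in> cball 0 (R + 1) \<Longrightarrow> y \<in> cball 0 (R + 1) \<Longrightarrow> dist x y < d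
        \<Longrightarrow> dist (partial j \<phi> x) (partial j \<phi> y) < 2 * \<omega>"
      unfolding uniformly_continuous_on_def by meson
    show ?thesis
      by (intro exI[of _ d] conjI ballI impI d(1)) (use d(2) in \<open>simp add: dist_norm\<close>)
  qed
  then obtain d where d: "\<And>j. d j > 0" "\<And>j x y. x \<in> cball 0 (R + 1) \<Longrightarrow> y \<in> cball 0 (R + 1) \<Longrightarrow>
      norm (x - y) < d j \<Longrightarrow> \<bar>partial j \<phi> x - partial j \<phi> y\<bar> < 2 * \<omega>" by metis
  obtain \<epsilon>0 where \<epsilon>0: "\<epsilon>0 > 0" "\<And>\<epsilon> \<rho>. \<epsilon> \<le> \<epsilon>0 \<Longrightarrow> mollifier \<epsilon> \<rho> \<Longrightarrow> l2sq (\<lambda>x. conv \<rho> v x - v x) \<le> ennreal \<delta>"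
    by (rule mollifier_approx[OF v v_fin v0 \<delta>]) auto
  define d' where "d' = Min (range d)"
  have d': "d' > 0" "d' \<le> d j" for j using d(1) by (auto simp: d'_def)
  \<comment> \<open>The bound 1 keeps x in the ball of radius \<open>R + 1\<close> whenever y is in
    the support of v and the kernel is nonzero; the bound by d' makes the coefficient oscillate by
    less than 2 * \<omega> there.\<close>
  define \<epsilon> where "\<epsilon> = min \<epsilon>0 (min 1 (d' / 2))"
  have \<epsilon>: "\<epsilon> > 0" "\<epsilon> \<le> \<epsilon>0" "\<epsilon> \<le> 1" "\<epsilon> < d'" using \<epsilon>0 d'(1) by (auto simp: \<epsilon>_def)
  obtain \<rho> :: "real^'n \<Rightarrow> real" where \<rho>: "mollifier \<epsilon> \<rho>" using mollifier_exists[OF \<epsilon>(1)] by blast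
  have \<rho>0: "\<rho> z \<ge> 0" for z using \<rho> by (simp add: mollifier_def)
  define E where "E = (\<lambda>j x. LINT y|lborel. (\<rho> (x - y) * ((partial j \<phi> x - partial j \<phi> y) / 2)) *\<^sub>R v y)"
  have tw: "twisted \<phi> j (conv \<rho> v) x = conv \<rho> (H j) x + E j x" for j x
    unfolding E_def by (rule twisted_conv[OF \<phi> \<rho> vi Hi \<phi>vi w])
  have g: "C_k 1 (conv \<rho> v)" by (rule C_k_1_mollified[OF \<rho> vi])
  have cH [measurable]: "conv \<rho> (H j) \<in> borel_measurable borel" for j
    by (intro C_k_1_borel_measurable C_k_1_mollified[OF \<rho>] Hi)
  \<comment> \<open>Measurability of the commutator is read off from the identity that expresses it
    as a difference of two measurable functions.\<close>
  have Em: "E j \<in> borel_measurable borel" for j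
  proof -
    have [measurable]: "twisted \<phi> j (conv \<rho> v) \<in> borel_measurable borel"
      by (rule twisted_measurable[OF \<phi> g])
    have "E j = (\<lambda>x. twisted \<phi> j (conv \<rho> v) x - conv \<rho> (H j) x)" by (simp add: tw)
    then show ?thesis by simp
  qed
  have El2: "l2sq (E j) \<le> ennreal (\<omega>\<^sup>2 * U)" for j
  proof -
    have "l2sq (E j) \<le> l2sq (\<lambda>y. \<omega> *\<^sub>R v y)"
      unfolding E_def
    proof (rule l2sq_young[OF \<rho> _ norm_mollified_le[OF \<rho>]])
      fix x y
      show "norm ((\<rho> (x - y) * ((partial j \<phi> x - partial j \<phi> y) / 2)) *\<^sub>R v y) \<le> \<rho> (x - y) * norm (\<omega> *\<^sub>R v y)"
      proof (cases "norm y > R \<or> norm (x - y) > \<epsilon>")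
        case False
        then have "norm x \<le> R + 1" using \<epsilon>(3) norm_triangle_sub[of x y] by linarith
        then have "\<bar>partial j \<phi> x - partial j \<phi> y\<bar> < 2 * \<omega>"
          using False \<epsilon>(4) d'(2)[of j] by (intro d(2)) auto
        then have "\<bar>(partial j \<phi> x - partial j \<phi> y) / 2\<bar> \<le> \<omega>" by simp
        then have "\<rho> (x - y) * \<bar>(partial j \<phi> x - partial j \<phi> y) / 2\<bar> * norm (v y) \<le> \<rho> (x - y) * \<omega> * norm (v y)"
          by (intro mult_right_mono mult_left_mono \<rho>0) auto
        then show ?thesis using \<rho>0[of "x - y"] \<omega> by (simp add: abs_mult mult.assoc)
      qed (auto simp: v0 mollifier_support[OF \<rho>])
    qed measurable
    also have "\<dots> = ennreal (\<omega>\<^sup>2) * ennreal U" unfolding U(1) by (rule l2sq_scaleR[OF v])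
    finally show ?thesis using U(2) by (simp add: ennreal_mult)
  qed
  have twj: "l2sq (twisted \<phi> j (conv \<rho> v)) \<le> 2 * l2sq (H j) + ennreal (2 * (\<omega>\<^sup>2 * U))" for j
  proof -
    have "l2sq (twisted \<phi> j (conv \<rho> v)) = l2sq (\<lambda>x. conv \<rho> (H j) x + E j x)" by (simp add: tw[abs_def] l2sq_def)
    also have "\<dots> \<le> 2 * l2sq (conv \<rho> (H j)) + 2 * l2sq (E j)" by (rule l2sq_add[OF cH Em])
    also have "\<dots> \<le> 2 * l2sq (H j) + 2 * ennreal (\<omega>\<^sup>2 * U)"
      by (intro add_mono mult_left_mono l2sq_conv_le[OF \<rho> H] El2) auto
    also have "2 * ennreal (\<omega>\<^sup>2 * U) = ennreal (2 * (\<omega>\<^sup>2 * U))" using U(2) by (simp add: ennreal_mult)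
    finally show ?thesis .
  qed
  have "(\<Sum>j\<in>UNIV. l2sq (twisted \<phi> j (conv \<rho> v))) \<le> (\<Sum>j\<in>UNIV. 2 * l2sq (H j) + ennreal (2 * (\<omega>\<^sup>2 * U)))"
    by (intro sum_mono twj)
  also have "\<dots> = 2 * (\<Sum>j\<in>UNIV. l2sq (H j)) + ennreal (real CARD('n) * (2 * (\<omega>\<^sup>2 * U)))"
    unfolding sum.distrib sum_distrib_left[symmetric]
    by (simp only: sum_constant ennreal_mult'[of "real _"] of_nat_0_le_iff ennreal_of_nat_eq_real_of_nat)
  also have "\<dots> \<le> 2 * (\<Sum>j\<in>UNIV. l2sq (H j)) + ennreal 1" by (intro add_left_mono ennreal_leI \<omega>U)
  finally have "(\<Sum>j\<in>UNIV. l2sq (twisted \<phi> j (conv \<rho> v))) \<le> 2 * (\<Sum>j\<in>UNIV. l2sq (H j)) + 1" by simp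
  then show thesis
    by (intro that[of "conv \<rho> v" "\<epsilon> + R"] g \<epsilon>0(2)[OF \<epsilon>(2) \<rho>] conv_eq_0[OF mollifier_support[OF \<rho>] v0]) auto
qed

text \<open>Cut off, then mollify. Each stage at most doubles the energy and adds 1, and 2 * (2 * S
  + 1) + 1 = 4 * S + 3.\<close>

lemma smooth_approximation:
  fixes \<phi> :: "real^'n::finite \<Rightarrow> real" and G :: "'n \<Rightarrow> real^'n \<Rightarrow> complex"
  assumes \<phi>: "smooth \<phi>"
    and u [measurable]: "u \<in> borel_measurable borel" and u_fin: "l2sq u < \<infinity>"
    and G [measurable]: "\<And>j. G j \<in> borel_measurable borel" and G_fin: "\<And>j. l2sq (G j) < \<infinity>"
    and w: "\<And>j. weak_twisted \<phi> j u (G j)" and \<delta>: "\<delta> > 0"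
  obtains g R where "C_k 1 g" "\<And>x. norm x > R \<Longrightarrow> g x = 0" "l2sq (\<lambda>x. g x - u x) \<le> ennreal \<delta>"
    "(\<Sum>j\<in>UNIV. l2sq (twisted \<phi> j g)) \<le> 4 * (\<Sum>j\<in>UNIV. l2sq (G j)) + 3"
proof -
  have \<delta>4: "\<delta> / 4 > 0" using \<delta> by simp
  obtain v H R where vH [measurable]: "v \<in> borel_measurable borel" "\<And>j. H j \<in> borel_measurable borel"
    and supp: "\<And>x. norm x > R \<Longrightarrow> v x = 0" "\<And>j x. norm x > R \<Longrightarrow> H j x = 0"
    and wv: "\<And>j. weak_twisted \<phi> j v (H j)" and vu: "l2sq (\<lambda>x. v x - u x) \<le> ennreal (\<delta> / 4)"
    and HG: "(\<Sum>j\<in>UNIV. l2sq (H j)) \<le> 2 * (\<Sum>j\<in>UNIV. l2sq (G j)) + 1"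
    by (rule cutoff_approx[OF \<phi> u u_fin G G_fin w \<delta>4]) (rule that; assumption)
  have "l2sq (\<lambda>x. (v x - u x) + u x) \<le> 2 * ennreal (\<delta> / 4) + 2 * l2sq u"
    by (intro order_trans[OF l2sq_add] add_mono mult_left_mono vu) auto
  then have "l2sq v \<le> 2 * ennreal (\<delta> / 4) + 2 * l2sq u" by simp
  also have "\<dots> < \<infinity>" using u_fin by (simp add: ennreal_mult_less_top)
  finally have v_fin: "l2sq v < \<infinity>" .
  have H_fin: "l2sq (H j) < \<infinity>" for j
  proof -
    have "l2sq (H j) \<le> (\<Sum>j\<in>UNIV. l2sq (H j))" by (rule member_le_sum) auto
    also have "\<dots> \<le> 2 * (\<Sum>j\<in>UNIV. l2sq (G j)) + 1" by (rule HG)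
    also have "\<dots> < \<infinity>" using G_fin by (auto simp: ennreal_mult_less_top)
    finally show ?thesis .
  qed
  obtain g R' where g: "C_k 1 g" "\<And>x. norm x > R' \<Longrightarrow> g x = 0" "l2sq (\<lambda>x. g x - v x) \<le> ennreal (\<delta> / 4)"
    "(\<Sum>j\<in>UNIV. l2sq (twisted \<phi> j g)) \<le> 2 * (\<Sum>j\<in>UNIV. l2sq (H j)) + 1"
    by (rule mollify_approx[where R=R, OF \<phi> vH(1) v_fin vH(2) H_fin supp wv \<delta>4]) (assumption, assumption, (rule that; assumption))
  have [measurable]: "g \<in> borel_measurable borel" by (rule C_k_1_borel_measurable[OF g(1)])
  have "l2sq (\<lambda>x. (g x - v x) + (v x - u x)) \<le> 2 * ennreal (\<delta> / 4) + 2 * ennreal (\<delta> / 4)"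
    by (intro order_trans[OF l2sq_add] add_mono mult_left_mono vu g) auto
  also have "\<dots> = ennreal (2 * (\<delta> / 4) + 2 * (\<delta> / 4))" by (rule two_ennreal_add) (use \<delta> in auto)
  finally have gu: "l2sq (\<lambda>x. g x - u x) \<le> ennreal \<delta>" by simp
  have "(\<Sum>j\<in>UNIV. l2sq (twisted \<phi> j g)) \<le> 2 * (2 * (\<Sum>j\<in>UNIV. l2sq (G j)) + 1) + 1"
    by (intro order_trans[OF g(4)] add_right_mono mult_left_mono HG) auto
  also have "\<dots> = 4 * (\<Sum>j\<in>UNIV. l2sq (G j)) + 3" by (simp add: distrib_left mult.assoc[symmetric])
  finally show thesis by (intro that[OF g(1,2) gu])
qed

section \<open>Completeness and compactness\<close>

text \<open>Riesz-Fischer: along a fast subsequence the increments are almost everywhere summable,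
  so a pointwise limit exists, and Fatou's lemma transfers the Cauchy estimate to it.\<close>

lemma l2sq_complete:
  fixes w :: "nat \<Rightarrow> real^'n::finite \<Rightarrow> complex"
  assumes w [measurable]: "\<And>k. w k \<in> borel_measurable borel"
    and cauchy: "\<And>e::real. e > 0 \<Longrightarrow> \<exists>N. \<forall>k\<ge>N. \<forall>l\<ge>N. l2sq (\<lambda>x. w k x - w l x) \<le> ennreal e"
  obtains g where "g \<in> borel_measurable borel"
    "\<And>e::real. e > 0 \<Longrightarrow> \<exists>N. \<forall>k\<ge>N. l2sq (\<lambda>x. w k x - g x) \<le> ennreal e"
proof -
  have "\<exists>N. \<forall>k\<ge>N. \<forall>l\<ge>N. l2sq (\<lambda>x. w k x - w l x) \<le> ennreal ((1/8) ^ i)" for i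
    by (rule cauchy) simp
  then obtain N where N: "\<And>i k l. k \<ge> N i \<Longrightarrow> l \<ge> N i \<Longrightarrow> l2sq (\<lambda>x. w k x - w l x) \<le> ennreal ((1/8) ^ i)"
    by metis
  \<comment> \<open>Adding up the thresholds makes r increasing and at least as large as both i and
    \<open>N i\<close>.\<close>
  define r where "r = (\<lambda>i. i + (\<Sum>j\<le>i. N j))"
  have r_mono: "r i \<le> r (Suc i)" and rN: "N i \<le> r i" and ri: "i \<le> r i" for i
    by (auto simp: r_def intro: member_le_sum trans_le_add2)
  define d where "d = (\<lambda>i x. w (r (Suc i)) x - w (r i) x)"
  have [measurable]: "d i \<in> borel_measurable borel" for i unfolding d_def by measurable
  have dle: "l2sq (d i) \<le> ennreal ((1/8) ^ i)" for i
    unfolding d_def by (rule N) (use rN[of i] r_mono[of i] in auto)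
  \<comment> \<open>The weights 2 ^ i still leave a convergent series, since 2 ^ i * (1/8) ^ i =
    (1/4) ^ i, and they are what turns square summability into summability below.\<close>
  have "(\<integral>\<^sup>+x. (\<Sum>i. ennreal (2 ^ i * (norm (d i x))\<^sup>2)) \<partial>lborel) = (\<Sum>i. ennreal (2 ^ i) * l2sq (d i))"
    unfolding l2sq_def by (simp add: nn_integral_suminf ennreal_mult nn_integral_cmult)
  also have "\<dots> \<le> (\<Sum>i. ennreal ((1/4) ^ i))"
  proof (rule suminf_le)
    show "ennreal (2 ^ i) * l2sq (d i) \<le> ennreal ((1/4) ^ i)" for i
    proof -
      have "ennreal (2 ^ i) * l2sq (d i) \<le> ennreal (2 ^ i) * ennreal ((1/8) ^ i)"
        by (rule mult_left_mono[OF dle]) simp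
      also have "\<dots> = ennreal ((1/4) ^ i)"
        by (subst ennreal_mult[symmetric]) (simp_all add: power_mult_distrib[symmetric])
      finally show ?thesis .
    qed
  qed auto
  also have "\<dots> = ennreal (1 / (1 - 1/4))"
    by (rule suminf_ennreal_eq[OF _ geometric_sums]) simp_all
  also have "\<dots> < \<infinity>" by simp
  finally have "AE x in lborel. (\<Sum>i. ennreal (2 ^ i * (norm (d i x))\<^sup>2)) \<noteq> \<infinity>"
    by (intro nn_integral_PInf_AE) simp_all
  then have AE_conv: "AE x in lborel. convergent (\<lambda>i. w (r i) x)"
  proof eventually_elim
    case (elim x)
    then have s: "summable (\<lambda>i. 2 ^ i * (norm (d i x))\<^sup>2)"
      by (intro summable_suminf_not_top) auto
    have "summable (\<lambda>i. d i x)"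
    proof (rule summable_comparison_test')
      show "summable (\<lambda>i. (1/2) ^ i + 2 ^ i * (norm (d i x))\<^sup>2)"
        by (intro summable_add s summable_geometric) simp
      show "norm (d i x) \<le> (1/2) ^ i + 2 ^ i * (norm (d i x))\<^sup>2" for i
      proof -
        \<comment> \<open>The inequality between 2ab and the sum of squares, with the weight split
          so that one square is the geometric term (1/2) ^ i.\<close>
        define a where "a = sqrt ((1/2::real) ^ i)"
        define b where "b = sqrt (2 ^ i) * norm (d i x)"
        have "a * b = norm (d i x)"
          by (simp add: a_def b_def mult.assoc[symmetric] real_sqrt_mult[symmetric] power_mult_distrib[symmetric])
        moreover have "a\<^sup>2 = (1/2) ^ i" "b\<^sup>2 = 2 ^ i * (norm (d i x))\<^sup>2"
          by (simp_all add: a_def b_def power_mult_distrib)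
        moreover have "2 * (a * b) \<le> a\<^sup>2 + b\<^sup>2" using sum_squares_bound[of a b] by (simp only: mult.assoc)
        ultimately show ?thesis using norm_ge_zero[of "d i x"] by linarith
      qed
    qed
    then have "convergent (\<lambda>n. \<Sum>i<n. d i x)" by (simp add: summable_iff_convergent)
    moreover have "(\<Sum>i<n. d i x) = w (r n) x - w (r 0) x" for n
      unfolding d_def by (rule sum_lessThan_telescope[of "\<lambda>n. w (r n) x"])
    ultimately have "convergent (\<lambda>n. w (r n) x - w (r 0) x)" by simp
    then have "convergent (\<lambda>n. (w (r n) x - w (r 0) x) + w (r 0) x)"
      by (intro convergent_add convergent_const)
    then show ?case by simp
  qed
  \<comment> \<open>The value of \<open>lim\<close> where the sequence diverges is irrelevant, as
    this happens only on a null set.\<close>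
  define g where "g = (\<lambda>x. lim (\<lambda>i. w (r i) x))"
  have g [measurable]: "g \<in> borel_measurable borel" unfolding g_def by measurable
  have "\<exists>N. \<forall>k\<ge>N. l2sq (\<lambda>x. w k x - g x) \<le> ennreal e" if e: "e > 0" for e :: real
  proof -
    obtain N0 where N0: "\<And>k l. k \<ge> N0 \<Longrightarrow> l \<ge> N0 \<Longrightarrow> l2sq (\<lambda>x. w k x - w l x) \<le> ennreal e"
      using cauchy[OF e] by blast
    have "l2sq (\<lambda>x. w k x - g x) \<le> ennreal e" if k: "k \<ge> N0" for k
    proof -
      have "AE x in lborel. ennreal ((norm (w k x - g x))\<^sup>2) = liminf (\<lambda>i. ennreal ((norm (w k x - w (r i) x))\<^sup>2))"
        using AE_conv
      proof eventually_elim
        case (elim x)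
        then have "(\<lambda>i. w (r i) x) \<longlonglongrightarrow> g x" by (simp add: g_def convergent_LIMSEQ_iff)
        then have "(\<lambda>i. ennreal ((norm (w k x - w (r i) x))\<^sup>2)) \<longlonglongrightarrow> ennreal ((norm (w k x - g x))\<^sup>2)"
          by (intro tendsto_ennrealI tendsto_intros)
        then show ?case by (intro lim_imp_Liminf[symmetric]) auto
      qed
      then have "l2sq (\<lambda>x. w k x - g x) = (\<integral>\<^sup>+x. liminf (\<lambda>i. ennreal ((norm (w k x - w (r i) x))\<^sup>2)) \<partial>lborel)"
        unfolding l2sq_def by (rule nn_integral_cong_AE)
      also have "\<dots> \<le> liminf (\<lambda>i. l2sq (\<lambda>x. w k x - w (r i) x))"
        unfolding l2sq_def by (rule nn_integral_liminf) measurable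
      also have "\<dots> \<le> limsup (\<lambda>i. l2sq (\<lambda>x. w k x - w (r i) x))"
        by (rule Liminf_le_Limsup) simp
      also have "\<dots> \<le> ennreal e"
      proof (rule Limsup_bounded)
        show "\<forall>\<^sub>F i in sequentially. l2sq (\<lambda>x. w k x - w (r i) x) \<le> ennreal e"
          using eventually_ge_at_top[of N0]
        proof eventually_elim
          case (elim i)
          then show ?case using ri[of i] k by (intro N0) auto
        qed
      qed
      finally show ?thesis .
    qed
    then show ?thesis by blast
  qed
  with g show thesis by (rule that)
qed

section \<open>Extraction of a convergent subsequence\<close>

lemma partial_diff:
  assumes "f differentiable (at x)" "g differentiable (at x)"
  shows "partial j (\<lambda>x. f x - g x) x = partial j f x - partial j g x"
  using partial_eq[OF has_derivative_diff[OF assms[unfolded frechet_derivative_works]], of j]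
  by (simp add: partial_def)

lemma C_k_1_diff:
  assumes "C_k 1 f" "C_k 1 g"
  shows "C_k 1 (\<lambda>x. f x - g x)"
proof -
  have "partial j (\<lambda>x. f x - g x) = (\<lambda>x. partial j f x - partial j g x)" for j
    using assms by (auto simp: partial_diff)
  with assms show ?thesis
    unfolding C_k_1_iff by (auto intro!: differentiable_diff continuous_on_diff)
qed

lemma l2sq_diff:
  assumes [measurable]: "u \<in> borel_measurable borel" "v \<in> borel_measurable borel"
  shows "l2sq (\<lambda>x. u x - v x) \<le> 2 * l2sq u + 2 * l2sq v"
proof -
  have "l2sq (\<lambda>x. u x + (- v x)) \<le> 2 * l2sq u + 2 * l2sq (\<lambda>x. - v x)" by (rule l2sq_add) measurable
  then show ?thesis by (simp add: l2sq_def)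
qed

lemma twisted_diff:
  assumes "C_k 1 f" "C_k 1 g"
  shows "twisted \<phi> j (\<lambda>x. f x - g x) x = twisted \<phi> j f x - twisted \<phi> j g x"
proof -
  have "f differentiable (at x)" "g differentiable (at x)" using assms by simp_all
  then show ?thesis unfolding twisted_def by (simp add: partial_diff scaleR_right_diff_distrib)
qed

lemma integral_le_nn_integral:
  fixes f :: "'a \<Rightarrow> real"
  assumes "\<And>x. f x \<ge> 0"
  shows "ennreal (LINT x|M. f x) \<le> (\<integral>\<^sup>+x. ennreal (f x) \<partial>M)"
proof -
  have "ennreal (LINT x|M. f x) \<le> ennreal (norm (LINT x|M. f x))" by (rule ennreal_leI) simp
  also have "\<dots> \<le> (\<integral>\<^sup>+x. ennreal (norm (f x)) \<partial>M)" by (rule norm_integral_le_nn_integral)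
  also have "\<dots> = (\<integral>\<^sup>+x. ennreal (f x) \<partial>M)" using assms by (intro nn_integral_cong) simp
  finally show ?thesis .
qed

text \<open>Each \<open>u k\<close> is replaced by a compactly supported \<open>C\<^sup>1\<close>
  function \<open>w k\<close> at squared distance at most 1 / (k + 1). Differences of these are
  again admissible in \<open>main_inequality\<close>, and the replacement does not affect
  limits.\<close>

theorem l2_compactness:
  fixes \<phi> :: "real^'n::finite \<Rightarrow> real" and u :: "nat \<Rightarrow> real^'n \<Rightarrow> complex"
  assumes \<phi>: "smooth \<phi>" and sb: "semibounded_below (potential \<phi>)"
    and \<gamma>: "\<gamma> > 0" and div: "diverges_off_small_sets (potential \<phi>) \<gamma>"
    and u [measurable]: "\<And>k. u k \<in> borel_measurable borel"
    and G [measurable]: "\<And>k j. G k j \<in> borel_measurable borel"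
    and weak: "\<And>k j. weak_twisted \<phi> j (u k) (G k j)"
    and B: "B \<ge> 0" "\<And>k. l2sq (u k) \<le> ennreal B" "\<And>k. (\<Sum>j\<in>UNIV. l2sq (G k j)) \<le> ennreal B"
  obtains g s where "g \<in> borel_measurable borel" "l2sq g < \<infinity>" "strict_mono (s :: nat \<Rightarrow> nat)"
    "\<And>e::real. e > 0 \<Longrightarrow> \<exists>N. \<forall>k\<ge>N. l2sq (\<lambda>x. u (s k) x - g x) \<le> ennreal e"
proof -
  obtain C where C: "C > 0" "\<And>x. potential \<phi> x \<ge> - C"
    using sb by (auto simp: semibounded_below_def)
  have u_fin: "l2sq (u k) < \<infinity>" for k using B(2)[of k] by (rule order_le_less_trans) simp
  have G_fin: "l2sq (G k j) < \<infinity>" for k j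
  proof -
    have "l2sq (G k j) \<le> (\<Sum>j\<in>UNIV. l2sq (G k j))" by (rule member_le_sum) auto
    also have "\<dots> \<le> ennreal B" by (rule B)
    finally show ?thesis by (rule order_le_less_trans) simp
  qed
  define P where "P = (\<lambda>k w R. C_k 1 w \<and> (\<forall>x. norm x > R \<longrightarrow> w x = 0) \<and> l2sq (\<lambda>x. w x - u k x) \<le> ennreal (1 / real (Suc k))
     \<and> (\<Sum>j\<in>UNIV. l2sq (twisted \<phi> j w)) \<le> 4 * (\<Sum>j\<in>UNIV. l2sq (G k j)) + 3)"
  have "\<exists>w R. P k w R" for k
  proof -
    have pos: "1 / real (Suc k) > 0" by simp
    show ?thesis
      unfolding P_def by (rule smooth_approximation[OF \<phi> u u_fin G G_fin weak pos]) blast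
  qed
  then obtain w R where P: "\<And>k. P k (w k) (R k)" by metis
  have w: "C_k 1 (w k)" and w0: "norm x > R k \<Longrightarrow> w k x = 0"
    and wu: "l2sq (\<lambda>x. w k x - u k x) \<le> ennreal (1 / real (Suc k))"
    and tw: "(\<Sum>j\<in>UNIV. l2sq (twisted \<phi> j (w k))) \<le> 4 * (\<Sum>j\<in>UNIV. l2sq (G k j)) + 3" for k x
    using P[of k] unfolding P_def by blast+
  have w_m [measurable]: "w k \<in> borel_measurable borel" for k by (rule C_k_1_borel_measurable[OF w])
  have wi: "integrable lborel (w k)" for k
    by (rule integrable_continuous_bounded_support[OF C_k_1_continuous[OF w], of "cball 0 (R k)"]) (use w0 in auto)
  define B1 where "B1 = 2 + 2 * B"
  define B2 where "B2 = 4 * B + 3"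
  have B12: "B1 > 0" "B2 > 0" using B by (auto simp: B1_def B2_def)
  have w_l2: "l2sq (w k) \<le> ennreal B1" for k
  proof -
    have "l2sq (\<lambda>x. (w k x - u k x) + u k x) \<le> 2 * ennreal (1 / real (Suc k)) + 2 * ennreal B"
      by (intro order_trans[OF l2sq_add] add_mono mult_left_mono wu B) auto
    also have "\<dots> = ennreal (2 * (1 / real (Suc k)) + 2 * B)" by (rule two_ennreal_add) (use B in auto)
    also have "\<dots> \<le> ennreal B1"
    proof (rule ennreal_leI)
      have "1 / real (Suc k) \<le> 1" by simp
      then show "2 * (1 / real (Suc k)) + 2 * B \<le> B1" unfolding B1_def by linarith
    qed
    finally show ?thesis by simp
  qed
  have tw_l2: "(\<Sum>j\<in>UNIV. l2sq (twisted \<phi> j (w k))) \<le> ennreal B2" for k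
  proof -
    have "(\<Sum>j\<in>UNIV. l2sq (twisted \<phi> j (w k))) \<le> 4 * ennreal B + 3"
      by (intro order_trans[OF tw] add_right_mono mult_left_mono B) auto
    also have "\<dots> = ennreal B2" using B by (simp add: B2_def ennreal_plus ennreal_mult)
    finally show ?thesis .
  qed
  \<comment> \<open>The means over all cubes of all sides 1 / (m + 1) at once; this countable family
    is fixed before any \<epsilon> is chosen.\<close>
  define f where "f = (\<lambda>k (m, \<kappa>). LINT x:cube (1 / real (Suc m)) \<kappa>|lborel. w k x)"
  have f_bound: "norm (f k p) \<le> sqrt B1" for k p
  proof -
    obtain m \<kappa> where p: "p = (m, \<kappa>)" by (cases p)
    have s: "1 / real (Suc m) > 0" by simp
    have "(1 / real (Suc m)) ^ CARD('n) \<le> 1" by (rule power_le_one) auto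
    \<comment> \<open>Sides are at most 1, so the volumes are too, and Cauchy-Schwarz bounds every
      mean by the norm of \<open>w k\<close>.\<close>
    then have E: "emeasure lborel (cube (1 / real (Suc m)) \<kappa>) \<le> 1"
      unfolding emeasure_cube[OF s] by (simp only: ennreal_1[symmetric] ennreal_leI)
    have "(\<integral>\<^sup>+x\<in>cube (1 / real (Suc m)) \<kappa>. ennreal ((norm (w k x))\<^sup>2) \<partial>lborel) \<le> l2sq (w k)"
      unfolding l2sq_def by (intro nn_integral_mono) (auto simp: indicator_def)
    also note w_l2
    finally have "emeasure lborel (cube (1 / real (Suc m)) \<kappa>) *
        (\<integral>\<^sup>+x\<in>cube (1 / real (Suc m)) \<kappa>. ennreal ((norm (w k x))\<^sup>2) \<partial>lborel) \<le> 1 * ennreal B1"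
      by (intro mult_mono E) auto
    then have "ennreal ((norm (f k p))\<^sup>2) \<le> 1 * ennreal B1"
      unfolding f_def p prod.case by (intro order_trans[OF norm_set_integral_power2_le]) auto
    then have "(norm (f k p))\<^sup>2 \<le> B1" using B12 by (simp add: ennreal_le_iff)
    then show ?thesis by (rule real_le_rsqrt)
  qed
  obtain s :: "nat \<Rightarrow> nat" where s: "strict_mono s" and s_conv: "\<And>p. \<exists>l. (\<lambda>n. f (s n) p) \<longlonglongrightarrow> l"
    by (rule function_convergent_subsequence[of UNIV f "sqrt B1"])
       (auto intro: f_bound countableI_type)
  have cauchy: "\<exists>N. \<forall>k\<ge>N. \<forall>l\<ge>N. l2sq (\<lambda>x. w (s k) x - w (s l) x) \<le> ennreal e" if e: "e > 0" for e :: real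
  proof -
    \<comment> \<open>A difference of two approximants has energy at most 4 * B2 and squared norm at
      most 4 * B1, so this part of the main inequality uses up e / 2.\<close>
    define \<epsilon> where "\<epsilon> = e / (2 * (4 * B2 + 4 * B1))"
    have \<epsilon>: "\<epsilon> > 0" using e B12 by (simp add: \<epsilon>_def)
    obtain m :: nat and I :: "('n \<Rightarrow> int) set" and c :: real where I: "finite I" "c \<ge> 0"
      and main: "\<And>w R. C_k 1 w \<Longrightarrow> (\<And>x. norm x > R \<Longrightarrow> w x = 0) \<Longrightarrow>
        (LINT x|lborel. (norm (w x))\<^sup>2) \<le>
        \<epsilon> * ((LINT x|lborel. (\<Sum>j\<in>UNIV. (norm (twisted \<phi> j w x))\<^sup>2)) + (LINT x|lborel. (norm (w x))\<^sup>2))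
        + c * (\<Sum>k\<in>I. (norm (LINT x:cube (1 / real (Suc m)) k|lborel. w x))\<^sup>2)"
      by (rule main_inequality[OF \<phi> C \<gamma> div \<epsilon>]) (rule that; (assumption | blast))
    define D where "D = c * real (card I) + 1"
    have D: "D > 0" using I by (simp add: D_def add_nonneg_pos)
    \<comment> \<open>The tolerance for the differences of means over the finitely many near cubes:
      c times their squared sum is then at most the other e / 2.\<close>
    define \<eta> where "\<eta> = sqrt (e / (2 * D))"
    have \<eta>: "\<eta> > 0" using e D by (simp add: \<eta>_def)
    have "\<exists>N. \<forall>k\<ge>N. \<forall>l\<ge>N. norm (f (s k) p - f (s l) p) < \<eta>" for p
    proof -
      have "Cauchy (\<lambda>n. f (s n) p)" using s_conv[of p] LIMSEQ_imp_Cauchy by blast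
      then show ?thesis using \<eta> unfolding Cauchy_iff by blast
    qed
    then obtain N where N: "\<And>p k l. k \<ge> N p \<Longrightarrow> l \<ge> N p \<Longrightarrow> norm (f (s k) p - f (s l) p) < \<eta>" by metis
    define N' where "N' = (\<Sum>\<kappa>\<in>I. N (m, \<kappa>))"
    have N': "N (m, \<kappa>) \<le> N'" if "\<kappa> \<in> I" for \<kappa>
      unfolding N'_def using I that by (intro member_le_sum) auto
    have "l2sq (\<lambda>x. w (s k) x - w (s l) x) \<le> ennreal e" if kl: "k \<ge> N'" "l \<ge> N'" for k l
    proof -
      define h where "h = (\<lambda>x. w (s k) x - w (s l) x)"
      have h: "C_k 1 h" unfolding h_def by (intro C_k_1_diff w)
      have h0: "h x = 0" if "norm x > max (R (s k)) (R (s l))" for x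
        using that by (simp add: h_def w0)
      have hm [measurable]: "h \<in> borel_measurable borel" by (rule C_k_1_borel_measurable[OF h])
      have tm [measurable]: "twisted \<phi> j h \<in> borel_measurable borel" "twisted \<phi> j (w i) \<in> borel_measurable borel" for j i
        by (intro twisted_measurable[OF \<phi>] h w)+
      have h_l2: "l2sq h \<le> ennreal (4 * B1)"
      proof -
        have "l2sq h \<le> 2 * ennreal B1 + 2 * ennreal B1"
          unfolding h_def by (intro order_trans[OF l2sq_diff] add_mono mult_left_mono w_l2) auto
        also have "\<dots> = ennreal (2 * B1 + 2 * B1)" by (rule two_ennreal_add) (use B12 in auto)
        finally show ?thesis by simp
      qed
      have "ennreal (LINT x|lborel. (norm (h x))\<^sup>2) \<le> l2sq h"
        unfolding l2sq_def by (rule integral_le_nn_integral) simp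
      also note h_l2
      finally have 1: "(LINT x|lborel. (norm (h x))\<^sup>2) \<le> 4 * B1" using B12 by (simp add: ennreal_le_iff)
      have "ennreal (LINT x|lborel. (\<Sum>j\<in>UNIV. (norm (twisted \<phi> j h x))\<^sup>2))
        \<le> (\<integral>\<^sup>+x. ennreal (\<Sum>j\<in>UNIV. (norm (twisted \<phi> j h x))\<^sup>2) \<partial>lborel)"
        by (rule integral_le_nn_integral) (simp add: sum_nonneg)
      also have "\<dots> = (\<integral>\<^sup>+x. (\<Sum>j\<in>UNIV. ennreal ((norm (twisted \<phi> j h x))\<^sup>2)) \<partial>lborel)"
        by (simp add: sum_ennreal)
      also have "\<dots> = (\<Sum>j\<in>UNIV. l2sq (twisted \<phi> j h))"
        unfolding l2sq_def by (rule nn_integral_sum) measurable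
      also have "\<dots> \<le> (\<Sum>j\<in>UNIV. 2 * l2sq (twisted \<phi> j (w (s k))) + 2 * l2sq (twisted \<phi> j (w (s l))))"
      proof (rule sum_mono)
        fix j
        have "l2sq (twisted \<phi> j h) = l2sq (\<lambda>x. twisted \<phi> j (w (s k)) x - twisted \<phi> j (w (s l)) x)"
          unfolding h_def l2sq_def by (simp add: twisted_diff[OF w w])
        also have "\<dots> \<le> 2 * l2sq (twisted \<phi> j (w (s k))) + 2 * l2sq (twisted \<phi> j (w (s l)))"
          by (rule l2sq_diff) measurable
        finally show "l2sq (twisted \<phi> j h) \<le> 2 * l2sq (twisted \<phi> j (w (s k))) + 2 * l2sq (twisted \<phi> j (w (s l)))" .
      qed
      also have "\<dots> = 2 * (\<Sum>j\<in>UNIV. l2sq (twisted \<phi> j (w (s k)))) + 2 * (\<Sum>j\<in>UNIV. l2sq (twisted \<phi> j (w (s l))))"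
        by (simp add: sum.distrib sum_distrib_left)
      also have "\<dots> \<le> 2 * ennreal B2 + 2 * ennreal B2"
        by (intro add_mono mult_left_mono tw_l2) auto
      also have "\<dots> = ennreal (2 * B2 + 2 * B2)" by (rule two_ennreal_add) (use B12 in auto)
      finally have 2: "(LINT x|lborel. (\<Sum>j\<in>UNIV. (norm (twisted \<phi> j h x))\<^sup>2)) \<le> 4 * B2"
        using B12 by (simp add: ennreal_le_iff)
      have 3: "(\<Sum>\<kappa>\<in>I. (norm (LINT x:cube (1 / real (Suc m)) \<kappa>|lborel. h x))\<^sup>2) \<le> real (card I) * \<eta>\<^sup>2"
      proof (rule sum_bounded_above)
        fix \<kappa> assume \<kappa>: "\<kappa> \<in> I"
        have si: "set_integrable lborel (cube (1 / real (Suc m)) \<kappa>) (w i)" for i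
          unfolding set_integrable_def by (rule integrable_mult_indicator[OF _ wi]) simp
        have "(LINT x:cube (1 / real (Suc m)) \<kappa>|lborel. h x) = f (s k) (m, \<kappa>) - f (s l) (m, \<kappa>)"
          unfolding h_def f_def prod.case by (rule set_integral_diff(2)[OF si si])
        moreover have "norm (f (s k) (m, \<kappa>) - f (s l) (m, \<kappa>)) < \<eta>"
          by (rule N) (use N'[OF \<kappa>] kl in auto)
        ultimately show "(norm (LINT x:cube (1 / real (Suc m)) \<kappa>|lborel. h x))\<^sup>2 \<le> \<eta>\<^sup>2"
          by (simp add: power_mono less_imp_le)
      qed
      have "(LINT x|lborel. (norm (h x))\<^sup>2) \<le>
        \<epsilon> * ((LINT x|lborel. (\<Sum>j\<in>UNIV. (norm (twisted \<phi> j h x))\<^sup>2)) + (LINT x|lborel. (norm (h x))\<^sup>2))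
        + c * (\<Sum>k\<in>I. (norm (LINT x:cube (1 / real (Suc m)) k|lborel. h x))\<^sup>2)"
        by (rule main[OF h h0])
      also have "\<dots> \<le> \<epsilon> * (4 * B2 + 4 * B1) + c * (real (card I) * \<eta>\<^sup>2)"
        by (intro add_mono mult_left_mono 1 2 3) (use \<epsilon> I in auto)
      also have "\<epsilon> * (4 * B2 + 4 * B1) = e / 2" using B12 by (simp add: \<epsilon>_def field_simps)
      also have "c * (real (card I) * \<eta>\<^sup>2) \<le> e / 2"
      proof -
        have "c * (real (card I) * \<eta>\<^sup>2) \<le> D * \<eta>\<^sup>2" by (simp add: D_def algebra_simps)
        also have "\<dots> = e / 2" using D e by (simp add: \<eta>_def)
        finally show ?thesis .
      qed
      finally have le: "(LINT x|lborel. (norm (h x))\<^sup>2) \<le> e" by simp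
      have "l2sq h < \<infinity>" by (rule order_le_less_trans[OF h_l2]) simp
      from l2sq_leI[OF hm this le] show ?thesis by (simp add: h_def)
    qed
    then show ?thesis by blast
  qed
  obtain g where g [measurable]: "g \<in> borel_measurable borel"
    and lim: "\<And>e::real. e > 0 \<Longrightarrow> \<exists>N. \<forall>k\<ge>N. l2sq (\<lambda>x. w (s k) x - g x) \<le> ennreal e"
    by (rule l2sq_complete[of "\<lambda>k. w (s k)", OF w_m cauchy]) auto
  have "\<exists>N. \<forall>k\<ge>N. l2sq (\<lambda>x. u (s k) x - g x) \<le> ennreal e" if e: "e > 0" for e :: real
  proof -
    obtain N1 where N1: "\<And>k. k \<ge> N1 \<Longrightarrow> l2sq (\<lambda>x. w (s k) x - g x) \<le> ennreal (e / 4)"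
      using lim[of "e / 4"] e by auto
    obtain N2 :: nat where N2: "1 / real (Suc N2) < e / 4"
      using reals_Archimedean[of "e / 4"] e by (auto simp: inverse_eq_divide)
    have "l2sq (\<lambda>x. u (s k) x - g x) \<le> ennreal e" if k: "k \<ge> max N1 N2" for k
    proof -
      have "real (Suc N2) \<le> real (Suc (s k))"
        using k seq_suble[OF s, of k] by simp
      then have "1 / real (Suc (s k)) \<le> 1 / real (Suc N2)" by (intro divide_left_mono) auto
      then have "1 / real (Suc (s k)) \<le> e / 4" using N2 by linarith
      then have "l2sq (\<lambda>x. w (s k) x - u (s k) x) \<le> ennreal (e / 4)"
        using wu[of "s k"] ennreal_leI order_trans by blast
      then have "l2sq (\<lambda>x. u (s k) x - w (s k) x) \<le> ennreal (e / 4)"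
        by (simp add: l2sq_def norm_minus_commute)
      then have "l2sq (\<lambda>x. (u (s k) x - w (s k) x) + (w (s k) x - g x)) \<le> 2 * ennreal (e / 4) + 2 * ennreal (e / 4)"
        using N1[of k] k by (intro order_trans[OF l2sq_add] add_mono mult_left_mono) auto
      also have "\<dots> = ennreal (2 * (e / 4) + 2 * (e / 4))" by (rule two_ennreal_add) (use e in auto)
      finally show ?thesis by simp
    qed
    then show ?thesis by blast
  qed
  moreover have "l2sq g < \<infinity>"
  proof -
    obtain k where k: "l2sq (\<lambda>x. w (s k) x - g x) \<le> ennreal 1" using lim[of 1] by auto
    have "l2sq (\<lambda>x. w (s k) x - (w (s k) x - g x)) \<le> 2 * l2sq (w (s k)) + 2 * l2sq (\<lambda>x. w (s k) x - g x)"
      by (rule l2sq_diff) measurable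
    also have "\<dots> \<le> 2 * ennreal B1 + 2 * ennreal 1"
      by (intro add_mono mult_left_mono w_l2 k) auto
    finally have "l2sq (\<lambda>x. w (s k) x - (w (s k) x - g x)) \<le> 2 * ennreal B1 + 2 * ennreal 1" .
    then have "l2sq g \<le> 2 * ennreal B1 + 2 * ennreal 1" by simp
    also have "\<dots> < \<infinity>" by (simp add: ennreal_mult_less_top)
    finally show ?thesis .
  qed
  ultimately show thesis using g s by (intro that)
qed

section \<open>Weighted spaces\<close>

text \<open>The weighted spaces consist of Lebesgue measurable functions, whereas the estimates are
  made for Borel functions and \<open>lborel\<close>; this lemma links the two, applied to real and
  imaginary part.\<close>

lemma lebesgue_borel_version:
  fixes f :: "real^'n::finite \<Rightarrow> complex"
  assumes [measurable]: "f \<in> borel_measurable lebesgue"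
  obtains f' where "f' \<in> borel_measurable borel" "AE x in lborel. f x = f' x"
proof -
  have "(\<lambda>x. Re (f x)) \<in> borel_measurable lebesgue" "(\<lambda>x. Im (f x)) \<in> borel_measurable lebesgue"
    by measurable
  from this[THEN completion_ex_borel_measurable_real]
  obtain a b where [measurable]: "a \<in> borel_measurable lborel" "b \<in> borel_measurable lborel"
    and ab: "AE x in lborel. Re (f x) = a x" "AE x in lborel. Im (f x) = b x"
    by blast
  have "AE x in lborel. f x = Complex (a x) (b x)"
    using ab by eventually_elim (simp add: complex_eq_iff)
  moreover have "(\<lambda>x. Complex (a x) (b x)) \<in> borel_measurable borel"
    unfolding Complex_eq by measurable
  ultimately show thesis by (intro that)
qed

lemma lebesgue_integral_version:
  fixes f g :: "real^'n::finite \<Rightarrow> complex"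
  assumes f: "f \<in> borel_measurable lebesgue" and g: "g \<in> borel_measurable borel" and eq: "AE x in lborel. f x = g x"
  shows "(LINT x|lebesgue. f x) = (LINT x|lborel. g x)"
proof -
  have g': "g \<in> borel_measurable lborel" using g by simp
  have "(LINT x|lebesgue. f x) = (LINT x|lebesgue. g x)"
    by (rule integral_cong_AE[OF f measurable_completion[OF g']]) (rule AE_completion[OF eq])
  also have "\<dots> = (LINT x|lborel. g x)" by (rule integral_completion[OF g'])
  finally show ?thesis .
qed

lemma lebesgue_measurable_continuous:
  fixes f :: "real^'n::finite \<Rightarrow> 'b::{second_countable_topology, real_normed_vector}"
  assumes "continuous_on UNIV f"
  shows "f \<in> borel_measurable lebesgue"
proof -
  have "f \<in> borel_measurable lborel" using borel_measurable_continuous_onI[OF assms] by simp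
  then show ?thesis by (rule measurable_completion)
qed

lemma l2sq_weighted:
  assumes "AE x in lborel. u x = exp (- \<phi> x / 2) *\<^sub>R f x"
  shows "l2sq u = (\<integral>\<^sup>+x. ennreal ((cmod (f x))\<^sup>2 * exp (- \<phi> x)) \<partial>lebesgue)"
  unfolding l2sq_def nn_integral_completion
proof (rule nn_integral_cong_AE)
  show "AE x in lborel. ennreal ((cmod (u x))\<^sup>2) = ennreal ((cmod (f x))\<^sup>2 * exp (- \<phi> x))"
    using assms
  proof eventually_elim
    case (elim x)
    have "(exp (- \<phi> x / 2))\<^sup>2 = exp (- \<phi> x)" by (simp add: exp_double[symmetric])
    with elim show ?case by (simp add: power_mult_distrib mult.commute)
  qed
qed

lemma L2_norm_l2sq:
  assumes "f \<in> L2 \<phi>" "AE x in lborel. u x = exp (- \<phi> x / 2) *\<^sub>R f x"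
  shows "l2sq u = ennreal ((L2_norm \<phi> f)\<^sup>2)"
proof -
  have i: "integrable lebesgue (\<lambda>x. (cmod (f x))\<^sup>2 * exp (- \<phi> x))" using assms(1) by (simp add: L2_def)
  have "0 \<le> (LINT x|lebesgue. (cmod (f x))\<^sup>2 * exp (- \<phi> x))" by (rule Bochner_Integration.integral_nonneg) simp
  then show ?thesis
    unfolding L2_norm_def l2sq_weighted[OF assms(2)] by (simp add: nn_integral_eq_integral[OF i])
qed

lemma L2_l2sq:
  fixes \<phi> :: "real^'n::finite \<Rightarrow> real"
  assumes \<phi>: "smooth \<phi>" and f [measurable]: "f \<in> borel_measurable lebesgue"
    and eq: "AE x in lborel. u x = exp (- \<phi> x / 2) *\<^sub>R f x" and fin: "l2sq u < \<infinity>"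
  shows "f \<in> L2 \<phi>"
proof -
  have [measurable]: "\<phi> \<in> borel_measurable lebesgue"
    by (rule lebesgue_measurable_continuous[OF smooth_continuous_on[OF \<phi>]])
  have "integrable lebesgue (\<lambda>x. (cmod (f x))\<^sup>2 * exp (- \<phi> x))"
    using fin unfolding l2sq_weighted[OF eq] by (intro integrableI_bounded) simp_all
  then show ?thesis by (simp add: L2_def)
qed

lemma L2_version:
  fixes \<phi> :: "real^'n::finite \<Rightarrow> real"
  assumes \<phi>: "smooth \<phi>" and f: "f \<in> L2 \<phi>"
  obtains u where "u \<in> borel_measurable borel" "AE x in lborel. u x = exp (- \<phi> x / 2) *\<^sub>R f x"
    "l2sq u = ennreal ((L2_norm \<phi> f)\<^sup>2)"
proof -
  have "f \<in> borel_measurable lebesgue" using f by (simp add: L2_def)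
  then obtain f' where f' [measurable]: "f' \<in> borel_measurable borel" and ff': "AE x in lborel. f x = f' x"
    by (rule lebesgue_borel_version)
  have [measurable]: "\<phi> \<in> borel_measurable borel"
    by (rule borel_measurable_continuous_onI[OF smooth_continuous_on[OF \<phi>]])
  have eq: "AE x in lborel. exp (- \<phi> x / 2) *\<^sub>R f' x = exp (- \<phi> x / 2) *\<^sub>R f x"
    using ff' by eventually_elim simp
  show thesis
    by (rule that[OF _ eq L2_norm_l2sq[OF f eq]]) measurable
qed

text \<open>Under the substitution \<open>u = exp(-\<phi>/2) f\<close> the distributional derivatives (\<open>c = 0\<close>) become twisted
  derivatives for \<open>\<phi>\<close>, and the operators \<open>X\<^sub>j\<close> (\<open>c = 1\<close>) become twisted derivatives for \<open>-\<phi>\<close>.\<close>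

lemma weak_twisted_of_distribution:
  fixes \<phi> \<theta> :: "real^'n::finite \<Rightarrow> real"
  assumes \<phi>: "smooth \<phi>" and \<theta>: "\<And>x. partial j \<theta> x = (1 - 2 * c) * partial j \<phi> x"
    and f: "f \<in> borel_measurable lebesgue" and g: "g \<in> borel_measurable lebesgue"
    and u: "u \<in> borel_measurable borel" "AE x in lborel. u x = exp (- \<phi> x / 2) *\<^sub>R f x" "l2sq u < \<infinity>"
    and G: "G \<in> borel_measurable borel" "AE x in lborel. G x = exp (- \<phi> x / 2) *\<^sub>R g x" "l2sq G < \<infinity>"
    and weak: "\<And>\<psi>. \<psi> \<in> test_functions \<Longrightarrow> - (LINT x|lebesgue. f x * partial j \<psi> x)
      - of_real c * (LINT x|lebesgue. f x * (complex_of_real (partial j \<phi> x) * \<psi> x)) = (LINT x|lebesgue. g x * \<psi> x)"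
  shows "weak_twisted \<theta> j u G"
  unfolding weak_twisted_def
proof
  fix \<psi> :: "real^'n \<Rightarrow> complex" assume \<psi>: "\<psi> \<in> test_functions"
  obtain R where sm: "smooth \<psi>" and R: "\<And>x. norm x > R \<Longrightarrow> \<psi> x = 0" using test_functionsE[OF \<psi>] by blast
  have pR: "partial i \<psi> x = 0" if "norm x > R" for i x by (rule partial_eq_0_cball[OF R that])
  \<comment> \<open>The weight is placed in the test function: testing the equation for f with a *
    \<psi> replaces f by u almost everywhere, and the derivative of a produces half of
    \<open>partial j \<phi>\<close>.\<close>
  define a where "a = (\<lambda>x. exp (\<phi> x * (- 1 / 2)))"
  have a: "smooth a" unfolding a_def by (intro smooth_exp smooth_mult \<phi> smooth_const)
  have a_eq: "a x = exp (- \<phi> x / 2)" for x by (simp add: a_def)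
  have u2: "AE x in lborel. u x = a x *\<^sub>R f x" and G2: "AE x in lborel. G x = a x *\<^sub>R g x"
    using u(2) G(2) by (simp_all add: a_eq)
  have pa: "partial j a x = - (partial j \<phi> x / 2) * a x" for x
  proof -
    have "partial j (\<lambda>x. \<phi> x * (- 1 / 2)) x = \<phi> x * partial j (\<lambda>x. - 1 / 2) x + partial j \<phi> x * (- 1 / 2)"
      by (rule partial_mult[OF smooth_differentiable[OF \<phi>] smooth_differentiable[OF smooth_const]])
    then have "partial j (\<lambda>x. \<phi> x * (- 1 / 2)) x = partial j \<phi> x * (- 1 / 2)"
      by (simp only: partial_const mult_zero_right add_0_left)
    moreover have "(\<lambda>x. \<phi> x * (- 1 / 2)) differentiable (at x)"
      by (intro smooth_differentiable smooth_mult \<phi> smooth_const)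
    ultimately show ?thesis
      unfolding a_def by (simp only: partial_exp) (simp only: mult_minus_left mult_minus_right minus_divide_left[symmetric] times_divide_eq_right mult_1_right mult.commute)
  qed
  let ?\<psi> = "\<lambda>x. complex_of_real (a x) * \<psi> x"
  have \<psi>': "?\<psi> \<in> test_functions" by (rule test_functions_mult[OF a \<psi>])
  have c: "continuous_on UNIV \<psi>" "continuous_on UNIV (partial j \<psi>)" "continuous_on UNIV (partial j \<phi>)" "continuous_on UNIV a"
    by (intro smooth_continuous_on smooth_partial a sm \<phi>)+
  have c': "continuous_on UNIV ?\<psi>" "continuous_on UNIV (partial j ?\<psi>)"
    by (intro smooth_continuous_on smooth_partial smooth_mult smooth_of_real a sm)+
  have cm [measurable]: "\<psi> \<in> borel_measurable borel" "partial j \<psi> \<in> borel_measurable borel" "partial j \<phi> \<in> borel_measurable borel"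
    by (intro borel_measurable_continuous_onI c)+
  note [measurable] = u(1) G(1)
  have i1: "integrable lborel (\<lambda>x. u x * partial j \<psi> x)"
    by (rule integrable_l2_mult[OF u(1,3) c(2) pR])
  have i2: "integrable lborel (\<lambda>x. u x * ((partial j \<phi> x / 2) *\<^sub>R \<psi> x))"
    by (rule integrable_l2_mult[OF u(1,3), of _ R]) (auto intro!: continuous_intros c simp: R)
  have i3: "integrable lborel (\<lambda>x. G x * \<psi> x)"
    by (rule integrable_l2_mult[OF G(1,3) c(1) R])
  have 1: "(LINT x|lebesgue. f x * partial j ?\<psi> x) = (LINT x|lborel. u x * partial j \<psi> x - u x * ((partial j \<phi> x / 2) *\<^sub>R \<psi> x))"
  proof (rule lebesgue_integral_version)
    show "(\<lambda>x. f x * partial j ?\<psi> x) \<in> borel_measurable lebesgue"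
      by (intro borel_measurable_times f lebesgue_measurable_continuous c')
    show "AE x in lborel. f x * partial j ?\<psi> x = u x * partial j \<psi> x - u x * ((partial j \<phi> x / 2) *\<^sub>R \<psi> x)"
      using u2
    proof eventually_elim
      case (elim x)
      then show ?case
        unfolding partial_of_real_mult[OF a sm] pa elim
        by (simp add: scaleR_conv_of_real algebra_simps)
    qed
  qed measurable
  have 2: "(LINT x|lebesgue. f x * (complex_of_real (partial j \<phi> x) * ?\<psi> x)) = (LINT x|lborel. 2 * (u x * ((partial j \<phi> x / 2) *\<^sub>R \<psi> x)))"
  proof (rule lebesgue_integral_version)
    show "(\<lambda>x. f x * (complex_of_real (partial j \<phi> x) * ?\<psi> x)) \<in> borel_measurable lebesgue"
      by (intro borel_measurable_times f lebesgue_measurable_continuous c' continuous_on_of_real c)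
    show "AE x in lborel. f x * (complex_of_real (partial j \<phi> x) * ?\<psi> x) = 2 * (u x * ((partial j \<phi> x / 2) *\<^sub>R \<psi> x))"
      using u2
    proof eventually_elim
      case (elim x)
      then show ?case unfolding elim by (simp add: scaleR_conv_of_real)
    qed
  qed measurable
  have 3: "(LINT x|lebesgue. g x * ?\<psi> x) = (LINT x|lborel. G x * \<psi> x)"
  proof (rule lebesgue_integral_version)
    show "(\<lambda>x. g x * ?\<psi> x) \<in> borel_measurable lebesgue"
      by (intro borel_measurable_times g lebesgue_measurable_continuous c')
    show "AE x in lborel. g x * ?\<psi> x = G x * \<psi> x"
      using G2
    proof eventually_elim
      case (elim x)
      then show ?case unfolding elim by (simp add: scaleR_conv_of_real)
    qed
  qed measurable
  define P where "P = (LINT x|lborel. u x * ((partial j \<phi> x / 2) *\<^sub>R \<psi> x))"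
  \<comment> \<open>One P comes from differentiating the weight, and - 2c P from the multiplication
    term, whose coefficient is \<open>partial j \<phi>\<close> rather than its half. Together they
    give the factor 1 - 2c of \<theta>.\<close>
  have key: "(LINT x|lborel. u x * partial j \<psi> x) = P - of_real (2 * c) * P - (LINT x|lborel. G x * \<psi> x)"
    using weak[OF \<psi>'] unfolding 1 2 3 Bochner_Integration.integral_diff[OF i1 i2] integral_mult_right_zero P_def[symmetric]
    by (simp add: algebra_simps)
  have "(\<lambda>x. (G x - (partial j \<theta> x / 2) *\<^sub>R u x) * \<psi> x)
     = (\<lambda>x. G x * \<psi> x - of_real (1 - 2 * c) * (u x * ((partial j \<phi> x / 2) *\<^sub>R \<psi> x)))"
    unfolding \<theta> by (simp add: fun_eq_iff scaleR_conv_of_real algebra_simps)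
  then have "(LINT x|lborel. (G x - (partial j \<theta> x / 2) *\<^sub>R u x) * \<psi> x) = (LINT x|lborel. G x * \<psi> x) - of_real (1 - 2 * c) * P"
    using i2 i3 by (simp only: P_def Bochner_Integration.integral_diff integrable_mult_right integral_mult_right_zero)
  then show "(LINT x|lborel. u x * partial j \<psi> x) = - (LINT x|lborel. (G x - (partial j \<theta> x / 2) *\<^sub>R u x) * \<psi> x)"
    unfolding key by (simp add: algebra_simps)
qed

theorem L2_compactness:
  fixes \<phi> \<theta> :: "real^'n::finite \<Rightarrow> real" and f :: "nat \<Rightarrow> real^'n \<Rightarrow> complex"
    and g :: "nat \<Rightarrow> 'n \<Rightarrow> real^'n \<Rightarrow> complex"
  assumes \<phi>: "smooth \<phi>" and \<theta>: "smooth \<theta>" "\<And>j x. partial j \<theta> x = (1 - 2 * c) * partial j \<phi> x"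
    and sb: "semibounded_below (potential \<theta>)" and \<gamma>: "\<gamma> > 0" and div: "diverges_off_small_sets (potential \<theta>) \<gamma>"
    and f: "\<And>k. f k \<in> L2 \<phi>" and g: "\<And>k j. g k j \<in> L2 \<phi>"
    and weak: "\<And>k j \<psi>. \<psi> \<in> test_functions \<Longrightarrow> - (LINT x|lebesgue. f k x * partial j \<psi> x)
      - of_real c * (LINT x|lebesgue. f k x * (complex_of_real (partial j \<phi> x) * \<psi> x)) = (LINT x|lebesgue. g k j x * \<psi> x)"
    and bound: "\<And>k. sqrt ((L2_norm \<phi> (f k))\<^sup>2 + (\<Sum>j\<in>UNIV. (L2_norm \<phi> (g k j))\<^sup>2)) \<le> K"
  shows "\<exists>h\<in>L2 \<phi>. \<exists>s. strict_mono s \<and> (\<lambda>k. L2_norm \<phi> (\<lambda>x. f (s k) x - h x)) \<longlonglongrightarrow> 0"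
proof -
  have fm: "f k \<in> borel_measurable lebesgue" and gm: "g k j \<in> borel_measurable lebesgue" for k j
    using f[of k] g[of k j] by (auto simp: L2_def)
  define version where "version = (\<lambda>f u. u \<in> borel_measurable borel \<and>
    (AE x in lborel. u x = exp (- \<phi> x / 2) *\<^sub>R f x) \<and> l2sq u = ennreal ((L2_norm \<phi> f)\<^sup>2))"
  have ex: "\<exists>u. version f u" if "f \<in> L2 \<phi>" for f
    unfolding version_def by (rule L2_version[OF \<phi> that]) blast
  obtain u where "\<And>k. version (f k) (u k)" using ex[OF f] by metis
  then have u: "u k \<in> borel_measurable borel" "AE x in lborel. u k x = exp (- \<phi> x / 2) *\<^sub>R f k x"
    and u_l2: "l2sq (u k) = ennreal ((L2_norm \<phi> (f k))\<^sup>2)" for k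
    unfolding version_def by blast+
  obtain G where "\<And>k j. version (g k j) (G k j)" using ex[OF g] by metis
  then have G: "G k j \<in> borel_measurable borel" "AE x in lborel. G k j x = exp (- \<phi> x / 2) *\<^sub>R g k j x"
    and G_l2: "l2sq (G k j) = ennreal ((L2_norm \<phi> (g k j))\<^sup>2)" for k j
    unfolding version_def by blast+
  have sq: "(L2_norm \<phi> (f k))\<^sup>2 + (\<Sum>j\<in>UNIV. (L2_norm \<phi> (g k j))\<^sup>2) \<le> K\<^sup>2" for k
    using bound[of k] by (rule sqrt_le_D)
  have S0: "0 \<le> (\<Sum>j\<in>UNIV. (L2_norm \<phi> (g k j))\<^sup>2)" for k by (simp add: sum_nonneg)
  have b1: "l2sq (u k) \<le> ennreal (K\<^sup>2)" for k
    unfolding u_l2 by (rule ennreal_leI) (use sq[of k] S0[of k] in linarith)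
  have b2: "(\<Sum>j\<in>UNIV. l2sq (G k j)) \<le> ennreal (K\<^sup>2)" for k
  proof -
    have "(\<Sum>j\<in>UNIV. l2sq (G k j)) = ennreal (\<Sum>j\<in>UNIV. (L2_norm \<phi> (g k j))\<^sup>2)"
      unfolding G_l2 by (simp add: sum_ennreal)
    also have "\<dots> \<le> ennreal (K\<^sup>2)"
      by (rule ennreal_leI) (use sq[of k] zero_le_power2[of "L2_norm \<phi> (f k)"] in linarith)
    finally show ?thesis .
  qed
  have wk: "weak_twisted \<theta> j (u k) (G k j)" for k j
    by (rule weak_twisted_of_distribution[OF \<phi> \<theta>(2) fm gm u _ G _ weak]) (simp_all add: u_l2 G_l2)
  obtain v s where v: "v \<in> borel_measurable borel" "l2sq v < \<infinity>" and s: "strict_mono (s :: nat \<Rightarrow> nat)"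
    and lim: "\<And>e::real. e > 0 \<Longrightarrow> \<exists>N. \<forall>k\<ge>N. l2sq (\<lambda>x. u (s k) x - v x) \<le> ennreal e"
    by (rule l2_compactness[where u=u and G=G, OF \<theta>(1) sb \<gamma> div u(1) G(1) wk zero_le_power2 b1 b2])
       (rule that; (assumption | blast))
  \<comment> \<open>Undoing the substitution turns the unweighted limit into one in the weighted
    space.\<close>
  define h where "h = (\<lambda>x. exp (\<phi> x / 2) *\<^sub>R v x)"
  have \<phi>m [measurable]: "\<phi> \<in> borel_measurable borel"
    by (rule borel_measurable_continuous_onI[OF smooth_continuous_on[OF \<phi>]])
  have "h \<in> borel_measurable lborel" using v(1) unfolding h_def by measurable
  then have hm: "h \<in> borel_measurable lebesgue" by (rule measurable_completion)
  have hv: "v x = exp (- \<phi> x / 2) *\<^sub>R h x" for x by (simp add: h_def exp_add[symmetric])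
  have hL: "h \<in> L2 \<phi>"
    by (rule L2_l2sq[OF \<phi> hm AE_I2[OF hv] v(2)])
  have diff: "l2sq (\<lambda>x. u (s k) x - v x) = ennreal ((L2_norm \<phi> (\<lambda>x. f (s k) x - h x))\<^sup>2)" for k
  proof (rule L2_norm_l2sq)
    show eq: "AE x in lborel. u (s k) x - v x = exp (- \<phi> x / 2) *\<^sub>R (f (s k) x - h x)"
      using u(2)[of "s k"] by eventually_elim (simp add: hv scaleR_right_diff_distrib)
    have "l2sq (\<lambda>x. u (s k) x - v x) \<le> 2 * l2sq (u (s k)) + 2 * l2sq v" by (rule l2sq_diff[OF u(1) v(1)])
    also have "\<dots> < \<infinity>" using v(2) by (simp add: u_l2 ennreal_mult_less_top)
    finally show "(\<lambda>x. f (s k) x - h x) \<in> L2 \<phi>"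
      by (rule L2_l2sq[OF \<phi> borel_measurable_diff[OF fm hm] eq])
  qed
  have "(\<lambda>k. L2_norm \<phi> (\<lambda>x. f (s k) x - h x)) \<longlonglongrightarrow> 0"
  proof (rule LIMSEQ_I)
    fix e :: real assume e: "e > 0"
    obtain N where N: "\<And>k. k \<ge> N \<Longrightarrow> l2sq (\<lambda>x. u (s k) x - v x) \<le> ennreal ((e / 2)\<^sup>2)"
      using lim[of "(e / 2)\<^sup>2"] e by auto
    have "norm (L2_norm \<phi> (\<lambda>x. f (s k) x - h x) - 0) < e" if "k \<ge> N" for k
    proof -
      have "(L2_norm \<phi> (\<lambda>x. f (s k) x - h x))\<^sup>2 \<le> (e / 2)\<^sup>2"
        using N[OF that] unfolding diff by (subst (asm) ennreal_le_iff) auto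
      then have "\<bar>L2_norm \<phi> (\<lambda>x. f (s k) x - h x)\<bar> \<le> e / 2"
        using e abs_le_square_iff[of "L2_norm \<phi> (\<lambda>x. f (s k) x - h x)" "e / 2"] by simp
      then show ?thesis using e by simp
    qed
    then show "\<exists>N. \<forall>k\<ge>N. norm (L2_norm \<phi> (\<lambda>x. f (s k) x - h x) - 0) < e" by blast
  qed
  with hL s show ?thesis by blast
qed

section \<open>Specialisation to the two weighted Sobolev spaces\<close>

lemma represents_SOME:
  "dist_in_L2 \<phi> T \<Longrightarrow> represents_in_L2 \<phi> (SOME g. represents_in_L2 \<phi> g T) T"
  unfolding dist_in_L2_def by (rule someI_ex[of "\<lambda>g. represents_in_L2 \<phi> g T"])

lemma partial_uminus:
  fixes \<phi> :: "real^'n::finite \<Rightarrow> real"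
  assumes "smooth \<phi>"
  shows "partial j (\<lambda>x. - \<phi> x) = (\<lambda>x. - partial j \<phi> x)"
  using partial_bounded_linear[OF bounded_linear_minus[OF bounded_linear_ident] smooth_differentiable[OF assms]]
  by (simp add: fun_eq_iff)

lemma potential_uminus:
  fixes \<phi> :: "real^'n::finite \<Rightarrow> real"
  assumes "smooth \<phi>"
  shows "potential (\<lambda>x. - \<phi> x) = (\<lambda>x. 1/4 * (norm (gradient \<phi> x))\<^sup>2 + 1/2 * laplacian \<phi> x)"
  by (simp add: fun_eq_iff potential_def norm_gradient_sq laplacian_def partial_uminus assms smooth_partial sum_negf)

theorem corollary1p5:
  fixes \<phi> V1 V2 :: "real^'n::finite \<Rightarrow> real"
  assumes "smooth \<phi>"
    and "V1 = (\<lambda>x. 1/4 * (norm (gradient \<phi> x))\<^sup>2 - 1/2 * laplacian \<phi> x)"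
    and "V2 = (\<lambda>x. 1/4 * (norm (gradient \<phi> x))\<^sup>2 + 1/2 * laplacian \<phi> x)"
  shows
    "(semibounded_below V1 \<and> (\<exists>\<gamma>>0. diverges_off_small_sets V1 \<gamma>)
        \<longrightarrow> compact_injection (H1 \<phi>) (H1_norm \<phi>) (L2 \<phi>) (L2_norm \<phi>)) \<and>
     (semibounded_below V2 \<and> (\<exists>\<gamma>>0. diverges_off_small_sets V2 \<gamma>)
        \<longrightarrow> compact_injection (H1_grad \<phi>) (H1_grad_norm \<phi>) (L2 \<phi>) (L2_norm \<phi>))"
proof (intro conjI impI; elim conjE exE)
  fix \<gamma> :: real
  assume sb: "semibounded_below V1" and \<gamma>: "\<gamma> > 0" and div: "diverges_off_small_sets V1 \<gamma>"
  have V1: "V1 = potential \<phi>" by (simp add: assms(2) potential_def[abs_def])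
  show "compact_injection (H1 \<phi>) (H1_norm \<phi>) (L2 \<phi>) (L2_norm \<phi>)"
    unfolding compact_injection_def
  proof (intro conjI allI impI; (elim conjE exE)?)
    show "H1 \<phi> \<subseteq> L2 \<phi>" by (auto simp: H1_def)
    fix f :: "nat \<Rightarrow> real^'n \<Rightarrow> complex" and K
    assume f: "\<forall>k. f k \<in> H1 \<phi>" and K: "\<forall>k. H1_norm \<phi> (f k) \<le> K"
    \<comment> \<open>The same choice as in \<open>dist_L2_norm\<close>, so that the bound on
      \<open>H1_norm\<close> is literally a bound on these representatives and their uniqueness
      almost everywhere is not called upon.\<close>
    define g where "g = (\<lambda>k j. SOME g. represents_in_L2 \<phi> g (dist_deriv j (regular_dist (f k))))"
    have g: "represents_in_L2 \<phi> (g k j) (dist_deriv j (regular_dist (f k)))" for k j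
      unfolding g_def using f by (intro represents_SOME) (simp add: H1_def)
    show "\<exists>h\<in>L2 \<phi>. \<exists>s. strict_mono s \<and> (\<lambda>k. L2_norm \<phi> (\<lambda>x. f (s k) x - h x)) \<longlonglongrightarrow> 0"
    proof (rule L2_compactness[where c=0 and \<theta>=\<phi> and g=g and K=K])
      show "f k \<in> L2 \<phi>" for k using f by (simp add: H1_def)
      show "g k j \<in> L2 \<phi>" for k j using g[of k j] by (simp add: represents_in_L2_def)
      show "- (LINT x|lebesgue. f k x * partial j \<psi> x)
        - of_real 0 * (LINT x|lebesgue. f k x * (complex_of_real (partial j \<phi> x) * \<psi> x)) = (LINT x|lebesgue. g k j x * \<psi> x)"
        if "\<psi> \<in> test_functions" for k j \<psi>
        using g[of k j] that by (simp add: represents_in_L2_def dist_deriv_def regular_dist_def)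
      show "sqrt ((L2_norm \<phi> (f k))\<^sup>2 + (\<Sum>j\<in>UNIV. (L2_norm \<phi> (g k j))\<^sup>2)) \<le> K" for k
        using K by (simp add: H1_norm_def dist_L2_norm_def g_def)
    qed (use assms(1) sb \<gamma> div in \<open>simp_all add: V1\<close>)
  qed
next
  fix \<gamma> :: real
  assume sb: "semibounded_below V2" and \<gamma>: "\<gamma> > 0" and div: "diverges_off_small_sets V2 \<gamma>"
  have V2: "V2 = potential (\<lambda>x. - \<phi> x)" by (simp add: assms(3) potential_uminus[OF assms(1)])
  show "compact_injection (H1_grad \<phi>) (H1_grad_norm \<phi>) (L2 \<phi>) (L2_norm \<phi>)"
    unfolding compact_injection_def
  proof (intro conjI allI impI; (elim conjE exE)?)
    show "H1_grad \<phi> \<subseteq> L2 \<phi>" by (auto simp: H1_grad_def)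
    fix f :: "nat \<Rightarrow> real^'n \<Rightarrow> complex" and K
    assume f: "\<forall>k. f k \<in> H1_grad \<phi>" and K: "\<forall>k. H1_grad_norm \<phi> (f k) \<le> K"
    define g where "g = (\<lambda>k j. SOME g. represents_in_L2 \<phi> g (X_op \<phi> j (regular_dist (f k))))"
    have g: "represents_in_L2 \<phi> (g k j) (X_op \<phi> j (regular_dist (f k)))" for k j
      unfolding g_def using f by (intro represents_SOME) (simp add: H1_grad_def)
    show "\<exists>h\<in>L2 \<phi>. \<exists>s. strict_mono s \<and> (\<lambda>k. L2_norm \<phi> (\<lambda>x. f (s k) x - h x)) \<longlonglongrightarrow> 0"
    \<comment> \<open>For \<open>c = 1\<close> the factor 1 - 2c is -1, so the twisting function is
      - \<phi>, whose potential is V2.\<close>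
    proof (rule L2_compactness[where c=1 and \<theta>="\<lambda>x. - \<phi> x" and g=g and K=K])
      show "smooth (\<lambda>x. - \<phi> x)"
        using smooth_bounded_linear[OF bounded_linear_minus[OF bounded_linear_ident] assms(1)] by simp
      show "f k \<in> L2 \<phi>" for k using f by (simp add: H1_grad_def)
      show "g k j \<in> L2 \<phi>" for k j using g[of k j] by (simp add: represents_in_L2_def)
      show "- (LINT x|lebesgue. f k x * partial j \<psi> x)
        - of_real 1 * (LINT x|lebesgue. f k x * (complex_of_real (partial j \<phi> x) * \<psi> x)) = (LINT x|lebesgue. g k j x * \<psi> x)"
        if "\<psi> \<in> test_functions" for k j \<psi>
        using g[of k j] that
        by (simp add: represents_in_L2_def X_op_def dist_mult_def dist_deriv_def regular_dist_def)
      show "sqrt ((L2_norm \<phi> (f k))\<^sup>2 + (\<Sum>j\<in>UNIV. (L2_norm \<phi> (g k j))\<^sup>2)) \<le> K" for k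
        using K by (simp add: H1_grad_norm_def dist_L2_norm_def g_def)
    qed (use assms(1) sb \<gamma> div in \<open>simp_all add: V2 partial_uminus\<close>)
  qed
qed

end
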